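(* Let $(\varphi_t)_{t\ge0}$ be a hyperbolic semiflow whose Koenigs domain $\Omega$ satisfies that $\operatorname{int}(\overline{\Omega})=\Omega$ and that $\mathbb{C}\setminus\overline{\Omega}$ has at most two connected components, and let $\mathcal{T}=(C_{\varphi_t})_{t\ge0}$ be its associated $C_0$-semigroup acting on $H^p$ for $1\le p<\infty$. Then $\mathcal{T}'$ is abelian and does not contain any non-trivial idempotent.
   Context: $\mathbb{D}$ is the open unit disc of $\mathbb{C}$ and $\mathbb{T}$ the unit circle. For $1\le p<\infty$, $H^p$ is the Banach space of holomorphic $f:\mathbb{D}\to\mathbb{C}$ with $\|f\|_{H^p}=\left(\sup_{0<r<1}\int_0^{2\pi}|f(re^{i\theta})|^p\,d\theta\right)^{1/p}<\infty$. For holomorphic $\varphi:\mathbb{D}\to\mathbb{D}$, $C_\varphi f=f\circ\varphi$, a bounded operator on $H^p$. $\mathcal{L}(H^p)$ is the algebra of bounded linear operators on $H^p$; $\{T\}'=\{A\in\mathcal{L}(H^p):AT=TA\}$. For the semigroup $\mathcal{T}=(C_{\varphi_t})_{t\ge0}$, $\mathcal{T}'=\bigcap_{t>0}\{C_{\varphi_t}\}'$. A non-trivial idempotent is $J\in\mathcal{L}(H^p)$ with $J^2=J$, $J\ne 0$, $J\neq \mathrm{Id}$. Semiflows. A holomorphic semiflow is a family $(\varphi_t)_{t\ge0}$ of holomorphic self-maps of $\mathbb{D}$ with $\varphi_0(z)=z$, $\varphi_{t+s}=\varphi_t\circ\varphi_s$ for all $t,s\geq 0$, and $\varphi_t\to\varphi_s$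 uniformly on compact subsets of $\mathbb{D}$ as $t\to s$. It is elliptic if $\varphi_{t_0}(z_0)=z_0$ for some $t_0>0$ and $z_0\in\mathbb{D}$. If it is not elliptic, there is a unique $\tau\in\mathbb{T}$ (the Denjoy–Wolff point) such that $\varphi_t\to\tau$ uniformly on compact subsets as $t\to\infty$, and there is $\alpha\le 0$ such that $\varphi_t'$ has non-tangential limit $e^{t\alpha}$ at $\tau$ for all $t\geq 0$; the semiflow is hyperbolic if $\alpha<0$ and parabolic if $\alpha=0$. For a non-elliptic semiflow there is a univalent function $h:\mathbb{D}\to\mathbb{C}$ (the Koenigs function), unique up to an additive constant, with $\varphi_t(z)=h^{-1}(h(z)+t)$ for all $z\in\mathbb{D}$, $t\ge0$. The Koenigs domain is $\Omega=h(\mathbb{D})$. Interior and closure are taken in $\mathbb{C}$. *)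

theory Defs
  imports "HOL-Complex_Analysis.Complex_Analysis" "HOL-Library.FuncSet"
begin

abbreviation unit_disc :: "complex set" where
  "unit_disc \<equiv> ball 0 1"


subsection \<open>Hardy spaces and their operators\<close>

definition hardy_mean :: "real \<Rightarrow> (complex \<Rightarrow> complex) \<Rightarrow> real \<Rightarrow> real" where
  "hardy_mean p f r = integral {0..2 * pi} (\<lambda>\<theta>. cmod (f (of_real r * cis \<theta>)) powr p)"

text \<open>Functions on the disc are represented by total functions vanishing outside the disc, so that
  equality in the Hardy space is equality of functions.\<close>

definition hardy_space :: "real \<Rightarrow> (complex \<Rightarrow> complex) set" where
  "hardy_space p = {f. f holomorphic_on unit_disc \<and> (\<forall>z. z \<notin> unit_disc \<longrightarrow> f z = 0) \<and>
     bdd_above (hardy_mean p f ` {0<..<1})}"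

definition hardy_norm :: "real \<Rightarrow> (complex \<Rightarrow> complex) \<Rightarrow> real" where
  "hardy_norm p f = (SUP r\<in>{0<..<1}. hardy_mean p f r) powr (1 / p)"

text \<open>Operators are likewise extensional on the Hardy space, so that equality of operators is
  equality of functions; products of operators are formed with \<^const>\<open>compose\<close>.\<close>

definition bounded_operators ::
  "real \<Rightarrow> ((complex \<Rightarrow> complex) \<Rightarrow> (complex \<Rightarrow> complex)) set" where
  "bounded_operators p = {A \<in> hardy_space p \<rightarrow>\<^sub>E hardy_space p.
     (\<forall>f\<in>hardy_space p. \<forall>g\<in>hardy_space p. A (\<lambda>z. f z + g z) = (\<lambda>z. A f z + A g z)) \<and>
     (\<forall>c. \<forall>f\<in>hardy_space p. A (\<lambda>z. c * f z) = (\<lambda>z. c * A f z)) \<and>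
     (\<exists>C. \<forall>f\<in>hardy_space p. hardy_norm p (A f) \<le> C * hardy_norm p f)}"

definition zero_operator :: "real \<Rightarrow> (complex \<Rightarrow> complex) \<Rightarrow> (complex \<Rightarrow> complex)" where
  "zero_operator p = (\<lambda>f\<in>hardy_space p. (\<lambda>z. 0))"

definition id_operator :: "real \<Rightarrow> (complex \<Rightarrow> complex) \<Rightarrow> (complex \<Rightarrow> complex)" where
  "id_operator p = (\<lambda>f\<in>hardy_space p. f)"

definition composition_operator ::
  "real \<Rightarrow> (complex \<Rightarrow> complex) \<Rightarrow> (complex \<Rightarrow> complex) \<Rightarrow> (complex \<Rightarrow> complex)" where
  "composition_operator p \<phi> =
     (\<lambda>f\<in>hardy_space p. (\<lambda>z. if z \<in> unit_disc then f (\<phi> z) else 0))"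

definition commutant ::
  "real \<Rightarrow> ((complex \<Rightarrow> complex) \<Rightarrow> (complex \<Rightarrow> complex)) \<Rightarrow>
   ((complex \<Rightarrow> complex) \<Rightarrow> (complex \<Rightarrow> complex)) set" where
  "commutant p T = {A \<in> bounded_operators p.
     compose (hardy_space p) A T = compose (hardy_space p) T A}"

definition semigroup_commutant ::
  "real \<Rightarrow> (real \<Rightarrow> complex \<Rightarrow> complex) \<Rightarrow>
   ((complex \<Rightarrow> complex) \<Rightarrow> (complex \<Rightarrow> complex)) set" where
  "semigroup_commutant p \<phi> = (\<Inter>t\<in>{0<..}. commutant p (composition_operator p (\<phi> t)))"

definition nontrivial_idempotent ::
  "real \<Rightarrow> ((complex \<Rightarrow> complex) \<Rightarrow> (complex \<Rightarrow> complex)) \<Rightarrow> bool" where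
  "nontrivial_idempotent p J \<longleftrightarrow> J \<in> bounded_operators p \<and>
     compose (hardy_space p) J J = J \<and> J \<noteq> zero_operator p \<and> J \<noteq> id_operator p"


subsection \<open>Semiflows\<close>

text \<open>Only times \<open>t \<ge> 0\<close> and points of the disc are relevant; all other values of \<open>\<phi>\<close> are junk.\<close>

definition holomorphic_semiflow :: "(real \<Rightarrow> complex \<Rightarrow> complex) \<Rightarrow> bool" where
  "holomorphic_semiflow \<phi> \<longleftrightarrow>
     (\<forall>t\<ge>0. \<phi> t holomorphic_on unit_disc \<and> \<phi> t ` unit_disc \<subseteq> unit_disc) \<and>
     (\<forall>z\<in>unit_disc. \<phi> 0 z = z) \<and>
     (\<forall>t\<ge>0. \<forall>s\<ge>0. \<forall>z\<in>unit_disc. \<phi> (t + s) z = \<phi> t (\<phi> s z)) \<and>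
     (\<forall>s\<ge>0. \<forall>K. compact K \<and> K \<subseteq> unit_disc \<longrightarrow> uniform_limit K \<phi> (\<phi> s) (at s within {0..}))"

definition elliptic :: "(real \<Rightarrow> complex \<Rightarrow> complex) \<Rightarrow> bool" where
  "elliptic \<phi> \<longleftrightarrow> (\<exists>t>0. \<exists>z\<in>unit_disc. \<phi> t z = z)"

definition denjoy_wolff_point :: "(real \<Rightarrow> complex \<Rightarrow> complex) \<Rightarrow> complex \<Rightarrow> bool" where
  "denjoy_wolff_point \<phi> \<tau> \<longleftrightarrow> \<tau> \<in> sphere 0 1 \<and>
     (\<forall>K. compact K \<and> K \<subseteq> unit_disc \<longrightarrow> uniform_limit K \<phi> (\<lambda>z. \<tau>) at_top)"

definition stolz_region :: "complex \<Rightarrow> real \<Rightarrow> complex set" where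
  "stolz_region \<tau> M = {z \<in> unit_disc. cmod (z - \<tau>) < M * (1 - cmod z)}"

definition nontangential_limit :: "(complex \<Rightarrow> complex) \<Rightarrow> complex \<Rightarrow> complex \<Rightarrow> bool" where
  "nontangential_limit f \<tau> l \<longleftrightarrow> (\<forall>M>1. (f \<longlongrightarrow> l) (at \<tau> within stolz_region \<tau> M))"

text \<open>For a non-elliptic semiflow the point \<open>\<tau>\<close> and the exponent \<open>\<alpha>\<close> are uniquely determined, so
  the existential quantifiers below only name them.\<close>

definition hyperbolic_semiflow :: "(real \<Rightarrow> complex \<Rightarrow> complex) \<Rightarrow> bool" where
  "hyperbolic_semiflow \<phi> \<longleftrightarrow> holomorphic_semiflow \<phi> \<and> \<not> elliptic \<phi> \<and>
     (\<exists>\<tau> \<alpha>. denjoy_wolff_point \<phi> \<tau> \<and> \<alpha> < 0 \<and>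
        (\<forall>t\<ge>0. nontangential_limit (deriv (\<phi> t)) \<tau> (of_real (exp (t * \<alpha>)))))"

text \<open>The membership \<open>h z + t \<in> h ` unit_disc\<close> is implicit in the usual formula
  \<open>\<phi>\<^sub>t(z) = h\<inverse>(h(z) + t)\<close>; \<^const>\<open>inv_into\<close> is junk without it.\<close>

definition koenigs_function ::
  "(real \<Rightarrow> complex \<Rightarrow> complex) \<Rightarrow> (complex \<Rightarrow> complex) \<Rightarrow> bool" where
  "koenigs_function \<phi> h \<longleftrightarrow> h holomorphic_on unit_disc \<and> inj_on h unit_disc \<and>
     (\<forall>t\<ge>0. \<forall>z\<in>unit_disc. h z + of_real t \<in> h ` unit_disc \<and>
        \<phi> t z = inv_into unit_disc h (h z + of_real t))"

end

theory Submission
  imports Defs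
begin

text \<open>
  Fix \<open>z\<close> in the disc and consider the functional \<open>L f = A (B f) z - B (A f) z\<close> on the Hardy space, or
  \<open>L f = J f z\<close>, or \<open>L f = J f z - f z\<close>. For real \<open>y\<close> the function \<open>exp (\<i> y h)\<close> is bounded, because \<open>h\<close> maps
  into a horizontal strip, and composition with \<open>\<phi>\<^sub>t\<close> multiplies it by \<open>exp (\<i> y t)\<close>. An operator \<open>A\<close>
  in the commutant therefore maps it to a function with the same property, and the quotient of the two is
  invariant under the flow, hence constant: \<open>A (exp (\<i> y h)) = c(y) exp (\<i> y h)\<close>. So the first functional
  annihilates all these exponentials. For an idempotent, \<open>c\<close> takes the values 0 and 1 only and depends
  continuously on \<open>y\<close>, so it is constant, and one of the other two functionals annihilates the
  exponentials at every point. The theorem thus follows once a continuous functional that annihilates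
  all exponentials \<open>exp (\<i> y h)\<close> is known to be zero.

  This density statement has four steps, for \<open>\<Omega> = h(\<D>)\<close>.

  \<^item> Geometric series of exponentials approximate \<open>1 / (h - a)\<close> in mean square when \<open>a\<close> lies outside a
    strip containing \<open>\<Omega>\<close>. Both half planes outside the strip are covered, and every component of the
    complement of the closure of \<open>\<Omega>\<close> contains one of them; this is where the number of components
    enters. As \<open>a \<mapsto> L (1 / (h - a))\<close> is holomorphic there, it vanishes for every \<open>a\<close> off the closure
    (\<open>resolvent_zero\<close>).

  \<^item> If \<open>F\<close> is bounded and holomorphic on some \<open>\<epsilon>\<close>-neighbourhood of \<open>\<Omega>\<close>, then \<open>F\<close>, multiplied by a factor
    that decays at infinity, is a Cauchy integral over edges of a square lattice that avoid \<open>\<Omega>\<close>, hence a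
    uniform limit of combinations of the functions \<open>1 / (w - a)\<close> (\<open>Runge_weighted\<close>). So \<open>L (F \<circ> h) = 0\<close>.

  \<^item> The \<open>\<epsilon>\<close>-neighbourhoods of \<open>\<Omega>\<close> are simply connected because \<open>\<Omega>\<close> is invariant under translations to the
    right, and they shrink to the closure of \<open>\<Omega>\<close>, whose interior is \<open>\<Omega>\<close>. By Caratheodory's kernel
    theorem their Riemann maps \<open>v\<close>, suitably normalised, satisfy \<open>v \<circ> h \<longlonglongrightarrow> id\<close>
    (\<open>kernel_approximation\<close>). Since \<open>L (f \<circ> v \<circ> h) = 0\<close>, the functional annihilates every \<open>f\<close> that is
    holomorphic beyond the disc, and by dilation every bounded \<open>f\<close>.

  \<^item> Bounded functions are dense in the Hardy space (\<open>bounded_holomorphic_dense\<close>): if \<open>V\<close> is in the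
    Hardy space with exponent 2 and \<open>Re V\<close> dominates \<open>|f|\<close> to the power \<open>p / 2\<close>, then
    \<open>f (1 + \<epsilon> V)\<close> with the exponent \<open>-2 / p\<close> on the bracket is bounded and tends to \<open>f\<close> as \<open>\<epsilon> \<longlonglongrightarrow> 0\<close>.

  All convergence of bounded functions is measured in mean square over circles, where it can be read
  off from values at the origin: a function of modulus at most \<open>\<rho>\<close> with value \<open>u(0)\<close> at the origin differs
  from 1 by at most \<open>\<rho>\<^sup>2 + 1 - 2 Re (u(0))\<close> in normalised mean square. For uniformly bounded functions,
  convergence in mean square implies convergence in every Hardy norm.

  It remains to see that \<open>\<Omega>\<close> lies in a horizontal strip. Julia's lemma at the Denjoy--Wolff point turns
  the condition \<open>\<alpha> < 0\<close> into a positive harmonic function on \<open>\<Omega>\<close> that grows by a fixed factor larger than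
  one under \<open>w \<mapsto> w + 1\<close>. By Harnack's inequality \<open>\<Omega>\<close> then contains no large disc, whereas a
  domain of unbounded height that is invariant under translations to the right does.
\<close>

section \<open>Means over circles\<close>

lemma powr_two_eq_power2: "x \<ge> 0 \<Longrightarrow> x powr 2 = (x::real)\<^sup>2"
  by (cases "x = 0") (simp_all add: powr_numeral)

lemma hardy_mean_two: "hardy_mean 2 f r = integral {0..2*pi} (\<lambda>\<theta>. (cmod (f (of_real r * cis \<theta>)))\<^sup>2)"
  by (simp add: hardy_mean_def powr_two_eq_power2)

lemma continuous_on_circle:
  assumes "continuous_on (ball 0 R) f" "0 \<le> r" "r < R"
  shows "continuous_on A (\<lambda>\<theta>. f (of_real r * cis \<theta>) :: 'a::topological_space)"
  by (rule continuous_on_compose2[OF assms(1)])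
     (use assms in \<open>auto intro!: continuous_intros simp: norm_mult\<close>)

text \<open>The partial sums converge uniformly on the circle, so the series may be integrated term by term
  against \<open>g\<close>. With \<open>g\<close> an exponential this gives the coefficients, with \<open>g = cnj f\<close> Parseval's identity.\<close>
lemma power_series_circle_integral:
  assumes ser: "\<And>z. z \<in> ball 0 R \<Longrightarrow> (\<lambda>n. a n * z ^ n) sums f z"
    and r: "0 \<le> r" "r < R" and g: "continuous_on {0..2*pi} g"
  shows "(\<lambda>\<theta>. f (of_real r * cis \<theta>) * g \<theta>) integrable_on {0..2*pi}"
    and "(\<lambda>n. a n * of_real r ^ n * integral {0..2*pi} (\<lambda>\<theta>. cis (n * \<theta>) * g \<theta>)) sums
         integral {0..2*pi} (\<lambda>\<theta>. f (of_real r * cis \<theta>) * g \<theta>)"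
proof -
  define s where "s = (r + R) / 2"
  have s: "r < s" "s < R" "0 < s" using r by (auto simp: s_def)
  have "summable (\<lambda>n. a n * of_real s ^ n)"
    using ser[of "of_real s"] s by (auto simp: sums_iff)
  from powser_insidea[OF this, of "of_real r"] have sm: "summable (\<lambda>n. cmod (a n) * r ^ n)"
    using r s by (simp add: norm_mult norm_power)
  have "bounded (g ` {0..2*pi})"
    by (intro compact_imp_bounded compact_continuous_image g) auto
  then obtain B where B: "\<And>\<theta>. \<theta> \<in> {0..2*pi} \<Longrightarrow> cmod (g \<theta>) \<le> B"
    unfolding bounded_iff by blast
  define F where "F = (\<lambda>N \<theta>. \<Sum>n<N. a n * (of_real r * cis \<theta>) ^ n * g \<theta>)"
  have sums: "(\<lambda>n. a n * (of_real r * cis \<theta>) ^ n * g \<theta>) sums (f (of_real r * cis \<theta>) * g \<theta>)" for \<theta>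
    using ser[of "of_real r * cis \<theta>"] r by (intro sums_mult2) (auto simp: norm_mult)
  have "uniform_limit {0..2*pi} F (\<lambda>\<theta>. \<Sum>n. a n * (of_real r * cis \<theta>) ^ n * g \<theta>) sequentially"
    unfolding F_def
  proof (rule Weierstrass_m_test)
    show "norm (a n * (of_real r * cis \<theta>) ^ n * g \<theta>) \<le> cmod (a n) * r ^ n * B"
      if "\<theta> \<in> {0..2*pi}" for n \<theta>
      using B[OF that] r by (simp add: norm_mult norm_power mult_left_mono)
    show "summable (\<lambda>n. cmod (a n) * r ^ n * B)" using sm by (rule summable_mult2)
  qed
  then have ul: "uniform_limit {0..2*pi} F (\<lambda>\<theta>. f (of_real r * cis \<theta>) * g \<theta>) sequentially"
    using sums by (simp add: sums_iff)
  have contF: "continuous_on {0..2*pi} (F N)" for N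
    unfolding F_def by (intro continuous_intros g)
  obtain I J where I: "\<And>n. (F n has_integral I n) {0..2*pi}"
    and J: "((\<lambda>\<theta>. f (of_real r * cis \<theta>) * g \<theta>) has_integral J) {0..2*pi}" and lim: "I \<longlonglongrightarrow> J"
    by (rule uniform_limit_integral[OF ul contF]) auto
  show "(\<lambda>\<theta>. f (of_real r * cis \<theta>) * g \<theta>) integrable_on {0..2*pi}"
    using J by (auto simp: integrable_on_def)
  have "I N = (\<Sum>n<N. a n * of_real r ^ n * integral {0..2*pi} (\<lambda>\<theta>. cis (n * \<theta>) * g \<theta>))" for N
  proof -
    have "(F N has_integral (\<Sum>n<N. a n * of_real r ^ n * integral {0..2*pi} (\<lambda>\<theta>. cis (n * \<theta>) * g \<theta>))) {0..2*pi}"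
    proof -
      have eq: "F N = (\<lambda>\<theta>::real. \<Sum>n<N. a n * of_real r ^ n * (cis (n * \<theta>) * g \<theta>))"
        by (simp only: F_def power_mult_distrib Complex.DeMoivre mult.assoc)
      show ?thesis unfolding eq
        by (intro has_integral_sum has_integral_mult_right integrable_integral integrable_continuous_real
            continuous_intros g) auto
    qed
    then show ?thesis using I has_integral_unique by blast
  qed
  then have "I = (\<lambda>N. \<Sum>n<N. a n * of_real r ^ n * integral {0..2*pi} (\<lambda>\<theta>. cis (n * \<theta>) * g \<theta>))"
    by (rule ext)
  then show "(\<lambda>n. a n * of_real r ^ n * integral {0..2*pi} (\<lambda>\<theta>. cis (n * \<theta>) * g \<theta>)) sums
         integral {0..2*pi} (\<lambda>\<theta>. f (of_real r * cis \<theta>) * g \<theta>)"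
    using lim unfolding sums_def integral_unique[OF J] by simp
qed

lemma integral_cis_int: "integral {0..2*pi} (\<lambda>\<theta>. cis (of_int k * \<theta>)) = (if k = 0 then of_real (2*pi) else 0)"
proof (cases "k = 0")
  case False
  let ?G = "\<lambda>z::complex. exp (\<i> * of_int k * z) / (\<i> * of_int k)"
  have "(?G has_field_derivative exp (\<i> * of_int k * z)) (at z)" for z
    using False by (auto intro!: derivative_eq_intros)
  then have "((\<lambda>\<theta>. ?G (of_real \<theta>)) has_vector_derivative exp (\<i> * of_int k * of_real \<theta>)) (at \<theta> within {0..2*pi})" for \<theta>
    by (rule has_vector_derivative_real_field)
  then have "((\<lambda>\<theta>. exp (\<i> * of_int k * of_real \<theta>)) has_integral (?G (of_real (2*pi)) - ?G (of_real 0))) {0..2*pi}"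
    by (intro fundamental_theorem_of_calculus) auto
  then have "((\<lambda>\<theta>. cis (of_int k * \<theta>)) has_integral (cis (of_int k * (2*pi)) - 1) / (\<i> * of_int k)) {0..2*pi}"
    by (simp add: cis_conv_exp mult_ac diff_divide_distrib)
  moreover have "cis (of_int k * (2*pi)) = 1"
    using cis_multiple_2pi[of "of_int k"] by (simp add: mult_ac)
  ultimately show ?thesis using False by (simp add: integral_unique)
qed (simp add: scaleR_conv_of_real)

lemma power_series_coeff_integral:
  assumes ser: "\<And>z. z \<in> ball 0 R \<Longrightarrow> (\<lambda>n. a n * z ^ n) sums f z"
    and r: "0 \<le> r" "r < R"
  shows "integral {0..2*pi} (\<lambda>\<theta>. f (of_real r * cis \<theta>) * cis (- (real k * \<theta>))) = of_real (2*pi) * a k * of_real r ^ k"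
proof -
  have eq: "integral {0..2*pi} (\<lambda>\<theta>. cis (n * \<theta>) * cis (- (real k * \<theta>))) = (if n = k then of_real (2*pi) else 0)" for n :: nat
    using integral_cis_int[of "int n - int k"] by (simp add: cis_mult algebra_simps)
  have "(\<lambda>n. a n * of_real r ^ n * (if n = k then of_real (2*pi) else 0)) sums
     integral {0..2*pi} (\<lambda>\<theta>. f (of_real r * cis \<theta>) * cis (- (real k * \<theta>)))"
    using power_series_circle_integral(2)[OF ser r, of "\<lambda>\<theta>. cis (- (real k * \<theta>))"]
    unfolding eq by (simp add: continuous_intros)
  moreover have "(\<lambda>n. a n * of_real r ^ n * (if n = k then of_real (2*pi) else 0)) sums (a k * of_real r ^ k * of_real (2*pi))"
    using sums_single[of k "\<lambda>n. a n * of_real r ^ n * complex_of_real (2*pi)"] by (simp add: if_distrib cong: if_cong)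
  ultimately show ?thesis by (simp add: sums_unique2 mult_ac)
qed

text \<open>In \<open>f \<cdot> cnj f\<close> only the first factor is expanded; integration then picks out the coefficients of the
  second.\<close>
lemma parseval_power_series:
  assumes ser: "\<And>z. z \<in> ball 0 R \<Longrightarrow> (\<lambda>n. a n * z ^ n) sums f z"
    and cont: "continuous_on (ball 0 R) f"
    and r: "0 \<le> r" "r < R"
  shows "(\<lambda>n. 2 * pi * (cmod (a n))\<^sup>2 * r ^ (2 * n)) sums hardy_mean 2 f r"
proof -
  let ?g = "\<lambda>\<theta>. cnj (f (of_real r * cis \<theta>))"
  have cont': "continuous_on {0..2*pi} (\<lambda>\<theta>. f (of_real r * cis \<theta>))"
    by (rule continuous_on_circle[OF cont r])
  have coeff: "integral {0..2*pi} (\<lambda>\<theta>. cis (n * \<theta>) * ?g \<theta>) = of_real (2*pi) * cnj (a n) * of_real r ^ n" for n :: nat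
  proof -
    have "integral {0..2*pi} (\<lambda>\<theta>. cis (n * \<theta>) * ?g \<theta>)
        = cnj (integral {0..2*pi} (\<lambda>\<theta>. f (of_real r * cis \<theta>) * cis (- (real n * \<theta>))))"
      by (subst integral_cnj) (simp add: cis_cnj mult.commute)
    then show ?thesis using power_series_coeff_integral[OF ser r] by simp
  qed
  have eq: "f (of_real r * cis \<theta>) * ?g \<theta> = of_real ((cmod (f (of_real r * cis \<theta>)))\<^sup>2)" for \<theta>
    by (simp add: complex_norm_square[symmetric])
  have "(\<lambda>n. a n * of_real r ^ n * (of_real (2*pi) * cnj (a n) * of_real r ^ n)) sums
     integral {0..2*pi} (\<lambda>\<theta>. f (of_real r * cis \<theta>) * ?g \<theta>)"
    using power_series_circle_integral(2)[OF ser r, of ?g] cont' unfolding coeff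
    by (auto intro!: continuous_intros)
  moreover have "a n * of_real r ^ n * (of_real (2*pi) * cnj (a n) * of_real r ^ n)
     = of_real (2 * pi * (cmod (a n))\<^sup>2 * r ^ (2 * n))" for n
  proof -
    have "a n * of_real r ^ n * (of_real (2*pi) * cnj (a n) * of_real r ^ n)
      = of_real (2*pi) * (a n * cnj (a n)) * (of_real r ^ n * of_real r ^ n)" by (simp only: mult_ac)
    also have "\<dots> = of_real (2*pi) * of_real ((cmod (a n))\<^sup>2) * of_real (r ^ (2 * n))"
      by (simp only: complex_norm_square[symmetric] of_real_power of_real_mult mult_2 power_add)
    finally show ?thesis by (simp only: of_real_mult)
  qed
  moreover have "integral {0..2*pi} (\<lambda>\<theta>. f (of_real r * cis \<theta>) * ?g \<theta>) = of_real (hardy_mean 2 f r)"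
  proof -
    have "((\<lambda>\<theta>. (cmod (f (of_real r * cis \<theta>)))\<^sup>2) has_integral hardy_mean 2 f r) {0..2*pi}"
      unfolding hardy_mean_two
      by (intro integrable_integral integrable_continuous_real continuous_intros cont')
    from has_integral_of_real[OF this] show ?thesis
      unfolding eq by (rule integral_unique)
  qed
  ultimately have "(\<lambda>n. complex_of_real (2 * pi * (cmod (a n))\<^sup>2 * r ^ (2 * n))) sums of_real (hardy_mean 2 f r)"
    by (simp only:)
  then show ?thesis by (simp only: sums_of_real_iff)
qed

lemma parseval:
  assumes f: "f holomorphic_on ball 0 R" and r: "0 \<le> r" "r < R"
  shows "(\<lambda>n. 2 * pi * (cmod ((deriv ^^ n) f 0 / fact n))\<^sup>2 * r ^ (2 * n)) sums hardy_mean 2 f r"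
  by (rule parseval_power_series[OF _ holomorphic_on_imp_continuous_on[OF f] r])
     (use holomorphic_power_series[OF f] in auto)

lemma hardy_mean_two_mono:
  assumes f: "f holomorphic_on ball 0 R" and r: "0 \<le> r" "r \<le> s" "s < R"
  shows "hardy_mean 2 f r \<le> hardy_mean 2 f s"
  by (rule sums_le[OF _ parseval[OF f] parseval[OF f]])
     (use r in \<open>auto intro!: mult_left_mono power_mono\<close>)

lemma circle_mean_value:
  assumes f: "f holomorphic_on ball 0 R" and r: "0 \<le> r" "r < R"
  shows "((\<lambda>\<theta>. f (of_real r * cis \<theta>)) has_integral of_real (2*pi) * f 0) {0..2*pi}"
proof -
  have ser: "(\<lambda>n. (deriv ^^ n) f 0 / fact n * z ^ n) sums f z" if "z \<in> ball 0 R" for z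
    using holomorphic_power_series[OF f that] by simp
  have "(\<lambda>\<theta>. f (of_real r * cis \<theta>)) integrable_on {0..2*pi}"
    by (intro integrable_continuous_real continuous_on_circle[OF holomorphic_on_imp_continuous_on[OF f] r])
  moreover have "integral {0..2*pi} (\<lambda>\<theta>. f (of_real r * cis \<theta>)) = of_real (2*pi) * f 0"
    using power_series_coeff_integral[OF ser r, of 0] by simp
  ultimately show ?thesis by (metis integrable_integral)
qed

text \<open>By Parseval's identity the mean is at most \<open>2 \<pi> \<Sum> |a\<^sub>n|\<^sup>2 (1 - \<rho>\<^sup>n)\<^sup>2\<close>, uniformly in \<open>r\<close>, and this tends to 0 as
  \<open>\<rho> \<longlonglongrightarrow> 1\<close> by dominated convergence.\<close>
lemma dilation_approximation_mean_square:
  assumes f: "f holomorphic_on unit_disc" and M: "\<And>r. 0 < r \<Longrightarrow> r < 1 \<Longrightarrow> hardy_mean 2 f r \<le> M"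
    and "\<epsilon> > 0"
  obtains \<rho> where "0 < \<rho>" "\<rho> < 1" "\<And>r. 0 < r \<Longrightarrow> r < 1 \<Longrightarrow> hardy_mean 2 (\<lambda>z. f z - f (of_real \<rho> * z)) r \<le> \<epsilon>"
proof -
  define a where "a = (\<lambda>n. (deriv ^^ n) f 0 / fact n)"
  have ser: "(\<lambda>n. a n * z ^ n) sums f z" if "z \<in> unit_disc" for z
    using holomorphic_power_series[OF f that] by (simp add: a_def)
  define c where "c = (\<lambda>n. 2 * pi * (cmod (a n))\<^sup>2)"
  have c0: "c n \<ge> 0" for n by (simp add: c_def)
  have "(\<Sum>n<N. c n) \<le> M" for N
  proof (rule tendsto_upperbound)
    show "((\<lambda>r. \<Sum>n<N. c n * r ^ (2 * n)) \<longlongrightarrow> (\<Sum>n<N. c n)) (at_left (1::real))"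
    proof -
      have "((\<lambda>r. \<Sum>n<N. c n * r ^ (2 * n)) \<longlongrightarrow> (\<Sum>n<N. c n * 1 ^ (2 * n))) (at_left (1::real))"
        by (intro tendsto_intros)
      then show ?thesis by simp
    qed
    have "\<forall>\<^sub>F r in at_left (1::real). r \<in> {0<..<1}"
      by (rule eventually_at_leftI[of 0]) auto
    then show "\<forall>\<^sub>F r in at_left (1::real). (\<Sum>n<N. c n * r ^ (2 * n)) \<le> M"
    proof eventually_elim
      case (elim r)
      have s: "(\<lambda>n. c n * r ^ (2 * n)) sums hardy_mean 2 f r"
        using parseval[OF f, of r] elim by (simp add: c_def a_def)
      have "(\<Sum>n<N. c n * r ^ (2 * n)) \<le> hardy_mean 2 f r"
        unfolding sums_unique[OF s]
        by (rule sum_le_suminf) (use s elim c0 in \<open>auto simp: sums_iff\<close>)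
      also have "\<dots> \<le> M" using M elim by auto
      finally show ?case .
    qed
  qed auto
  then have smc: "summable c"
    by (intro bounded_imp_summable[where B = M] c0) (metis lessThan_Suc_atMost)
  define \<rho> where "\<rho> = (\<lambda>m::nat. 1 - 1 / (real m + 2))"
  have \<rho>: "0 < \<rho> m" "\<rho> m < 1" for m by (auto simp: \<rho>_def field_simps)
  have \<rho>lim: "\<rho> \<longlonglongrightarrow> 1" unfolding \<rho>_def
    using tendsto_diff[OF tendsto_const LIMSEQ_ignore_initial_segment[OF lim_1_over_n, of 2], of "1::real"]
    by (simp add: add.commute)
  define d where "d = (\<lambda>n m. c n * (1 - \<rho> m ^ n)\<^sup>2)"
  have d_le: "0 \<le> d n m" "d n m \<le> c n" for n m
  proof -
    have "(1 - \<rho> m ^ n)\<^sup>2 \<le> 1"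
      using \<rho>[of m] by (intro power_le_one) (auto simp: power_le_one less_imp_le)
    then show "d n m \<le> c n" using c0[of n] by (auto simp: d_def mult_left_le)
    show "0 \<le> d n m" using c0 by (auto simp: d_def)
  qed
  have "(\<lambda>m. suminf (\<lambda>n. d n m)) \<longlonglongrightarrow> suminf (\<lambda>n. 0)"
  proof (rule tannerys_theorem[where M = c, THEN conjunct2, THEN conjunct2])
    fix k
    have "(\<lambda>m. c k * (1 - \<rho> m ^ k)\<^sup>2) \<longlonglongrightarrow> c k * (1 - 1 ^ k)\<^sup>2"
      by (intro tendsto_intros \<rho>lim)
    then show "(\<lambda>m. d k m) \<longlonglongrightarrow> 0" by (simp add: d_def)
    show "\<forall>\<^sub>F (k, m) in sequentially \<times>\<^sub>F sequentially. norm (d k m) \<le> c k"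
      using d_le by (auto intro!: always_eventually)
  qed (use smc in auto)
  then have "\<forall>\<^sub>F m in sequentially. suminf (\<lambda>n. d n m) < \<epsilon>"
    using \<open>\<epsilon> > 0\<close> by (simp add: order_tendsto_iff)
  then obtain m where m: "suminf (\<lambda>n. d n m) < \<epsilon>" by (auto simp: eventually_sequentially)
  show ?thesis
  proof (rule that[of "\<rho> m"])
    fix r :: real assume r: "0 < r" "r < 1"
    let ?g = "\<lambda>z. f z - f (of_real (\<rho> m) * z)"
    have inb: "of_real (\<rho> m) * z \<in> unit_disc" if "z \<in> unit_disc" for z
      using that \<rho>[of m] mult_strict_mono'[of "\<rho> m" 1 "cmod z" 1] by (simp add: norm_mult)
    have "(\<lambda>n. 2 * pi * (cmod (a n * (1 - of_real (\<rho> m) ^ n)))\<^sup>2 * r ^ (2 * n)) sums hardy_mean 2 ?g r"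
    proof (rule parseval_power_series[where R = 1])
      show "(\<lambda>n. a n * (1 - of_real (\<rho> m) ^ n) * z ^ n) sums ?g z" if "z \<in> unit_disc" for z
        using sums_diff[OF ser[OF that] ser[OF inb[OF that]]]
        by (simp add: algebra_simps power_mult_distrib)
      have "?g holomorphic_on unit_disc"
        by (intro holomorphic_intros f holomorphic_on_compose_gen[of _ _ f unit_disc, unfolded o_def])
           (use inb in auto)
      then show "continuous_on unit_disc ?g" by (rule holomorphic_on_imp_continuous_on)
    qed (use r in auto)
    moreover have "cmod (1 - of_real (\<rho> m) ^ n) = 1 - \<rho> m ^ n" for n
    proof -
      have "cmod (1 - of_real (\<rho> m) ^ n) = \<bar>1 - \<rho> m ^ n\<bar>"
        by (metis norm_of_real of_real_1 of_real_diff of_real_power)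
      then show ?thesis using \<rho>[of m] by (simp add: power_le_one less_imp_le)
    qed
    ultimately have "(\<lambda>n. d n m * r ^ (2 * n)) sums hardy_mean 2 ?g r"
      by (simp add: d_def c_def norm_mult power_mult_distrib mult_ac)
    moreover have "(\<lambda>n. d n m) sums suminf (\<lambda>n. d n m)"
      by (rule summable_sums, rule summable_comparison_test'[OF smc, of 0]) (use d_le in auto)
    ultimately have "hardy_mean 2 ?g r \<le> suminf (\<lambda>n. d n m)"
      by (rule sums_le[rotated]) (use d_le r in \<open>auto intro!: mult_left_le power_le_one\<close>)
    then show "hardy_mean 2 ?g r \<le> \<epsilon>" using m by simp
  qed (use \<rho> in auto)
qed

text \<open>The real part of the mean value property of \<open>f\<^sup>2\<close>. It converts control of one of \<open>Re f\<close>, \<open>Im f\<close> into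
  control of the other.\<close>
lemma mean_square_Re_Im:
  assumes f: "f holomorphic_on ball 0 R" and r: "0 \<le> r" "r < R"
  shows "integral {0..2*pi} (\<lambda>\<theta>. (Re (f (of_real r * cis \<theta>)))\<^sup>2) - integral {0..2*pi} (\<lambda>\<theta>. (Im (f (of_real r * cis \<theta>)))\<^sup>2)
     = 2 * pi * ((Re (f 0))\<^sup>2 - (Im (f 0))\<^sup>2)"
proof -
  have cont: "continuous_on {0..2*pi} (\<lambda>\<theta>. f (of_real r * cis \<theta>))"
    by (rule continuous_on_circle[OF holomorphic_on_imp_continuous_on[OF f] r])
  have "(\<lambda>z. (f z)\<^sup>2) holomorphic_on ball 0 R" by (intro holomorphic_intros f)
  from has_integral_Re[OF circle_mean_value[OF this r]]
  have "((\<lambda>\<theta>. (Re (f (of_real r * cis \<theta>)))\<^sup>2 - (Im (f (of_real r * cis \<theta>)))\<^sup>2) has_integral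
     2 * pi * ((Re (f 0))\<^sup>2 - (Im (f 0))\<^sup>2)) {0..2*pi}"
    by (simp add: power2_eq_square)
  moreover have "((\<lambda>\<theta>. (Re (f (of_real r * cis \<theta>)))\<^sup>2 - (Im (f (of_real r * cis \<theta>)))\<^sup>2) has_integral
     integral {0..2*pi} (\<lambda>\<theta>. (Re (f (of_real r * cis \<theta>)))\<^sup>2) - integral {0..2*pi} (\<lambda>\<theta>. (Im (f (of_real r * cis \<theta>)))\<^sup>2)) {0..2*pi}"
    by (intro has_integral_diff integrable_integral integrable_continuous_real continuous_intros cont)
  ultimately show ?thesis using has_integral_unique by blast
qed

text \<open>Gives a function defined by a formula the form that members of the Hardy space have.\<close>
definition disc_restrict :: "(complex \<Rightarrow> complex) \<Rightarrow> complex \<Rightarrow> complex" where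
  "disc_restrict f = (\<lambda>z. if z \<in> unit_disc then f z else 0)"

definition bounded_holomorphic :: "(complex \<Rightarrow> complex) \<Rightarrow> bool" where
  "bounded_holomorphic f \<longleftrightarrow> f holomorphic_on unit_disc \<and> bounded (f ` unit_disc)"

lemma bounded_holomorphicI:
  "f holomorphic_on unit_disc \<Longrightarrow> (\<And>z. z \<in> unit_disc \<Longrightarrow> cmod (f z) \<le> B) \<Longrightarrow> bounded_holomorphic f"
  unfolding bounded_holomorphic_def bounded_iff by blast

lemma bounded_holomorphicE:
  assumes "bounded_holomorphic f"
  obtains B where "B > 0" "\<And>z. z \<in> unit_disc \<Longrightarrow> cmod (f z) \<le> B"
  using assms unfolding bounded_holomorphic_def bounded_pos by auto

lemma bounded_holomorphic_imp_holomorphic: "bounded_holomorphic f \<Longrightarrow> f holomorphic_on unit_disc"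
  by (simp add: bounded_holomorphic_def)

lemma bounded_holomorphic_const: "bounded_holomorphic (\<lambda>z. c)"
  by (rule bounded_holomorphicI[where B = "cmod c"]) auto

lemma bounded_holomorphic_add:
  assumes "bounded_holomorphic f" "bounded_holomorphic g"
  shows "bounded_holomorphic (\<lambda>z. f z + g z)"
  using assms unfolding bounded_holomorphic_def by (auto intro: holomorphic_intros bounded_plus_comp)

lemma bounded_holomorphic_mult:
  assumes f: "bounded_holomorphic f" and g: "bounded_holomorphic g"
  shows "bounded_holomorphic (\<lambda>z. f z * g z)"
proof -
  obtain A B where A: "A > 0" "\<And>z. z \<in> unit_disc \<Longrightarrow> cmod (f z) \<le> A"
    and B: "B > 0" "\<And>z. z \<in> unit_disc \<Longrightarrow> cmod (g z) \<le> B"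
    using bounded_holomorphicE[OF f] bounded_holomorphicE[OF g] by metis
  show ?thesis
  proof (rule bounded_holomorphicI[where B = "A * B"])
    show "(\<lambda>z. f z * g z) holomorphic_on unit_disc"
      using f g by (intro holomorphic_intros) (auto simp: bounded_holomorphic_def)
    show "cmod (f z * g z) \<le> A * B" if "z \<in> unit_disc" for z
      unfolding norm_mult using that A B by (intro mult_mono) auto
  qed
qed

lemma bounded_holomorphic_cmult: "bounded_holomorphic f \<Longrightarrow> bounded_holomorphic (\<lambda>z. c * f z)"
  by (intro bounded_holomorphic_mult bounded_holomorphic_const)

lemma bounded_holomorphic_diff:
  assumes "bounded_holomorphic f" "bounded_holomorphic g"
  shows "bounded_holomorphic (\<lambda>z. f z - g z)"
  using bounded_holomorphic_add[OF assms(1) bounded_holomorphic_cmult[OF assms(2), of "-1"]] by simp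

lemma bounded_holomorphic_sum:
  "(\<And>i. i \<in> I \<Longrightarrow> bounded_holomorphic (f i)) \<Longrightarrow> bounded_holomorphic (\<lambda>z. \<Sum>i\<in>I. f i z)"
  by (induction I rule: infinite_finite_induct) (auto intro: bounded_holomorphic_const bounded_holomorphic_add)

lemma circle_in_disc: "0 < r \<Longrightarrow> r < 1 \<Longrightarrow> of_real r * cis \<theta> \<in> unit_disc"
  by (simp add: norm_mult)

lemma hardy_mean_cong:
  assumes "\<And>z. z \<in> unit_disc \<Longrightarrow> f z = g z" "0 < r" "r < 1"
  shows "hardy_mean p f r = hardy_mean p g r"
  unfolding hardy_mean_def using assms by (simp add: norm_mult)

lemma hardy_integrable:
  assumes "continuous_on unit_disc f" "0 < r" "r < 1" "p > 0"
  shows "(\<lambda>\<theta>. cmod (f (of_real r * cis \<theta>)) powr p) integrable_on {0..2*pi}"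
  by (intro integrable_continuous_real continuous_on_powr' continuous_on_norm continuous_on_const
      continuous_on_circle[OF assms(1)]) (use assms in auto)

lemma hardy_mean_bound:
  assumes f: "f holomorphic_on unit_disc" and "p > 0" "0 < r" "r < 1"
    and g: "(g has_integral I) {0..2*pi}"
    and le: "\<And>\<theta>. cmod (f (of_real r * cis \<theta>)) powr p \<le> g \<theta>"
  shows "hardy_mean p f r \<le> I"
  unfolding hardy_mean_def
  by (rule has_integral_le[OF integrable_integral g])
     (use assms in \<open>auto intro!: hardy_integrable holomorphic_on_imp_continuous_on\<close>)

lemma hardy_mean_nonneg: "hardy_mean p f r \<ge> 0"
  proof (cases "(\<lambda>\<theta>. cmod (f (of_real r * cis \<theta>)) powr p) integrable_on {0..2*pi}")
  case True
  then show ?thesis unfolding hardy_mean_def by (rule integral_nonneg) auto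
qed (simp add: hardy_mean_def not_integrable_integral)

lemma hardy_mean_const_bound:
  assumes f: "f holomorphic_on unit_disc" and "p > 0" "0 < r" "r < 1" "\<And>z. z \<in> unit_disc \<Longrightarrow> cmod (f z) \<le> B"
  shows "hardy_mean p f r \<le> 2 * pi * B powr p"
proof (rule hardy_mean_bound[OF assms(1-4)])
  show "((\<lambda>\<theta>. B powr p) has_integral 2 * pi * B powr p) {0..2 * pi}"
    using has_integral_const_real[of "B powr p" 0 "2*pi"] by (simp add: mult_ac)
qed (use assms circle_in_disc in \<open>auto intro!: powr_mono2\<close>)

lemma hardy_norm_bound:
  assumes "p > 0" "\<And>r. 0 < r \<Longrightarrow> r < 1 \<Longrightarrow> hardy_mean p f r \<le> E"
  shows "hardy_norm p f \<le> E powr (1 / p)"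
proof -
  have "(SUP r\<in>{0<..<1}. hardy_mean p f r) \<le> E" by (rule cSUP_least) (use assms in auto)
  moreover have "0 \<le> (SUP r\<in>{0<..<1}. hardy_mean p f r)"
  proof (rule order_trans[OF hardy_mean_nonneg[of p f "1/2"]])
    show "hardy_mean p f (1/2) \<le> (SUP r\<in>{0<..<1}. hardy_mean p f r)"
      by (rule cSUP_upper) (use assms in \<open>auto intro!: bdd_aboveI2[of _ _ E]\<close>)
  qed
  ultimately show ?thesis unfolding hardy_norm_def using assms by (intro powr_mono2) auto
qed

lemma hardy_space_disc_restrict:
  assumes f: "bounded_holomorphic f" and p: "p > 0"
  shows "disc_restrict f \<in> hardy_space p"
proof -
  obtain B where B: "\<And>z. z \<in> unit_disc \<Longrightarrow> cmod (f z) \<le> B" using bounded_holomorphicE[OF f] by blast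
  have "hardy_mean p (disc_restrict f) r \<le> 2 * pi * B powr p" if "0 < r" "r < 1" for r
    using hardy_mean_const_bound[OF bounded_holomorphic_imp_holomorphic[OF f] p that B]
      hardy_mean_cong[of "disc_restrict f" f r p] that by (simp add: disc_restrict_def)
  moreover have "disc_restrict f holomorphic_on unit_disc"
    by (rule holomorphic_transform[OF bounded_holomorphic_imp_holomorphic[OF f]]) (simp add: disc_restrict_def)
  ultimately show ?thesis unfolding hardy_space_def
    by (auto simp: disc_restrict_def intro!: bdd_aboveI2[of _ _ "2 * pi * B powr p"])
qed

text \<open>A function of modulus about 1 with value about 1 at the origin is close to 1 in mean square: in
  \<open>|1 - u|\<^sup>2 = 1 + |u|\<^sup>2 - 2 Re u\<close> the last term has mean \<open>2 Re (u 0)\<close>.\<close>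
lemma hardy_mean_two_one_minus:
  assumes u: "u holomorphic_on unit_disc" and \<rho>: "\<And>z. z \<in> unit_disc \<Longrightarrow> cmod (u z) \<le> \<rho>"
    and r: "0 < r" "r < 1"
  shows "hardy_mean 2 (\<lambda>z. 1 - u z) r \<le> 2 * pi * (\<rho>\<^sup>2 + 1 - 2 * Re (u 0))"
proof (rule hardy_mean_bound)
  have "((\<lambda>\<theta>. \<rho>\<^sup>2 + 1 - 2 * Re (u (of_real r * cis \<theta>))) has_integral (2 * pi * (\<rho>\<^sup>2 + 1) - 2 * Re (of_real (2*pi) * u 0))) {0..2*pi}"
    using has_integral_const_real[of "\<rho>\<^sup>2 + 1" 0 "2*pi"]
    by (intro has_integral_diff has_integral_mult_right has_integral_Re circle_mean_value[OF u]) (use r in auto)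
  then show "((\<lambda>\<theta>. \<rho>\<^sup>2 + 1 - 2 * Re (u (of_real r * cis \<theta>))) has_integral 2 * pi * (\<rho>\<^sup>2 + 1 - 2 * Re (u 0))) {0..2*pi}"
    by (simp add: algebra_simps)
  fix \<theta>
  let ?z = "of_real r * cis \<theta>"
  have "(cmod (1 - u ?z))\<^sup>2 = 1 + (cmod (u ?z))\<^sup>2 - 2 * Re (u ?z)"
    unfolding cmod_power2 by (simp add: power2_eq_square algebra_simps)
  also have "(cmod (u ?z))\<^sup>2 \<le> \<rho>\<^sup>2" using \<rho>[OF circle_in_disc[OF r]] by (intro power_mono) auto
  finally show "cmod (1 - u ?z) powr 2 \<le> \<rho>\<^sup>2 + 1 - 2 * Re (u ?z)" by (simp add: powr_two_eq_power2)
qed (use r u in \<open>auto intro!: holomorphic_intros\<close>)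

lemma hardy_mean_two_dominated:
  assumes f: "f holomorphic_on unit_disc" and g: "g holomorphic_on unit_disc" and K: "K \<ge> 0"
    and le: "\<And>z. z \<in> unit_disc \<Longrightarrow> cmod (f z) \<le> K * cmod (g z)" and r: "0 < r" "r < 1"
  shows "hardy_mean 2 f r \<le> K\<^sup>2 * hardy_mean 2 g r"
proof (rule hardy_mean_bound[OF f])
  show "((\<lambda>\<theta>. K\<^sup>2 * cmod (g (of_real r * cis \<theta>)) powr 2) has_integral K\<^sup>2 * hardy_mean 2 g r) {0..2*pi}"
    unfolding hardy_mean_def
    by (intro has_integral_mult_right integrable_integral hardy_integrable holomorphic_on_imp_continuous_on g) (use r in auto)
  show "cmod (f (of_real r * cis \<theta>)) powr 2 \<le> K\<^sup>2 * cmod (g (of_real r * cis \<theta>)) powr 2" for \<theta>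
    using power_mono[OF le[OF circle_in_disc[OF r, of \<theta>]], where n = 2] by (simp add: powr_two_eq_power2 power_mult_distrib)
qed (use r in auto)

text \<open>By Schwarz's lemma \<open>\<psi> z = z u(z)\<close> with \<open>|u| \<le> 1\<close> and \<open>u(0) = \<psi>'(0)\<close>, so the previous estimate for \<open>u\<close>
  applies. A self-map fixing the origin with derivative near 1 there is near the identity.\<close>
lemma hardy_mean_two_minus_id:
  assumes \<psi>: "\<psi> holomorphic_on unit_disc" "\<psi> ` unit_disc \<subseteq> unit_disc" "\<psi> 0 = 0" and r: "0 < r" "r < 1"
  shows "hardy_mean 2 (\<lambda>z. z - \<psi> z) r \<le> 4 * pi * (1 - Re (deriv \<psi> 0))"
proof -
  obtain u where u: "u holomorphic_on unit_disc" "\<And>z. cmod z < 1 \<Longrightarrow> \<psi> z = z * u z" "deriv \<psi> 0 = u 0"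
    using Schwarz3[OF \<psi>(1,3)] by metis
  have u1: "cmod (u z) \<le> 1" if "z \<in> unit_disc" for z
  proof (cases "z = 0")
    case True
    have "cmod (deriv \<psi> 0) \<le> 1"
      by (rule Schwarz_Lemma(2)[OF \<psi>(1,3), of 0]) (use \<psi>(2) in \<open>auto simp: image_subset_iff\<close>)
    then show ?thesis using True u by simp
  next
    case False
    have "cmod (\<psi> z) \<le> cmod z"
      by (rule Schwarz_Lemma(1)[OF \<psi>(1,3)]) (use \<psi>(2) that in \<open>auto simp: image_subset_iff\<close>)
    then show ?thesis using False u(2)[of z] that by (simp add: norm_mult)
  qed
  have "hardy_mean 2 (\<lambda>z. z - \<psi> z) r \<le> 1\<^sup>2 * hardy_mean 2 (\<lambda>z. 1 - u z) r"
  proof (rule hardy_mean_two_dominated)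
    fix z assume z: "z \<in> unit_disc"
    then have "z - \<psi> z = z * (1 - u z)" using u(2)[of z] by (simp add: algebra_simps)
    then show "cmod (z - \<psi> z) \<le> 1 * cmod (1 - u z)" using z by (simp add: norm_mult mult_left_le_one_le)
  qed (use \<psi> u r in \<open>auto intro!: holomorphic_intros\<close>)
  also have "\<dots> \<le> 2 * pi * (1\<^sup>2 + 1 - 2 * Re (u 0))" using hardy_mean_two_one_minus[OF u(1) u1 r] by simp
  finally show ?thesis using u(3) by (simp add: algebra_simps)
qed

text \<open>Turns smallness in mean square of uniformly bounded functions into smallness of the \<open>p\<close>-th mean. The
  two powers with exponent \<open>p - 2\<close> serve the cases \<open>p \<ge> 2\<close> and \<open>p < 2\<close>.\<close>
lemma powr_le_of_bounded:
  assumes "0 \<le> x" "x \<le> B" "0 < d" "1 \<le> (p::real)"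
  shows "x powr p \<le> d powr p + (B powr (p - 2) + d powr (p - 2)) * x\<^sup>2"
proof (cases "x \<le> d")
  case True
  then have "x powr p \<le> d powr p" using assms by (intro powr_mono2) auto
  then show ?thesis by (simp add: add_increasing2)
next
  case False
  then have x: "x > 0" "x > d" using assms by auto
  have "x powr (p - 2) \<le> B powr (p - 2) + d powr (p - 2)"
  proof (cases "p \<ge> 2")
    case True
    then have "x powr (p - 2) \<le> B powr (p - 2)" using assms x by (intro powr_mono2) auto
    then show ?thesis by (simp add: add_increasing2)
  next
    case False
    then have "x powr (p - 2) \<le> d powr (p - 2)" using assms x by (intro powr_mono2') auto
    then show ?thesis by (simp add: add_increasing)
  qed
  moreover have "x powr p = x powr (p - 2) * x\<^sup>2"
    using x by (simp add: powr_add[symmetric] powr_numeral[symmetric] del: powr_numeral)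
  ultimately show ?thesis using mult_right_mono[of "x powr (p - 2)" _ "x\<^sup>2"] by (simp add: add_increasing)
qed

text \<open>The error depends on the oscillation of \<open>f\<close> only, hence is uniform in any further parameter. This is what
  moves a functional under an integral sign.\<close>
lemma Riemann_sum_error:
  fixes f :: "real \<Rightarrow> 'a::banach"
  assumes d: "d \<ge> 0" and cont: "continuous_on {0..real n * d} f"
    and osc: "\<And>s t. s \<in> {0..real n * d} \<Longrightarrow> t \<in> {0..real n * d} \<Longrightarrow> \<bar>s - t\<bar> \<le> d \<Longrightarrow> norm (f s - f t) \<le> \<epsilon>"
  shows "norm (integral {0..real n * d} f - (\<Sum>i<n. d *\<^sub>R f (real i * d))) \<le> real n * d * \<epsilon>"
  using cont osc
proof (induction n)
  case (Suc n)
  have le: "real n * d \<le> real (Suc n) * d" using d by (intro mult_right_mono) auto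
  have nd: "0 \<le> real n * d" using d by simp
  have c1: "continuous_on {real n * d..real (Suc n) * d} f"
    by (rule continuous_on_subset[OF Suc.prems(1)]) (use nd in auto)
  have IH: "norm (integral {0..real n * d} f - (\<Sum>i<n. d *\<^sub>R f (real i * d))) \<le> real n * d * \<epsilon>"
  proof (rule Suc.IH)
    show "continuous_on {0..real n * d} f" by (rule continuous_on_subset[OF Suc.prems(1)]) (use le in auto)
    show "norm (f s - f t) \<le> \<epsilon>" if "s \<in> {0..real n * d}" "t \<in> {0..real n * d}" "\<bar>s - t\<bar> \<le> d" for s t
      by (rule Suc.prems(2)) (use that le in auto)
  qed
  have split: "integral {0..real (Suc n) * d} f = integral {0..real n * d} f + integral {real n * d..real (Suc n) * d} f"
    using Henstock_Kurzweil_Integration.integral_combine[OF nd le, of f] integrable_continuous_real[OF Suc.prems(1)] by simp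
  have "norm (integral {real n * d..real (Suc n) * d} (\<lambda>s. f s - f (real n * d))) \<le> \<epsilon> * (real (Suc n) * d - real n * d)"
  proof (rule integral_bound[OF le])
    show "continuous_on {real n * d..real (Suc n) * d} (\<lambda>s. f s - f (real n * d))"
      by (intro continuous_intros c1)
    show "norm (f s - f (real n * d)) \<le> \<epsilon>" if "s \<in> {real n * d..real (Suc n) * d}" for s
      by (rule Suc.prems(2)) (use that nd le order_trans[OF nd] in \<open>auto simp: ring_distribs\<close>)
  qed
  moreover have "integral {real n * d..real (Suc n) * d} (\<lambda>s. f s - f (real n * d))
      = integral {real n * d..real (Suc n) * d} f - d *\<^sub>R f (real n * d)"
    using integral_diff[OF integrable_continuous_real[OF c1] integrable_const_ivl, of "f (real n * d)"] le
    by (simp add: algebra_simps)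
  moreover have "\<epsilon> * (real (Suc n) * d - real n * d) = d * \<epsilon>" by (simp add: algebra_simps)
  ultimately have "norm (integral {real n * d..real (Suc n) * d} f - d *\<^sub>R f (real n * d)) \<le> d * \<epsilon>"
    by (simp only:)
  moreover have "integral {0..real (Suc n) * d} f - (\<Sum>i<Suc n. d *\<^sub>R f (real i * d))
     = (integral {0..real n * d} f - (\<Sum>i<n. d *\<^sub>R f (real i * d)))
       + (integral {real n * d..real (Suc n) * d} f - d *\<^sub>R f (real n * d))"
    unfolding split by simp
  ultimately show ?case using IH
    by (simp only:) (rule order_trans[OF norm_triangle_ineq], simp add: algebra_simps)
qed simp

section \<open>Density of the bounded functions\<close>

lemma circle_absolute_mean_bound:
  assumes f: "f holomorphic_on unit_disc" and s: "0 < s" "s < 1" and z: "cmod z < s"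
  shows "cmod (f z) \<le> 1 / (s - cmod z) * hardy_mean 1 f s"
proof -
  have "f holomorphic_on cball 0 s" using f by (rule holomorphic_on_subset) (use s in auto)
  from Cauchy_integral_circlepath_simple[OF this, of z] z
  have "((\<lambda>u. f u / (u - z)) has_contour_integral (2 * of_real pi * \<i> * f z)) (part_circlepath 0 s 0 (2 * pi))"
    by (simp add: circlepath_def)
  then have I: "((\<lambda>\<theta>. f (of_real s * cis \<theta>) / (of_real s * cis \<theta> - z) * of_real s * \<i> * cis \<theta>) has_integral (2 * of_real pi * \<i> * f z)) {0..2*pi}"
    by (subst (asm) has_contour_integral_part_circlepath_iff) simp_all
  have "cmod (2 * of_real pi * \<i> * f z) \<le> integral {0..2*pi} (\<lambda>\<theta>. 1 / (s - cmod z) * cmod (f (of_real s * cis \<theta>)))"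
    unfolding integral_unique[OF I, symmetric]
  proof (rule integral_norm_bound_integral)
    show "(\<lambda>\<theta>. 1 / (s - cmod z) * cmod (f (of_real s * cis \<theta>))) integrable_on {0..2*pi}"
      by (intro integrable_continuous_real continuous_intros continuous_on_circle[OF holomorphic_on_imp_continuous_on[OF f]]) (use s in auto)
    fix \<theta>
    have "cmod (of_real s * cis \<theta> - z) \<ge> s - cmod z"
      using norm_triangle_ineq2[of "of_real s * cis \<theta>" z] s by (simp add: norm_mult)
    then have "cmod (f (of_real s * cis \<theta>)) * s / cmod (of_real s * cis \<theta> - z) \<le> cmod (f (of_real s * cis \<theta>)) * 1 / (s - cmod z)"
      using s z by (intro frac_le mult_left_mono) auto
    then show "cmod (f (of_real s * cis \<theta>) / (of_real s * cis \<theta> - z) * of_real s * \<i> * cis \<theta>)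
       \<le> 1 / (s - cmod z) * cmod (f (of_real s * cis \<theta>))"
      using s by (simp add: norm_mult norm_divide)
  qed (use I in blast)
  also have "\<dots> = 1 / (s - cmod z) * hardy_mean 1 f s"
    by (simp add: hardy_mean_def)
  finally have le: "2 * pi * cmod (f z) \<le> 1 / (s - cmod z) * hardy_mean 1 f s" by (simp add: norm_mult)
  have "1 * cmod (f z) \<le> 2 * pi * cmod (f z)" by (intro mult_right_mono) (use pi_gt3 in auto)
  then show ?thesis using le by simp
qed

text \<open>Integrating \<open>x \<le> d + d\<^bsup>1 - p\<^esup> x\<^bsup>p\<^esup>\<close> bounds the first mean by the \<open>p\<close>-th one; the choice of \<open>d\<close> as the
  \<open>p\<close>-th root of \<open>E\<close> makes both terms multiples of \<open>d\<close>.\<close>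
lemma point_evaluation_bound:
  assumes f: "f holomorphic_on unit_disc" and p: "p \<ge> 1" and s: "0 < s" "s < 1" and z: "cmod z < s"
    and E: "E > 0" "hardy_mean p f s \<le> E"
  shows "cmod (f z) \<le> (2 * pi + 1) / (s - cmod z) * E powr (1 / p)"
proof -
  define d where "d = E powr (1 / p)"
  have d: "d > 0" using E by (simp add: d_def)
  have dp: "d powr (1 - p) * E = d"
  proof -
    have "E = d powr p" using E p by (simp add: d_def powr_powr)
    then have "d powr (1 - p) * E = d powr ((1 - p) + p)" by (simp only: powr_add)
    then show ?thesis using d by simp
  qed
  have "hardy_mean 1 f s \<le> 2 * pi * d + d powr (1 - p) * hardy_mean p f s"
  proof (rule hardy_mean_bound[OF f _ s])
    show "((\<lambda>\<theta>. d + d powr (1 - p) * cmod (f (of_real s * cis \<theta>)) powr p) has_integral 2 * pi * d + d powr (1 - p) * hardy_mean p f s) {0..2*pi}"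
      unfolding hardy_mean_def using has_integral_const_real[of d 0 "2*pi"]
      by (intro has_integral_add has_integral_mult_right integrable_integral hardy_integrable holomorphic_on_imp_continuous_on f)
         (use s p in auto)
    fix \<theta>
    let ?x = "cmod (f (of_real s * cis \<theta>))"
    show "?x powr 1 \<le> d + d powr (1 - p) * ?x powr p"
    proof (cases "?x \<le> d")
      case False
      then have x: "?x > d" "?x > 0" using d by auto
      have "?x = ?x powr (1 - p) * ?x powr p" using x by (simp add: powr_add[symmetric])
      also have "\<dots> \<le> d powr (1 - p) * ?x powr p" using x d p by (intro mult_right_mono powr_mono2') auto
      finally show ?thesis using d by simp
    qed (simp add: add_increasing2)
  qed simp
  also have "\<dots> \<le> 2 * pi * d + d powr (1 - p) * E" using E by (intro add_left_mono mult_left_mono) auto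
  also have "\<dots> = (2 * pi + 1) * d" unfolding dp by (simp add: algebra_simps)
  finally have "hardy_mean 1 f s \<le> (2 * pi + 1) * d" .
  then have "1 / (s - cmod z) * hardy_mean 1 f s \<le> 1 / (s - cmod z) * ((2 * pi + 1) * d)"
    using z by (intro mult_left_mono) auto
  then show ?thesis using circle_absolute_mean_bound[OF f s z] by (simp add: d_def)
qed

text \<open>On the unit circle \<open>cnj z = 1 / z\<close>, so the product is a Laurent polynomial, and its real part does not
  change when the negative powers are reflected and their coefficients conjugated.\<close>
lemma Re_poly_mult_cnj_poly_on_circle:
  fixes P Q :: "complex poly"
  shows "\<exists>R. \<forall>z. cmod z = 1 \<longrightarrow> Re (poly P z * cnj (poly Q z)) = Re (poly R z)"
proof (induction Q arbitrary: P)
  case 0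
  show ?case by (intro exI[of _ 0]) simp
next
  case (pCons c Q)
  obtain d P' where P: "P = pCons d P'" by (cases P)
  obtain R where R: "\<And>z. cmod z = 1 \<Longrightarrow> Re (poly P' z * cnj (poly Q z)) = Re (poly R z)"
    using pCons.IH[of P'] by blast
  show ?case
  proof (intro exI[of _ "smult (cnj c) P + smult (cnj d) (pCons 0 Q) + R"] allI impI)
    fix z :: complex assume z: "cmod z = 1"
    have zz: "z * cnj z = 1" using z complex_norm_square[of z] by simp
    have "poly P z * cnj (poly (pCons c Q) z) = cnj c * poly P z + d * cnj (z * poly Q z) + (z * cnj z) * (poly P' z * cnj (poly Q z))"
      by (simp add: P algebra_simps)
    then have "Re (poly P z * cnj (poly (pCons c Q) z)) = Re (cnj c * poly P z) + Re (d * cnj (z * poly Q z)) + Re (poly P' z * cnj (poly Q z))"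
      unfolding zz by simp
    moreover have "Re (d * cnj w) = Re (cnj d * w)" for w by simp
    moreover have "poly (smult (cnj c) P + smult (cnj d) (pCons 0 Q) + R) z = cnj c * poly P z + cnj d * (z * poly Q z) + poly R z"
      by simp
    ultimately show "Re (poly P z * cnj (poly (pCons c Q) z)) = Re (poly (smult (cnj c) P + smult (cnj d) (pCons 0 Q) + R) z)"
      using R[OF z] by (simp only: plus_complex.sel)
  qed
qed

lemma real_polynomial_on_circle:
  assumes "real_polynomial_function T"
  shows "\<exists>P. \<forall>z. cmod z = 1 \<longrightarrow> T z = Re (poly P (z::complex))"
  using assms
proof induction
  case (linear f)
  show ?case
  proof (intro exI[of _ "[:0, of_real (f 1) - \<i> * of_real (f \<i>):]"] allI impI)
    fix z :: complex
    interpret bounded_linear f by (rule linear)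
    have "z = Re z *\<^sub>R 1 + Im z *\<^sub>R \<i>" by (simp add: complex_eq_iff)
    then have "f z = f (Re z *\<^sub>R 1 + Im z *\<^sub>R \<i>)" by (rule arg_cong)
    also have "\<dots> = Re z * f 1 + Im z * f \<i>" by (simp only: add scaleR real_scaleR_def)
    finally show "f z = Re (poly [:0, of_real (f 1) - \<i> * of_real (f \<i>):] z)" by simp
  qed
next
  case (const c)
  show ?case by (intro exI[of _ "[:of_real c:]"]) simp
next
  case (add f g)
  then obtain P Q where "\<forall>z. cmod z = 1 \<longrightarrow> f z = Re (poly P z)" "\<forall>z. cmod z = 1 \<longrightarrow> g z = Re (poly Q z)" by blast
  then show ?case by (intro exI[of _ "P + Q"]) simp
next
  case (mult f g)
  then obtain P Q where PQ: "\<And>z. cmod z = 1 \<Longrightarrow> f z = Re (poly P z)" "\<And>z. cmod z = 1 \<Longrightarrow> g z = Re (poly Q z)" by blast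
  obtain R where R: "\<And>z. cmod z = 1 \<Longrightarrow> Re (poly P z * cnj (poly Q z)) = Re (poly R z)"
    using Re_poly_mult_cnj_poly_on_circle[of P Q] by blast
  show ?case
  proof (intro exI[of _ "smult (1/2) (P * Q + R)"] allI impI)
    fix z :: complex assume z: "cmod z = 1"
    have "Re (poly P z) * Re (poly Q z) = (Re (poly P z * poly Q z) + Re (poly P z * cnj (poly Q z))) / 2" by simp
    then show "f z * g z = Re (poly (smult (1/2) (P * Q + R)) z)" using PQ[OF z] R[OF z] by simp
  qed
qed

text \<open>An approximate solution of the Dirichlet problem: Weierstrass approximation by polynomials in the
  real and imaginary parts, which agree on the circle with real parts of holomorphic polynomials. The
  normalisation at the origin makes the mean square of \<open>Im V\<close> at most that of \<open>Re V\<close>.\<close>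
lemma harmonic_polynomial_approximation:
  assumes g: "continuous_on (sphere 0 1) g" and e: "e > 0"
  obtains V where "V holomorphic_on UNIV" "Im (V 0) = 0" "\<And>z. cmod z = 1 \<Longrightarrow> \<bar>Re (V z) - g z\<bar> < e"
proof -
  obtain T where T: "real_polynomial_function T" "\<And>z. z \<in> sphere 0 1 \<Longrightarrow> \<bar>g z - T z\<bar> < e"
    using Stone_Weierstrass_real_polynomial_function[OF compact_sphere g e] by blast
  obtain P where P: "\<And>z. cmod z = 1 \<Longrightarrow> T z = Re (poly P z)" using real_polynomial_on_circle[OF T(1)] by blast
  show ?thesis
  proof (rule that[of "\<lambda>z. poly P z - \<i> * of_real (Im (poly P 0))"])
    show "(\<lambda>z. poly P z - \<i> * of_real (Im (poly P 0))) holomorphic_on UNIV" by (intro holomorphic_intros)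
    show "\<bar>Re (poly P z - \<i> * of_real (Im (poly P 0))) - g z\<bar> < e" if "cmod z = 1" for z
      using T(2)[of z] P[OF that] that by (simp add: abs_minus_commute)
  qed simp
qed

text \<open>Subharmonicity of \<open>|f|\<^bsup>q\<^esup>\<close>. Suppose \<open>|f|\<^bsup>q\<^esup> - Re V\<close> has a positive maximum \<open>m\<close>. Where it is attained \<open>f\<close> has
  no zero, so \<open>|f|\<^bsup>q\<^esup> = |g|\<close> nearby with \<open>g\<close> holomorphic, and for a suitable unimodular \<open>c\<close> the harmonic
  function \<open>Re (c g - V) \<le> |g| - Re V\<close> attains \<open>m\<close> there too. It is then constant nearby, so the set of
  maximum points is open and has no point of largest modulus, although it is compact.\<close>
lemma powr_modulus_le_harmonic:
  assumes f: "f holomorphic_on ball 0 R" and R: "R > 1" and V: "V holomorphic_on UNIV" and q: "q > 0"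
    and le: "\<And>z. cmod z = 1 \<Longrightarrow> cmod (f z) powr q \<le> Re (V z)" and z: "cmod z \<le> 1"
  shows "cmod (f z) powr q \<le> Re (V z)"
proof (rule ccontr)
  assume neg: "\<not> ?thesis"
  define W where "W = (\<lambda>z. cmod (f z) powr q - Re (V z))"
  have contf: "continuous_on (cball 0 1) f"
    by (rule continuous_on_subset[OF holomorphic_on_imp_continuous_on[OF f]]) (use R in auto)
  have contV: "continuous_on (cball 0 1) V"
    by (rule continuous_on_subset[OF holomorphic_on_imp_continuous_on[OF V]]) auto
  have contW: "continuous_on (cball 0 1) W"
    unfolding W_def by (intro continuous_intros continuous_on_powr' contf contV) (use q in auto)
  obtain x where x: "x \<in> cball 0 1" "\<And>y. y \<in> cball 0 1 \<Longrightarrow> W y \<le> W x"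
    using continuous_attains_sup[OF compact_cball _ contW] by force
  define m where "m = W x"
  have m: "m > 0" using x(2)[of z] z neg by (auto simp: m_def W_def)
  define Z where "Z = {y \<in> cball 0 1. W y = m}"
  have "closed Z" unfolding Z_def by (rule continuous_closed_preimage_constant[OF contW]) simp
  moreover have "bounded Z" by (rule bounded_subset[OF bounded_cball[of 0 1]]) (auto simp: Z_def)
  ultimately have "compact Z" by (simp add: compact_eq_bounded_closed)
  moreover have "Z \<noteq> {}" using x(1) by (auto simp: Z_def m_def)
  ultimately obtain w where w: "w \<in> Z" "\<And>y. y \<in> Z \<Longrightarrow> cmod y \<le> cmod w"
    using continuous_attains_sup[of Z cmod] continuous_on_norm_id by blast
  have Ww: "W w = m" "cmod w \<le> 1" using w by (auto simp: Z_def)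
  have w1: "cmod w < 1"
  proof (rule ccontr)
    assume "\<not> ?thesis"
    then have "cmod w = 1" using Ww by simp
    from le[OF this] have "W w \<le> 0" by (simp add: W_def)
    then show False using Ww m by simp
  qed
  have Vpos: "Re (V y) \<ge> 0" if "cmod y \<le> 1" for y
  proof -
    have "Re (- V y) \<le> 0"
    proof (rule maximum_real_frontier[of "\<lambda>z. - V z" "cball 0 1"])
      show "(\<lambda>z. - V z) holomorphic_on interior (cball 0 1)"
        by (intro holomorphic_intros holomorphic_on_subset[OF V]) auto
      show "continuous_on (closure (cball 0 1)) (\<lambda>z. - V z)" using contV by (auto intro: continuous_intros)
      show "Re (- V z) \<le> 0" if "z \<in> frontier (cball 0 1)" for z
      proof -
        have "cmod z = 1" using that by (simp add: frontier_cball)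
        from le[OF this] show ?thesis using powr_ge_zero[of "cmod (f z)" q] by (simp del: powr_ge_zero)
      qed
    qed (use that in auto)
    then show ?thesis by simp
  qed
  have fw: "f w \<noteq> 0"
  proof
    assume "f w = 0"
    then have "W w = - Re (V w)" by (simp add: W_def)
    then show False using Vpos[OF Ww(2)] Ww m by simp
  qed
  have "isCont f w" using contf w1 by (intro continuous_on_interior[OF contf]) auto
  then obtain d1 where d1: "d1 > 0" "\<And>y. dist w y < d1 \<Longrightarrow> f y \<noteq> 0"
    using continuous_at_avoid[of w f 0] fw by auto
  define d where "d = min d1 (1 - cmod w)"
  have d: "d > 0" using d1 w1 by (simp add: d_def)
  have bd: "ball w d \<subseteq> ball 0 1"
  proof
    fix y assume "y \<in> ball w d"
    then show "y \<in> ball 0 1" using norm_triangle_sub[of y w] by (simp add: d_def dist_norm norm_minus_commute)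
  qed
  have fnz: "f y \<noteq> 0" if "y \<in> ball w d" for y using d1(2)[of y] that by (simp add: d_def)
  have fb: "f holomorphic_on ball w d" using f by (rule holomorphic_on_subset) (use bd R in force)
  obtain l where l: "l holomorphic_on ball w d" "\<And>y. y \<in> ball w d \<Longrightarrow> f y = exp (l y)"
    using contractible_imp_holomorphic_log[OF fb convex_imp_contractible[OF convex_ball] fnz] by blast
  define g where "g = (\<lambda>y. exp (of_real q * l y))"
  have gmod: "cmod (g y) = cmod (f y) powr q" if "y \<in> ball w d" for y
    by (simp add: g_def l(2)[OF that] powr_def)
  define c where "c = cnj (g w) / of_real (cmod (g w))"
  have gw: "g w \<noteq> 0" by (simp add: g_def)
  have c1: "cmod c = 1" using gw by (simp add: c_def norm_divide)
  have cg: "c * g w = of_real (cmod (g w))"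
  proof -
    have "c * g w = (g w * cnj (g w)) / of_real (cmod (g w))" by (simp add: c_def)
    also have "\<dots> = of_real (cmod (g w))" using gw unfolding complex_norm_square[symmetric] by (simp add: power2_eq_square)
    finally show ?thesis .
  qed
  define E where "E = (\<lambda>y. exp (c * g y - V y))"
  have Ehol: "E holomorphic_on ball w d"
    unfolding E_def g_def by (intro holomorphic_intros l holomorphic_on_subset[OF V]) auto
  have wd: "w \<in> ball w d" using d by simp
  have Ele: "Re (c * g y - V y) \<le> W y" if "y \<in> ball w d" for y
  proof -
    have "Re (c * g y) \<le> cmod (c * g y)" by (rule complex_Re_le_cmod)
    then show ?thesis using gmod[OF that] by (simp add: W_def norm_mult c1)
  qed
  have Ew: "Re (c * g w - V w) = m" using Ww gmod[OF wd] unfolding cg minus_complex.sel W_def by (simp add: cg)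
  have "E constant_on ball w d"
  proof (rule maximum_modulus_principle[OF Ehol _ _ _ subset_refl wd])
    fix y assume y: "y \<in> ball w d"
    have "W y \<le> m" using x(2)[of y] y bd by (force simp: m_def)
    then have "Re (c * g y - V y) \<le> Re (c * g w - V w)" using Ele[OF y] Ew by linarith
    then show "cmod (E y) \<le> cmod (E w)" by (simp only: E_def norm_exp_eq_Re exp_le_cancel_iff)
  qed auto
  then have "E y = E w" if "y \<in> ball w d" for y using that wd unfolding constant_on_def by metis
  then have "Re (c * g y - V y) = m" if "y \<in> ball w d" for y
  proof -
    have "cmod (E y) = cmod (E w)" using \<open>\<And>y. y \<in> ball w d \<Longrightarrow> E y = E w\<close>[OF that] by simp
    then show ?thesis unfolding E_def norm_exp_eq_Re exp_inj_iff using Ew by simp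
  qed
  then have inZ: "y \<in> Z" if "y \<in> ball w d" for y
    using Ele[OF that] x(2)[of y] that bd by (force simp: Z_def m_def)
  \<comment> \<open>A point of \<open>Z\<close> further out than \<open>w\<close>\<close>
  define y where "y = (if w = 0 then of_real (d / 2) else w + of_real (d / 2 / cmod w) * w)"
  have "cmod y > cmod w \<and> y \<in> ball w d"
  proof (cases "w = 0")
    case True
    then show ?thesis using d by (simp add: y_def)
  next
    case False
    have "y = of_real (1 + d / 2 / cmod w) * w" using False by (simp add: y_def algebra_simps)
    then have "cmod y = (1 + d / 2 / cmod w) * cmod w" using d by (simp only: norm_mult norm_of_real) simp
    also have "\<dots> = cmod w + d / 2" using False by (simp add: ring_distribs)
    finally have "cmod y = cmod w + d / 2" .
    moreover have "dist w y = d / 2"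
    proof -
      have "dist w y = cmod (of_real (d / 2 / cmod w) * w)" using False by (simp add: y_def dist_norm)
      also have "\<dots> = \<bar>d / 2 / cmod w\<bar> * cmod w" by (simp only: norm_mult norm_of_real)
      finally show ?thesis using False d by simp
    qed
    ultimately show ?thesis using d by simp
  qed
  then show False using w(2)[OF inZ[of y]] by simp
qed

text \<open>The limit of approximate harmonic extensions \<open>Re V\<^sub>n\<close> of \<open>|f|\<^bsup>p/2\<^esup>\<close> from the circles of radius \<open>\<rho>\<^sub>n\<close>. The
  mean square of \<open>Re V\<^sub>n\<close> is controlled by the \<open>p\<close>-th mean of \<open>f\<close>, that of \<open>Im V\<^sub>n\<close> by that of \<open>Re V\<^sub>n\<close>, and
  Montel's theorem provides the limit. The exponent \<open>p / 2\<close> is chosen to land in mean square.\<close>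
lemma harmonic_majorant:
  assumes f: "f \<in> hardy_space p" and p: "p \<ge> 1"
  obtains V M where "V holomorphic_on unit_disc" "\<And>r. 0 < r \<Longrightarrow> r < 1 \<Longrightarrow> hardy_mean 2 V r \<le> M"
    "\<And>z. z \<in> unit_disc \<Longrightarrow> cmod (f z) powr (p / 2) \<le> Re (V z)"
proof -
  have fh: "f holomorphic_on unit_disc" and bdd: "bdd_above (hardy_mean p f ` {0<..<1})"
    using f by (auto simp: hardy_space_def)
  obtain A where "\<forall>x\<in>hardy_mean p f ` {0<..<1}. x \<le> A" using bdd unfolding bdd_above_def by blast
  then have A: "hardy_mean p f r \<le> A" if "0 < r" "r < 1" for r using that by auto
  define q where "q = p / 2"
  have q: "q > 0" using p by (simp add: q_def)
  define \<rho> where "\<rho> = (\<lambda>n::nat. 1 - 1 / (real n + 2))"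
  have \<rho>: "0 < \<rho> n" "\<rho> n < 1" for n by (auto simp: \<rho>_def field_simps)
  have \<rho>lim: "\<rho> \<longlonglongrightarrow> 1" unfolding \<rho>_def
    using tendsto_diff[OF tendsto_const LIMSEQ_ignore_initial_segment[OF lim_1_over_n, of 2], of "1::real"]
    by (simp add: add.commute)
  define g where "g = (\<lambda>n z. f (of_real (\<rho> n) * z))"
  have in_disc: "of_real (\<rho> n) * z \<in> unit_disc" if "cmod z < 1 / \<rho> n" for n z
    using that \<rho>[of n] by (simp add: norm_mult field_simps)
  have gh: "g n holomorphic_on ball 0 (1 / \<rho> n)" for n
    unfolding g_def
    by (rule holomorphic_on_compose_gen[of _ _ f unit_disc, unfolded o_def])
       (use in_disc fh in \<open>auto intro!: holomorphic_intros\<close>)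
  have R: "1 / \<rho> n > 1" for n using \<rho>[of n] by simp
  have gcont: "continuous_on (sphere 0 1) (\<lambda>z. cmod (g n z) powr q + 1)" for n
    by (intro continuous_intros continuous_on_powr' continuous_on_subset[OF holomorphic_on_imp_continuous_on[OF gh]])
       (use q R[of n] in auto)
  define M where "M = 4 * A + 32 * pi + 1"
  have "\<exists>V. V holomorphic_on UNIV \<and> Im (V 0) = 0 \<and> (\<forall>z. cmod z = 1 \<longrightarrow> \<bar>Re (V z) - (cmod (g n z) powr q + 1)\<bar> < 1)" for n
    using harmonic_polynomial_approximation[OF gcont, of 1 n] by (metis zero_less_one)
  then obtain V where V: "\<And>n. V n holomorphic_on UNIV" "\<And>n. Im (V n 0) = 0"
    "\<And>n z. cmod z = 1 \<Longrightarrow> \<bar>Re (V n z) - (cmod (g n z) powr q + 1)\<bar> < 1" by metis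
  have Vd: "V n holomorphic_on S" for n S using V(1) by (rule holomorphic_on_subset) auto
  have Vge: "cmod (g n z) powr q \<le> Re (V n z)" if z: "cmod z \<le> 1" for n z
  proof (rule powr_modulus_le_harmonic[OF gh R V(1) q _ z])
    show "cmod (g n z) powr q \<le> Re (V n z)" if "cmod z = 1" for z using V(3)[OF that, of n] by linarith
  qed
  have Vmean1: "hardy_mean 2 (V n) 1 \<le> M" for n
  proof -
    let ?I = "\<lambda>F. integral {0..2*pi} (\<lambda>\<theta>. (F (V n (of_real 1 * cis \<theta>)))\<^sup>2)"
    have cV: "continuous_on {0..2*pi} (\<lambda>\<theta>. V n (of_real 1 * cis \<theta>))"
      by (rule continuous_on_circle[of 2]) (auto intro: holomorphic_on_imp_continuous_on Vd)
    have cg: "continuous_on {0..2*pi} (\<lambda>\<theta>. g n (of_real 1 * cis \<theta>))"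
      by (rule continuous_on_circle[OF holomorphic_on_imp_continuous_on[OF gh]]) (use R in auto)
    have cgp: "continuous_on {0..2*pi} (\<lambda>\<theta>. cmod (g n (of_real 1 * cis \<theta>)) powr p)"
      by (intro continuous_on_powr' continuous_on_norm cg continuous_on_const) (use p in auto)
    have "?I Re - ?I Im = 2 * pi * ((Re (V n 0))\<^sup>2 - (Im (V n 0))\<^sup>2)"
      by (rule mean_square_Re_Im[of _ 2]) (auto intro: Vd)
    moreover have "0 \<le> 2 * pi * ((Re (V n 0))\<^sup>2 - 0\<^sup>2)" by simp
    ultimately have ImRe: "?I Im \<le> ?I Re" unfolding V(2) by linarith
    have "?I Re \<le> integral {0..2*pi} (\<lambda>\<theta>. 2 * cmod (g n (of_real 1 * cis \<theta>)) powr p + 8)"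
    proof (intro integral_le integrable_continuous_real continuous_on_add continuous_on_mult continuous_on_const
        continuous_on_power continuous_on_Re cV cgp)
      fix \<theta>
      let ?z = "of_real 1 * cis \<theta>"
      have z: "cmod ?z = 1" by simp
      define x where "x = cmod (g n ?z) powr q"
      have x0: "x \<ge> 0" by (simp add: x_def)
      have b: "0 \<le> Re (V n ?z)" "Re (V n ?z) \<le> x + 2"
      proof -
        have "\<bar>Re (V n ?z) - (x + 1)\<bar> < 1" using V(3)[OF z, of n] by (simp only: x_def)
        then show "0 \<le> Re (V n ?z)" "Re (V n ?z) \<le> x + 2" using x0 by linarith+
      qed
      have "(Re (V n ?z))\<^sup>2 \<le> (x + 2)\<^sup>2" using b by (intro power_mono) auto
      also have "\<dots> \<le> 2 * x\<^sup>2 + 8"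
        using zero_le_power2[of "x - 2"] by (simp add: power2_eq_square algebra_simps)
      also have "x\<^sup>2 = cmod (g n ?z) powr p"
        by (simp add: x_def q_def power2_eq_square powr_add[symmetric])
      finally show "(Re (V n ?z))\<^sup>2 \<le> 2 * cmod (g n ?z) powr p + 8" .
    qed
    also have "\<dots> = 2 * hardy_mean p f (\<rho> n) + 16 * pi"
    proof (rule integral_unique)
      have "((\<lambda>\<theta>. cmod (f (of_real (\<rho> n) * cis \<theta>)) powr p) has_integral hardy_mean p f (\<rho> n)) {0..2*pi}"
        unfolding hardy_mean_def
        by (intro integrable_integral hardy_integrable holomorphic_on_imp_continuous_on fh) (use \<rho> p in auto)
      then show "((\<lambda>\<theta>. 2 * cmod (g n (of_real 1 * cis \<theta>)) powr p + 8) has_integral 2 * hardy_mean p f (\<rho> n) + 16 * pi) {0..2*pi}"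
        using has_integral_const_real[of "8::real" 0 "2*pi"]
        by (intro has_integral_add has_integral_mult_right) (simp_all add: g_def)
    qed
    also have "\<dots> \<le> 2 * A + 16 * pi" using A[OF \<rho>] by simp
    finally have I: "?I Re \<le> 2 * A + 16 * pi" .
    have "hardy_mean 2 (V n) 1 = ?I Re + ?I Im"
      unfolding hardy_mean_two cmod_power2
      by (intro integral_add integrable_continuous_real continuous_intros cV)
    then show ?thesis using I ImRe by (simp add: M_def)
  qed
  have Vmean: "hardy_mean 2 (V n) r \<le> M" if "0 < r" "r < 1" for n r
    using hardy_mean_two_mono[OF Vd[of n "ball 0 2"], of r 1] Vmean1[of n] that by simp
  have M0: "M > 0"
    using order_trans[OF hardy_mean_nonneg[of p f "1/2"] A[of "1/2"]] by (simp add: M_def add_nonneg_pos)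
  obtain W r where W: "W holomorphic_on unit_disc" and r: "strict_mono (r :: nat \<Rightarrow> nat)"
    and lim: "\<And>x. x \<in> unit_disc \<Longrightarrow> (\<lambda>n. V (r n) x) \<longlonglongrightarrow> W x"
    and ulim: "\<And>K. compact K \<Longrightarrow> K \<subseteq> unit_disc \<Longrightarrow> uniform_limit K (V \<circ> r) W sequentially"
  proof (rule Montel[of unit_disc "range V" V])
    fix K :: "complex set" assume K: "compact K" "K \<subseteq> unit_disc"
    show "\<exists>B. \<forall>h\<in>range V. \<forall>z\<in>K. cmod (h z) \<le> B"
    proof (cases "K = {}")
      case False
      obtain x where x: "x \<in> K" "\<And>z. z \<in> K \<Longrightarrow> cmod z \<le> cmod x"
        using continuous_attains_sup[OF K(1) False, of cmod] by (auto intro: continuous_intros)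
      define s where "s = (1 + cmod x) / 2"
      have s: "cmod x < s" "s < 1" "0 < s" using x(1) K(2) by (auto simp: s_def add_pos_nonneg)
      have "cmod (V n z) \<le> (2 * pi + 1) / (s - cmod x) * M powr (1 / 2)" if "z \<in> K" for n z
      proof -
        have zs: "cmod z < s" using x(2)[OF that] s by simp
        have "cmod (V n z) \<le> (2 * pi + 1) / (s - cmod z) * M powr (1 / 2)"
          by (rule point_evaluation_bound[OF Vd _ s(3,2) zs M0 Vmean[OF s(3,2)]]) simp
        also have "\<dots> \<le> (2 * pi + 1) / (s - cmod x) * M powr (1 / 2)"
          using x(2)[OF that] s zs by (intro mult_right_mono divide_left_mono) auto
        finally show ?thesis .
      qed
      then show ?thesis by blast
    qed auto
  qed (use Vd in auto)
  show ?thesis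
  proof (rule that[OF W])
    show "hardy_mean 2 W s \<le> M" if s: "0 < s" "s < 1" for s
    proof -
      have cVn: "continuous_on {0..2*pi} (\<lambda>\<theta>. V n (of_real s * cis \<theta>))" for n
        by (rule continuous_on_circle[of 1]) (use s in \<open>auto intro: holomorphic_on_imp_continuous_on Vd\<close>)
      have cW: "continuous_on {0..2*pi} (\<lambda>\<theta>. W (of_real s * cis \<theta>))"
        by (rule continuous_on_circle[OF holomorphic_on_imp_continuous_on[OF W]]) (use s in auto)
      have "uniform_limit (sphere 0 s) (V \<circ> r) W sequentially" by (rule ulim) (use s in auto)
      then have "uniform_limit {0..2*pi} (\<lambda>n \<theta>. V (r n) (of_real s * cis \<theta>)) (\<lambda>\<theta>. W (of_real s * cis \<theta>)) sequentially"
        unfolding o_def by (rule uniform_limit_compose') (use s in \<open>auto simp: norm_mult\<close>)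
      then have "uniform_limit {0..2*pi} (\<lambda>n \<theta>. V (r n) (of_real s * cis \<theta>) * cnj (V (r n) (of_real s * cis \<theta>)))
          (\<lambda>\<theta>. W (of_real s * cis \<theta>) * cnj (W (of_real s * cis \<theta>))) sequentially"
      proof (intro uniform_lim_mult)
        show "uniform_limit {0..2*pi} (\<lambda>n \<theta>. cnj (V (r n) (of_real s * cis \<theta>))) (\<lambda>\<theta>. cnj (W (of_real s * cis \<theta>))) sequentially"
          if "uniform_limit {0..2*pi} (\<lambda>n \<theta>. V (r n) (of_real s * cis \<theta>)) (\<lambda>\<theta>. W (of_real s * cis \<theta>)) sequentially"
          using that unfolding uniform_limit_iff dist_norm by (simp add: complex_cnj_diff[symmetric] del: complex_cnj_diff)
        show "bounded ((\<lambda>\<theta>. W (of_real s * cis \<theta>)) ` {0..2*pi})"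
          by (intro compact_imp_bounded compact_continuous_image cW) auto
        show "bounded ((\<lambda>\<theta>. cnj (W (of_real s * cis \<theta>))) ` {0..2*pi})"
          by (intro compact_imp_bounded compact_continuous_image continuous_intros cW) auto
      qed auto
      then obtain I J where I: "\<And>n. ((\<lambda>\<theta>. V (r n) (of_real s * cis \<theta>) * cnj (V (r n) (of_real s * cis \<theta>))) has_integral I n) {0..2*pi}"
        and J: "((\<lambda>\<theta>. W (of_real s * cis \<theta>) * cnj (W (of_real s * cis \<theta>))) has_integral J) {0..2*pi}" and IJ: "I \<longlonglongrightarrow> J"
        by (rule uniform_limit_integral) (auto intro!: continuous_intros cVn)
      have hm: "hardy_mean 2 F s = Re K" if "((\<lambda>\<theta>. F (of_real s * cis \<theta>) * cnj (F (of_real s * cis \<theta>))) has_integral K) {0..2*pi}" for F K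
        using integral_unique[OF has_integral_Re[OF that]] unfolding hardy_mean_two complex_norm_square[symmetric]
        by (simp add: complex_norm_square[symmetric] del: of_real_power)
      have "(\<lambda>n. Re (I n)) \<longlonglongrightarrow> Re J" by (intro tendsto_intros IJ)
      then have "(\<lambda>n. hardy_mean 2 (V (r n)) s) \<longlonglongrightarrow> hardy_mean 2 W s"
        using hm[OF I] hm[OF J] by simp
      then show ?thesis by (rule LIMSEQ_le_const2) (use Vmean[OF s] in auto)
    qed
    fix z :: complex assume z: "z \<in> unit_disc"
    have cf: "isCont f z" using continuous_on_interior[OF holomorphic_on_imp_continuous_on[OF fh], of z] z by simp
    have rtop: "filterlim r at_top sequentially" using r by (rule filterlim_subseq)
    have "(\<lambda>n. of_real (\<rho> (r n)) * z) \<longlonglongrightarrow> of_real 1 * z"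
      by (intro tendsto_intros filterlim_compose[OF \<rho>lim rtop])
    then have "(\<lambda>n. f (of_real (\<rho> (r n)) * z)) \<longlonglongrightarrow> f z" using isCont_tendsto_compose[OF cf] by simp
    then have "(\<lambda>n. cmod (g (r n) z) powr q) \<longlonglongrightarrow> cmod (f z) powr q"
      unfolding g_def by (intro tendsto_powr' tendsto_norm tendsto_const) (use q in auto)
    moreover have "(\<lambda>n. Re (V (r n) z)) \<longlonglongrightarrow> Re (W z)" by (intro tendsto_intros lim z)
    ultimately have "cmod (f z) powr q \<le> Re (W z)"
      by (rule LIMSEQ_le) (use Vge[of z] z in auto)
    then show "cmod (f z) powr (p / 2) \<le> Re (W z)" by (simp add: q_def)
  qed
qed

text \<open>For the multiplier \<open>(1 + \<zeta>)\<^bsup>-\<eta>\<^esup>\<close>, which has modulus at most 1 on the right half plane and tends to 1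
  as \<open>\<zeta> \<longlonglongrightarrow> 0\<close>.\<close>
lemma one_minus_inverse_power_bound:
  assumes \<zeta>: "Re \<zeta> \<ge> 0" and \<eta>: "\<eta> > 0"
  shows "cmod (1 - exp (- (of_real \<eta> * Ln (1 + \<zeta>)))) \<le> \<eta> * cmod \<zeta>"
    and "cmod (1 - exp (- (of_real \<eta> * Ln (1 + \<zeta>)))) \<le> 2"
    and "cmod (exp (- (of_real \<eta> * Ln (1 + \<zeta>)))) = cmod (1 + \<zeta>) powr (- \<eta>)"
proof -
  let ?P = "\<lambda>\<zeta>. exp (- (of_real \<eta> * Ln (1 + \<zeta>)))"
  have mod: "cmod (?P w) = cmod (1 + w) powr (- \<eta>)" and ge1: "1 \<le> cmod (1 + w)" and nz: "1 + w \<noteq> 0"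
    if "Re w \<ge> 0" for w
  proof -
    show ge1: "1 \<le> cmod (1 + w)" using complex_Re_le_cmod[of "1 + w"] that by simp
    then show nz: "1 + w \<noteq> 0" by auto
    show "cmod (?P w) = cmod (1 + w) powr (- \<eta>)" using nz by (simp add: powr_def)
  qed
  have le1: "cmod (?P w) \<le> 1" if "Re w \<ge> 0" for w
  proof -
    have "cmod (1 + w) powr (- \<eta>) \<le> 1 powr (- \<eta>)" by (rule powr_mono2') (use ge1[OF that] \<eta> in auto)
    then show ?thesis using mod[OF that] by simp
  qed
  show "cmod (?P \<zeta>) = cmod (1 + \<zeta>) powr (- \<eta>)" by (rule mod[OF \<zeta>])
  show "cmod (1 - ?P \<zeta>) \<le> 2" using norm_triangle_ineq4[of 1 "?P \<zeta>", unfolded norm_one] le1[OF \<zeta>] by linarith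
  have "cmod (?P \<zeta> - ?P 0) \<le> \<eta> * cmod (\<zeta> - 0)"
  proof (rule field_differentiable_bound[of "{w. 0 \<le> Re w}" ?P "\<lambda>w. ?P w * (- (of_real \<eta> / (1 + w)))"])
    show "convex {w. 0 \<le> Re w}" using convex_halfspace_Re_ge[of 0] by simp
    fix w assume w: "w \<in> {w. 0 \<le> Re w}"
    then have "1 + w \<notin> \<real>\<^sub>\<le>\<^sub>0" by (auto simp: complex_nonpos_Reals_iff)
    then show "(?P has_field_derivative ?P w * (- (of_real \<eta> / (1 + w)))) (at w within {w. 0 \<le> Re w})"
      by (auto intro!: derivative_eq_intros simp: field_simps)
    have "\<eta> / cmod (1 + w) \<le> \<eta> / 1" using ge1[of w] w \<eta> by (intro divide_left_mono) auto
    then have "cmod (?P w) * (\<eta> / cmod (1 + w)) \<le> 1 * \<eta>" using le1[of w] w \<eta> by (intro mult_mono) auto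
    then show "cmod (?P w * (- (of_real \<eta> / (1 + w)))) \<le> \<eta>" using \<eta> by (simp add: norm_mult norm_divide)
  qed (use \<zeta> in auto)
  then show "cmod (1 - ?P \<zeta>) \<le> \<eta> * cmod \<zeta>" by (simp add: norm_minus_commute)
qed

text \<open>Take \<open>g = f P\<close> with \<open>P = (1 + \<epsilon> V)\<^bsup>-2/p\<^esup>\<close>. Since \<open>|1 + \<epsilon> V| \<ge> \<epsilon> |f|\<^bsup>p/2\<^esup>\<close>, the product is bounded. Moreover
  \<open>|f - g|\<^bsup>p\<^esup> \<le> |V|\<^sup>2 |1 - P|\<^bsup>p\<^esup>\<close>; here \<open>V\<close> is replaced by a bounded dilate \<open>Q\<close> up to a small error in mean
  square, and what remains is of order \<open>\<epsilon>\<close> because \<open>|1 - P|\<close> is at most a multiple of \<open>\<epsilon> |V|\<close>.\<close>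
lemma bounded_holomorphic_dense:
  assumes f: "f \<in> hardy_space p" and p: "p \<ge> 1" and \<delta>: "\<delta> > 0"
  obtains g where "bounded_holomorphic g" "\<And>r. 0 < r \<Longrightarrow> r < 1 \<Longrightarrow> hardy_mean p (\<lambda>z. f z - g z) r \<le> \<delta>"
proof -
  have fh: "f holomorphic_on unit_disc" using f by (auto simp: hardy_space_def)
  obtain V M where V: "V holomorphic_on unit_disc" "\<And>r. 0 < r \<Longrightarrow> r < 1 \<Longrightarrow> hardy_mean 2 V r \<le> M"
    "\<And>z. z \<in> unit_disc \<Longrightarrow> cmod (f z) powr (p / 2) \<le> Re (V z)" using harmonic_majorant[OF f p] by blast
  have M0: "M \<ge> 0" using V(2)[of "1/2"] hardy_mean_nonneg[of 2 V "1/2"] by simp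
  \<comment> \<open>From \<open>m \<le> 2\<close> one gets \<open>m\<^bsup>p\<^esup> \<le> c m\<close>\<close>
  define c where "c = 2 powr (p - 1)"
  have c: "c > 0" by (simp add: c_def)
  obtain \<rho> where \<rho>: "0 < \<rho>" "\<rho> < 1" "\<And>r. 0 < r \<Longrightarrow> r < 1 \<Longrightarrow> hardy_mean 2 (\<lambda>z. V z - V (of_real \<rho> * z)) r \<le> \<delta> / (8 * c)"
    using dilation_approximation_mean_square[OF V(1,2), of "\<delta> / (8 * c)"] \<delta> c by (metis divide_pos_pos mult_pos_pos zero_less_numeral)
  define Q where "Q = (\<lambda>z. V (of_real \<rho> * z))"
  have ins: "of_real \<rho> * z \<in> cball 0 \<rho>" if "z \<in> unit_disc" for z using that \<rho> by (simp add: norm_mult)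
  have cbs: "cball 0 \<rho> \<subseteq> unit_disc" using \<rho> by auto
  have Qh: "Q holomorphic_on unit_disc"
    unfolding Q_def by (rule holomorphic_on_compose_gen[of _ _ V unit_disc, unfolded o_def])
      (use ins cbs V in \<open>auto intro!: holomorphic_intros\<close>)
  have "bounded (V ` cball 0 \<rho>)"
    by (intro compact_imp_bounded compact_continuous_image holomorphic_on_imp_continuous_on holomorphic_on_subset[OF V(1) cbs]) auto
  then obtain B where B: "B > 0" "\<And>z. z \<in> unit_disc \<Longrightarrow> cmod (Q z) \<le> B"
    unfolding bounded_pos Q_def using ins by (metis imageI)
  define \<eta> where "\<eta> = 2 / p"
  have \<eta>: "\<eta> > 0" using p by (simp add: \<eta>_def)
  \<comment> \<open>Chosen so that the part of the error linear in \<open>\<epsilon>\<close> is \<open>\<delta> / 2\<close>\<close>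
  define \<epsilon> where "\<epsilon> = \<delta> / (4 * c * B\<^sup>2 * \<eta> * (2 * pi + M))"
  have D: "4 * c * B\<^sup>2 * \<eta> * (2 * pi + M) > 0" using c B \<eta> M0 by (intro mult_pos_pos add_pos_nonneg) auto
  have \<epsilon>: "\<epsilon> > 0" using \<delta> D by (simp add: \<epsilon>_def)
  define P where "P = (\<lambda>z. exp (- (of_real \<eta> * Ln (1 + of_real \<epsilon> * V z))))"
  have ReV: "Re (V z) \<ge> 0" if "z \<in> unit_disc" for z
    using V(3)[OF that] powr_ge_zero[of "cmod (f z)" "p/2"] by linarith
  have Re\<epsilon>V: "Re (of_real \<epsilon> * V z) \<ge> 0" if "z \<in> unit_disc" for z using ReV[OF that] \<epsilon> by simp
  have Ph: "P holomorphic_on unit_disc"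
  proof -
    have "1 + of_real \<epsilon> * V z \<notin> \<real>\<^sub>\<le>\<^sub>0" if "z \<in> unit_disc" for z
      using Re\<epsilon>V[OF that] by (auto simp: complex_nonpos_Reals_iff)
    then show ?thesis unfolding P_def by (intro holomorphic_intros V) auto
  qed
  define g where "g = (\<lambda>z. f z * P z)"
  have gh: "g holomorphic_on unit_disc" unfolding g_def by (intro holomorphic_intros fh Ph)
  have gB: "cmod (g z) \<le> \<epsilon> powr (- \<eta>)" if z: "z \<in> unit_disc" for z
  proof (cases "f z = 0")
    case False
    let ?x = "cmod (f z)"
    have x: "?x > 0" using False by simp
    have "\<epsilon> * ?x powr (p / 2) \<le> \<epsilon> * Re (V z)" using V(3)[OF z] \<epsilon> by simp
    also have "\<dots> \<le> Re (1 + of_real \<epsilon> * V z)" by simp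
    also have "\<dots> \<le> cmod (1 + of_real \<epsilon> * V z)" by (rule complex_Re_le_cmod)
    finally have le: "\<epsilon> * ?x powr (p / 2) \<le> cmod (1 + of_real \<epsilon> * V z)" .
    have "cmod (P z) = cmod (1 + of_real \<epsilon> * V z) powr (- \<eta>)"
      unfolding P_def by (rule one_minus_inverse_power_bound(3)[OF Re\<epsilon>V[OF z] \<eta>])
    also have "\<dots> \<le> (\<epsilon> * ?x powr (p / 2)) powr (- \<eta>)"
      by (rule powr_mono2') (use le x \<epsilon> \<eta> in auto)
    also have "\<dots> = \<epsilon> powr (- \<eta>) * ?x powr (- 1)"
      using x \<epsilon> p by (simp add: powr_mult powr_powr \<eta>_def)
    finally have "cmod (P z) \<le> \<epsilon> powr (- \<eta>) * ?x powr (- 1)" .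
    then have "?x * cmod (P z) \<le> ?x * (\<epsilon> powr (- \<eta>) * ?x powr (- 1))" by (rule mult_left_mono) simp
    also have "\<dots> = \<epsilon> powr (- \<eta>)" using x by (simp add: powr_minus field_simps)
    finally show ?thesis by (simp add: g_def norm_mult)
  qed (simp add: g_def)
  show ?thesis
  proof (rule that[OF bounded_holomorphicI[OF gh gB]])
    fix r :: real assume r: "0 < r" "r < 1"
    have p0: "p > 0" using p by simp
    have "hardy_mean p (\<lambda>z. f z - g z) r \<le> c * (4 * hardy_mean 2 (\<lambda>z. V z - Q z) r + 2 * B\<^sup>2 * \<eta> * \<epsilon> * (2 * pi + hardy_mean 2 V r))"
    proof (rule hardy_mean_bound[OF _ p0 r])
      show "(\<lambda>z. f z - g z) holomorphic_on unit_disc" by (intro holomorphic_intros fh gh)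
      let ?z = "\<lambda>\<theta>. of_real r * cis \<theta>"
      show "((\<lambda>\<theta>. c * (4 * cmod (V (?z \<theta>) - Q (?z \<theta>)) powr 2 + 2 * B\<^sup>2 * \<eta> * \<epsilon> * (1 + cmod (V (?z \<theta>)) powr 2))) has_integral
          c * (4 * hardy_mean 2 (\<lambda>z. V z - Q z) r + 2 * B\<^sup>2 * \<eta> * \<epsilon> * (2 * pi + hardy_mean 2 V r))) {0..2*pi}"
        unfolding hardy_mean_def using has_integral_const_real[of "1::real" 0 "2*pi"]
        by (intro has_integral_mult_right has_integral_add integrable_integral hardy_integrable[of "\<lambda>z. V z - Q z"] hardy_integrable[of V]
            holomorphic_on_imp_continuous_on holomorphic_on_diff V(1) Qh) (use r in auto)
      fix \<theta>
      let ?w = "?z \<theta>"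
      have w: "?w \<in> unit_disc" by (rule circle_in_disc[OF r])
      define m where "m = cmod (1 - P ?w)"
      define v where "v = cmod (V ?w)"
      have m: "0 \<le> m" "m \<le> 2" "m \<le> \<eta> * (\<epsilon> * v)"
        using one_minus_inverse_power_bound(1,2)[OF Re\<epsilon>V[OF w] \<eta>] \<epsilon> by (auto simp: m_def v_def P_def norm_mult)
      have mp: "m powr p \<le> c * m"
      proof (cases "m = 0")
        case False
        then have "m powr p = m powr (p - 1) * m" using m(1) by (simp add: powr_diff)
        also have "\<dots> \<le> c * m" unfolding c_def using m p by (intro mult_right_mono powr_mono2) auto
        finally show ?thesis .
      qed simp
      have v0: "v \<ge> 0" by (simp add: v_def)
      have fp: "cmod (f ?w) powr p \<le> v\<^sup>2"
      proof -
        have "cmod (f ?w) powr p = (cmod (f ?w) powr (p / 2))\<^sup>2" by (simp add: power2_eq_square powr_add[symmetric])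
        also have "\<dots> \<le> v\<^sup>2" using V(3)[OF w] complex_Re_le_cmod[of "V ?w"] by (intro power_mono) (auto simp: v_def)
        finally show ?thesis .
      qed
      have v2: "v\<^sup>2 \<le> 2 * (cmod (V ?w - Q ?w))\<^sup>2 + 2 * B\<^sup>2"
      proof -
        have "v \<le> cmod (V ?w - Q ?w) + B" using norm_triangle_sub[of "V ?w" "Q ?w"] B(2)[OF w] by (simp add: v_def)
        then have "v\<^sup>2 \<le> (cmod (V ?w - Q ?w) + B)\<^sup>2" using v0 by (intro power_mono) auto
        also have "\<dots> \<le> 2 * (cmod (V ?w - Q ?w))\<^sup>2 + 2 * B\<^sup>2"
          using zero_le_power2[of "cmod (V ?w - Q ?w) - B"] by (simp add: power2_eq_square algebra_simps)
        finally show ?thesis .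
      qed
      have v1: "v \<le> 1 + v\<^sup>2"
        using zero_le_power2[of "v - 1/2"] by (simp add: power2_eq_square algebra_simps)
      have "cmod (f ?w - g ?w) = cmod (f ?w) * m"
        by (simp add: g_def m_def norm_mult[symmetric] algebra_simps)
      then have "cmod (f ?w - g ?w) powr p = cmod (f ?w) powr p * m powr p" using m by (simp add: powr_mult)
      also have "\<dots> \<le> v\<^sup>2 * (c * m)" using fp mp by (intro mult_mono) auto
      also have "\<dots> = c * (v\<^sup>2 * m)" by simp
      also have "\<dots> \<le> c * (4 * (cmod (V ?w - Q ?w))\<^sup>2 + 2 * B\<^sup>2 * \<eta> * \<epsilon> * (1 + v\<^sup>2))"
      proof (rule mult_left_mono)
        have "v\<^sup>2 * m \<le> (2 * (cmod (V ?w - Q ?w))\<^sup>2 + 2 * B\<^sup>2) * m" using v2 m by (intro mult_right_mono) auto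
        also have "\<dots> = 2 * (cmod (V ?w - Q ?w))\<^sup>2 * m + 2 * B\<^sup>2 * m" by (simp add: algebra_simps)
        also have "\<dots> \<le> 2 * (cmod (V ?w - Q ?w))\<^sup>2 * 2 + 2 * B\<^sup>2 * (\<eta> * (\<epsilon> * (1 + v\<^sup>2)))"
        proof (intro add_mono mult_left_mono)
          have "\<eta> * (\<epsilon> * v) \<le> \<eta> * (\<epsilon> * (1 + v\<^sup>2))" using v1 \<eta> \<epsilon> by (intro mult_left_mono) auto
          then show "m \<le> \<eta> * (\<epsilon> * (1 + v\<^sup>2))" using m(3) by linarith
        qed (use m in auto)
        finally show "v\<^sup>2 * m \<le> 4 * (cmod (V ?w - Q ?w))\<^sup>2 + 2 * B\<^sup>2 * \<eta> * \<epsilon> * (1 + v\<^sup>2)" by (simp add: mult_ac)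
      qed (use c in simp)
      finally show "cmod (f ?w - g ?w) powr p \<le> c * (4 * cmod (V ?w - Q ?w) powr 2 + 2 * B\<^sup>2 * \<eta> * \<epsilon> * (1 + cmod (V ?w) powr 2))"
        by (simp add: v_def powr_two_eq_power2)
    qed
    also have "\<dots> \<le> c * (4 * (\<delta> / (8 * c)) + 2 * B\<^sup>2 * \<eta> * \<epsilon> * (2 * pi + M))"
      using c \<eta> \<epsilon> \<rho>(3)[OF r] V(2)[OF r] by (intro mult_left_mono add_mono) (auto simp: Q_def)
    also have "\<dots> = \<delta> / 2 + \<epsilon> * (4 * c * B\<^sup>2 * \<eta> * (2 * pi + M)) / 2" using c by (simp add: field_simps)
    also have "\<epsilon> * (4 * c * B\<^sup>2 * \<eta> * (2 * pi + M)) = \<delta>"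
      using nonzero_eq_divide_eq[of "4 * c * B\<^sup>2 * \<eta> * (2 * pi + M)" \<epsilon> \<delta>] D \<epsilon>_def by auto
    finally show "hardy_mean p (\<lambda>z. f z - g z) r \<le> \<delta>" by simp
  qed
qed

section \<open>Bounded functionals on the Hardy space\<close>

text \<open>The density of the exponentials is proved in its dual form, for one continuous functional at a time.\<close>
locale hardy_functional =
  fixes p :: real and L :: "(complex \<Rightarrow> complex) \<Rightarrow> complex" and C :: real
  assumes p_ge_1: "1 \<le> p"
    and L_add: "f \<in> hardy_space p \<Longrightarrow> g \<in> hardy_space p \<Longrightarrow> L (\<lambda>z. f z + g z) = L f + L g"
    and L_scale: "f \<in> hardy_space p \<Longrightarrow> L (\<lambda>z. c * f z) = c * L f"
    and L_bound: "f \<in> hardy_space p \<Longrightarrow> cmod (L f) \<le> C * hardy_norm p f"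
begin

definition \<Lambda> :: "(complex \<Rightarrow> complex) \<Rightarrow> complex" where
  "\<Lambda> f = L (disc_restrict f)"

lemma \<Lambda>_add:
  assumes "bounded_holomorphic f" "bounded_holomorphic g"
  shows "\<Lambda> (\<lambda>z. f z + g z) = \<Lambda> f + \<Lambda> g"
proof -
  have "disc_restrict (\<lambda>z. f z + g z) = (\<lambda>z. disc_restrict f z + disc_restrict g z)"
    by (auto simp: disc_restrict_def)
  then show ?thesis unfolding \<Lambda>_def
    using L_add hardy_space_disc_restrict assms p_ge_1 by simp
qed

lemma \<Lambda>_cmult:
  assumes "bounded_holomorphic f"
  shows "\<Lambda> (\<lambda>z. c * f z) = c * \<Lambda> f"
proof -
  have "disc_restrict (\<lambda>z. c * f z) = (\<lambda>z. c * disc_restrict f z)" by (auto simp: disc_restrict_def)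
  then show ?thesis unfolding \<Lambda>_def using L_scale hardy_space_disc_restrict assms p_ge_1 by simp
qed

lemma \<Lambda>_diff:
  assumes "bounded_holomorphic f" "bounded_holomorphic g"
  shows "\<Lambda> (\<lambda>z. f z - g z) = \<Lambda> f - \<Lambda> g"
  using \<Lambda>_add[OF assms(1) bounded_holomorphic_cmult[OF assms(2), of "-1"]] \<Lambda>_cmult[OF assms(2), of "-1"] by simp

lemma \<Lambda>_sum:
  assumes "finite I" "\<And>i. i \<in> I \<Longrightarrow> bounded_holomorphic (f i)"
  shows "\<Lambda> (\<lambda>z. \<Sum>i\<in>I. f i z) = (\<Sum>i\<in>I. \<Lambda> (f i))"
  using assms
proof (induction I rule: finite_induct)
  case empty
  show ?case using \<Lambda>_cmult[OF bounded_holomorphic_const, of 0 0] by simp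
next
  case (insert i I)
  then show ?case using \<Lambda>_add[of "f i" "\<lambda>z. \<Sum>i\<in>I. f i z"] bounded_holomorphic_sum[of I f] by simp
qed

lemma L_mean_bound:
  assumes "f \<in> hardy_space p" "\<And>r. 0 < r \<Longrightarrow> r < 1 \<Longrightarrow> hardy_mean p f r \<le> E"
  shows "cmod (L f) \<le> \<bar>C\<bar> * E powr (1 / p)"
proof -
  have "cmod (L f) \<le> C * hardy_norm p f" by (rule L_bound[OF assms(1)])
  also have "\<dots> \<le> \<bar>C\<bar> * hardy_norm p f"
    by (intro mult_right_mono) (auto simp: hardy_norm_def)
  also have "\<dots> \<le> \<bar>C\<bar> * E powr (1 / p)"
    by (intro mult_left_mono hardy_norm_bound) (use p_ge_1 assms in auto)
  finally show ?thesis .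
qed

lemma L_eq_0_approx:
  assumes f: "f \<in> hardy_space p"
    and approx: "\<And>\<delta>. \<delta> > 0 \<Longrightarrow> \<exists>g. f - g \<in> hardy_space p \<and> g \<in> hardy_space p \<and> L g = 0 \<and>
       (\<forall>r. 0 < r \<and> r < 1 \<longrightarrow> hardy_mean p (f - g) r \<le> \<delta>)"
  shows "L f = 0"
proof -
  have "cmod (L f) \<le> \<bar>C\<bar> * \<delta> powr (1 / p)" if \<delta>: "\<delta> > 0" for \<delta>
  proof -
    obtain g where g: "f - g \<in> hardy_space p" "g \<in> hardy_space p" "L g = 0"
       "\<And>r. 0 < r \<Longrightarrow> r < 1 \<Longrightarrow> hardy_mean p (f - g) r \<le> \<delta>" using approx[OF \<delta>] by blast
    have "L f = L (f - g)" using L_add[OF g(1,2)] g(3) by simp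
    then show ?thesis using L_mean_bound[OF g(1,4)] by simp
  qed
  then have "\<forall>\<^sub>F \<delta> in at_right 0. cmod (L f) \<le> \<bar>C\<bar> * \<delta> powr (1 / p)"
    by (auto simp: eventually_at_filter)
  moreover have "((\<lambda>\<delta>. \<bar>C\<bar> * \<delta> powr (1 / p)) \<longlongrightarrow> \<bar>C\<bar> * 0) (at_right 0)"
  proof (intro tendsto_intros)
    show "((\<lambda>\<delta>. \<delta> powr (1 / p)) \<longlongrightarrow> 0) (at_right 0)"
      by (rule tendsto_eq_rhs, rule tendsto_powr'[OF tendsto_ident_at tendsto_const])
         (use p_ge_1 in \<open>auto simp: eventually_at_filter\<close>)
  qed
  ultimately have "cmod (L f) \<le> \<bar>C\<bar> * 0" by (intro tendsto_lowerbound) auto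
  then show ?thesis by simp
qed

lemma disc_restrict_diff: "disc_restrict f - disc_restrict g = disc_restrict (\<lambda>z. f z - g z)"
  by (auto simp: disc_restrict_def fun_eq_iff)

text \<open>Uniformly bounded convergence in mean square implies convergence in the Hardy space, so the kernel
  is closed under it.\<close>
lemma \<Lambda>_eq_0_approx_mean_square:
  assumes f: "bounded_holomorphic f"
    and approx: "\<And>\<delta>. \<delta> > 0 \<Longrightarrow> \<exists>g. bounded_holomorphic g \<and> \<Lambda> g = 0 \<and>
       (\<forall>z\<in>unit_disc. cmod (f z - g z) \<le> B) \<and> (\<forall>r. 0 < r \<and> r < 1 \<longrightarrow> hardy_mean 2 (\<lambda>z. f z - g z) r \<le> \<delta>)"
  shows "\<Lambda> f = 0"
  unfolding \<Lambda>_def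
proof (rule L_eq_0_approx)
  have p0: "p > 0" using p_ge_1 by simp
  show "disc_restrict f \<in> hardy_space p" by (rule hardy_space_disc_restrict[OF f p0])
  fix \<delta> :: real assume \<delta>: "\<delta> > 0"
  \<comment> \<open>The constant part \<open>2 \<pi> d\<^bsup>p\<^esup>\<close> of the bound then is \<open>\<delta> / 2\<close>\<close>
  define d where "d = (\<delta> / (4 * pi)) powr (1 / p)"
  have d: "d > 0" using \<delta> by (simp add: d_def)
  have dp: "d powr p = \<delta> / (4 * pi)" using \<delta> p0 by (simp add: d_def powr_powr)
  define K where "K = B powr (p - 2) + d powr (p - 2)"
  have K: "K > 0" using d by (simp add: K_def add_nonneg_pos)
  obtain g where g: "bounded_holomorphic g" "\<Lambda> g = 0"
     "\<And>z. z\<in>unit_disc \<Longrightarrow> cmod (f z - g z) \<le> B"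
     "\<And>r. 0 < r \<Longrightarrow> r < 1 \<Longrightarrow> hardy_mean 2 (\<lambda>z. f z - g z) r \<le> \<delta> / (2 * K)"
    using approx[of "\<delta> / (2 * K)"] \<delta> K by auto
  have fg: "bounded_holomorphic (\<lambda>z. f z - g z)" by (rule bounded_holomorphic_diff[OF f g(1)])
  have hol: "(\<lambda>z. f z - g z) holomorphic_on unit_disc" by (rule bounded_holomorphic_imp_holomorphic[OF fg])
  have "hardy_mean p (disc_restrict (\<lambda>z. f z - g z)) r \<le> \<delta>" if r: "0 < r" "r < 1" for r
  proof -
    have "hardy_mean p (disc_restrict (\<lambda>z. f z - g z)) r = hardy_mean p (\<lambda>z. f z - g z) r"
      by (rule hardy_mean_cong) (use r in \<open>auto simp: disc_restrict_def\<close>)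
    also have "\<dots> \<le> 2 * pi * d powr p + K * hardy_mean 2 (\<lambda>z. f z - g z) r"
    proof (rule hardy_mean_bound[OF hol p0 r])
      let ?D = "\<lambda>\<theta>. cmod (f (of_real r * cis \<theta>) - g (of_real r * cis \<theta>))"
      show "((\<lambda>\<theta>. d powr p + K * ?D \<theta> powr 2) has_integral 2 * pi * d powr p + K * hardy_mean 2 (\<lambda>z. f z - g z) r) {0..2*pi}"
        unfolding hardy_mean_def using has_integral_const_real[of "d powr p" 0 "2*pi"]
        by (intro has_integral_add has_integral_mult_right integrable_integral
             hardy_integrable[of "\<lambda>z. f z - g z"] holomorphic_on_imp_continuous_on hol) (use r in auto)
      show "?D \<theta> powr p \<le> d powr p + K * ?D \<theta> powr 2" for \<theta>
        using powr_le_of_bounded[of "?D \<theta>" B d p] g(3)[OF circle_in_disc[OF r]] d p_ge_1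
        by (simp add: K_def powr_two_eq_power2)
    qed
    also have "\<dots> \<le> 2 * pi * d powr p + K * (\<delta> / (2 * K))"
      using g(4)[OF r] K by (intro add_left_mono mult_left_mono) auto
    also have "\<dots> = \<delta>" using K by (simp add: dp)
    finally show ?thesis .
  qed
  then show "\<exists>ga. disc_restrict f - ga \<in> hardy_space p \<and> ga \<in> hardy_space p \<and> L ga = 0 \<and>
     (\<forall>r. 0 < r \<and> r < 1 \<longrightarrow> hardy_mean p (disc_restrict f - ga) r \<le> \<delta>)"
    using g(2) by (intro exI[of _ "disc_restrict g"])
      (auto simp: disc_restrict_diff \<Lambda>_def intro!: hardy_space_disc_restrict[OF _ p0] fg g(1))
qed

lemma \<Lambda>_sup_bound:
  assumes f: "f holomorphic_on unit_disc" and B: "\<And>z. z \<in> unit_disc \<Longrightarrow> cmod (f z) \<le> B"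
  shows "cmod (\<Lambda> f) \<le> \<bar>C\<bar> * (2 * pi) powr (1 / p) * B"
proof -
  have p0: "p > 0" using p_ge_1 by simp
  have B0: "B \<ge> 0" using B[of 0] by (auto intro: order_trans[OF norm_ge_zero])
  have "cmod (L (disc_restrict f)) \<le> \<bar>C\<bar> * (2 * pi * B powr p) powr (1 / p)"
  proof (rule L_mean_bound)
    show "disc_restrict f \<in> hardy_space p"
      by (rule hardy_space_disc_restrict[OF bounded_holomorphicI[OF f B] p0])
    show "hardy_mean p (disc_restrict f) r \<le> 2 * pi * B powr p" if "0 < r" "r < 1" for r
      using hardy_mean_const_bound[OF f p0 that B] hardy_mean_cong[of "disc_restrict f" f r p] that
      by (simp add: disc_restrict_def)
  qed
  also have "(2 * pi * B powr p) powr (1 / p) = (2 * pi) powr (1 / p) * B"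
    using B0 p0 by (simp add: powr_mult powr_powr)
  finally show ?thesis by (simp add: \<Lambda>_def mult_ac)
qed

lemma \<Lambda>_eq_0_approx_sup:
  assumes f: "bounded_holomorphic f"
    and approx: "\<And>\<delta>. \<delta> > 0 \<Longrightarrow> \<exists>g. bounded_holomorphic g \<and> \<Lambda> g = 0 \<and> (\<forall>z\<in>unit_disc. cmod (f z - g z) \<le> \<delta>)"
  shows "\<Lambda> f = 0"
proof -
  let ?K = "\<bar>C\<bar> * (2 * pi) powr (1 / p)"
  have le: "cmod (\<Lambda> f) \<le> ?K * \<delta>" if \<delta>: "\<delta> > 0" for \<delta>
  proof -
    obtain g where g: "bounded_holomorphic g" "\<Lambda> g = 0" "\<And>z. z\<in>unit_disc \<Longrightarrow> cmod (f z - g z) \<le> \<delta>"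
      using approx[OF \<delta>] by blast
    have "cmod (\<Lambda> (\<lambda>z. f z - g z)) \<le> ?K * \<delta>"
      by (rule \<Lambda>_sup_bound[OF bounded_holomorphic_imp_holomorphic[OF bounded_holomorphic_diff[OF f g(1)]] g(3)])
    then show ?thesis using \<Lambda>_diff[OF f g(1)] g(2) by simp
  qed
  have "\<forall>\<^sub>F \<delta> in at_right 0. cmod (\<Lambda> f) \<le> ?K * \<delta>"
    using le by (auto simp: eventually_at_filter)
  moreover have "((\<lambda>\<delta>. ?K * \<delta>) \<longlongrightarrow> ?K * 0) (at_right 0)" by (intro tendsto_intros)
  ultimately have "cmod (\<Lambda> f) \<le> ?K * 0" by (intro tendsto_lowerbound) auto
  then show ?thesis by simp
qed

text \<open>The integral is a uniform limit of its Riemann sums.\<close>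
lemma \<Lambda>_integral_eq_0:
  assumes bh: "\<And>s. s \<in> {0..1} \<Longrightarrow> bounded_holomorphic (k s)"
    and zero: "\<And>s. s \<in> {0..1} \<Longrightarrow> \<Lambda> (k s) = 0"
    and uc: "\<And>\<epsilon>. \<epsilon> > 0 \<Longrightarrow> \<exists>\<delta>>0. \<forall>s\<in>{0..1::real}. \<forall>t\<in>{0..1}. \<bar>s - t\<bar> < \<delta> \<longrightarrow> (\<forall>z\<in>unit_disc. cmod (k s z - k t z) \<le> \<epsilon>)"
  shows "bounded_holomorphic (\<lambda>z. integral {0..1} (\<lambda>s. k s z))" (is "bounded_holomorphic ?I")
    and "\<Lambda> (\<lambda>z. integral {0..1} (\<lambda>s. k s z)) = 0"
proof -
  define R where "R = (\<lambda>n z. \<Sum>i<n. (1 / real n) *\<^sub>R k (real i * (1 / real n)) z)"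
  have cont: "continuous_on {0..1} (\<lambda>s. k s z)" if z: "z \<in> unit_disc" for z
    unfolding continuous_on_iff
  proof (intro ballI allI impI)
    fix s \<epsilon> :: real assume s: "s \<in> {0..1}" and \<epsilon>: "\<epsilon> > 0"
    obtain \<delta> where "\<delta> > 0" "\<And>s t. s\<in>{0..1} \<Longrightarrow> t\<in>{0..1} \<Longrightarrow> \<bar>s - t\<bar> < \<delta> \<Longrightarrow> cmod (k s z - k t z) \<le> \<epsilon> / 2"
      using uc[of "\<epsilon> / 2"] \<epsilon> z by (meson half_gt_zero)
    then show "\<exists>d>0. \<forall>t\<in>{0..1}. dist t s < d \<longrightarrow> dist (k t z) (k s z) < \<epsilon>"
      using s \<epsilon> by (intro exI[of _ \<delta>]) (force simp: dist_norm)
  qed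
  have Rbh: "bounded_holomorphic (R n)" and R0: "\<Lambda> (R n) = 0" for n
  proof -
    have *: "bounded_holomorphic (k (real i * (1 / real n)))" "\<Lambda> (k (real i * (1 / real n))) = 0" if "i < n" for i
      using that by (auto intro!: bh zero)
    show "bounded_holomorphic (R n)"
      unfolding R_def scaleR_conv_of_real
      by (intro bounded_holomorphic_sum bounded_holomorphic_cmult *) auto
    have "\<Lambda> (R n) = (\<Sum>i<n. \<Lambda> (\<lambda>z. of_real (1 / real n) * k (real i * (1 / real n)) z))"
      unfolding R_def scaleR_conv_of_real
      by (intro \<Lambda>_sum bounded_holomorphic_cmult *) auto
    also have "\<dots> = 0" using * by (intro sum.neutral ballI) (simp only: \<Lambda>_cmult lessThan_iff mult_zero_right)
    finally show "\<Lambda> (R n) = 0" .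
  qed
  have err: "\<exists>N. \<forall>n\<ge>N. \<forall>z\<in>unit_disc. cmod (?I z - R n z) \<le> \<epsilon>" if \<epsilon>: "\<epsilon> > 0" for \<epsilon>
  proof -
    obtain \<delta> where \<delta>: "\<delta> > 0" "\<And>s t z. s\<in>{0..1} \<Longrightarrow> t\<in>{0..1} \<Longrightarrow> \<bar>s - t\<bar> < \<delta> \<Longrightarrow> z\<in>unit_disc \<Longrightarrow> cmod (k s z - k t z) \<le> \<epsilon>"
      using uc[OF \<epsilon>] by blast
    obtain N where N: "inverse (real (Suc N)) < \<delta>" using reals_Archimedean[OF \<delta>(1)] by blast
    have "cmod (?I z - R n z) \<le> \<epsilon>" if n: "n \<ge> Suc N" and z: "z \<in> unit_disc" for n z
    proof -
      have n1: "real n * (1 / real n) = 1" using n by simp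
      have "1 / real n < \<delta>"
      proof -
        have "1 / real n \<le> inverse (real (Suc N))" using n by (simp add: field_simps)
        then show ?thesis using N by simp
      qed
      then have "norm (integral {0..real n * (1 / real n)} (\<lambda>s. k s z) - (\<Sum>i<n. (1 / real n) *\<^sub>R k (real i * (1 / real n)) z))
          \<le> real n * (1 / real n) * \<epsilon>"
        by (intro Riemann_sum_error) (unfold n1, auto intro!: cont z \<delta>(2))
      then show ?thesis unfolding n1 R_def by simp
    qed
    then show ?thesis by blast
  qed
  have hol: "?I holomorphic_on unit_disc"
  proof (rule holomorphic_uniform_sequence[of unit_disc R])
    fix x :: complex assume "x \<in> unit_disc"
    then obtain d where d: "d > 0" "cball x d \<subseteq> unit_disc" using open_contains_cball[of unit_disc] open_ball by blast
    have "uniform_limit (cball x d) R ?I sequentially"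
    proof (rule uniform_limitI)
      fix e :: real assume "e > 0"
      then obtain N where "\<forall>n\<ge>N. \<forall>z\<in>unit_disc. cmod (?I z - R n z) \<le> e / 2" using err[of "e/2"] by auto
      then show "\<forall>\<^sub>F n in sequentially. \<forall>y\<in>cball x d. dist (R n y) (?I y) < e"
        using \<open>e > 0\<close> d unfolding eventually_sequentially dist_norm
        by (intro exI[of _ N]) (fastforce simp: norm_minus_commute subset_iff)
    qed
    then show "\<exists>d>0. cball x d \<subseteq> unit_disc \<and> uniform_limit (cball x d) R ?I sequentially" using d by blast
  qed (auto intro: bounded_holomorphic_imp_holomorphic Rbh)
  obtain N where N: "\<And>z. z\<in>unit_disc \<Longrightarrow> cmod (?I z - R N z) \<le> 1" using err[of 1] by (metis order.refl zero_less_one)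
  obtain B where B: "\<And>z. z \<in> unit_disc \<Longrightarrow> cmod (R N z) \<le> B" using bounded_holomorphicE[OF Rbh] by blast
  show bhI: "bounded_holomorphic ?I"
  proof (rule bounded_holomorphicI[OF hol])
    show "cmod (?I z) \<le> B + 1" if "z \<in> unit_disc" for z
      using N[OF that] B[OF that] norm_triangle_sub[of "?I z" "R N z"] by linarith
  qed
  show "\<Lambda> ?I = 0"
  proof (rule \<Lambda>_eq_0_approx_sup[OF bhI])
    fix \<delta> :: real assume "\<delta> > 0"
    from err[OF this] obtain N where "\<forall>z\<in>unit_disc. cmod (?I z - R N z) \<le> \<delta>" by blast
    then show "\<exists>g. bounded_holomorphic g \<and> \<Lambda> g = 0 \<and> (\<forall>z\<in>unit_disc. cmod (?I z - g z) \<le> \<delta>)"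
      by (intro exI[of _ "R N"] conjI Rbh R0)
  qed
qed

end

section \<open>Julia's lemma and horodiscs\<close>

lemma one_minus_Moebius_norm:
  assumes "cmod w < 1" "cmod z < 1"
  shows "(1 - (cmod (Moebius_function 0 w z))\<^sup>2) * (cmod (1 - cnj w * z))\<^sup>2 = (1 - (cmod w)\<^sup>2) * (1 - (cmod z)\<^sup>2)"
proof -
  have "1 - cnj w * z \<noteq> 0"
  proof
    assume "1 - cnj w * z = 0"
    then have "cmod w * cmod z = 1" by (metis complex_mod_cnj eq_iff_diff_eq_0 norm_mult norm_one)
    moreover have "cmod w * cmod z < 1 * 1" using assms by (intro mult_strict_mono') auto
    ultimately show False by simp
  qed
  then have "(1 - (cmod (Moebius_function 0 w z))\<^sup>2) * (cmod (1 - cnj w * z))\<^sup>2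
     = (cmod (1 - cnj w * z))\<^sup>2 - (cmod (z - w))\<^sup>2"
    by (simp add: Moebius_function_simple norm_divide power_divide field_simps)
  also have "\<dots> = (1 - (cmod w)\<^sup>2) * (1 - (cmod z)\<^sup>2)"
    unfolding cmod_power2 by (cases w; cases z) (simp add: algebra_simps power2_eq_square)
  finally show ?thesis .
qed

text \<open>Schwarz's lemma between Moebius maps, written without quotients so that the limit \<open>w \<longlonglongrightarrow> \<tau>\<close> at the
  boundary can be taken after division by \<open>1 - |w|\<^sup>2\<close>.\<close>
lemma Schwarz_Pick:
  assumes f: "f holomorphic_on unit_disc" "f ` unit_disc \<subseteq> unit_disc"
    and z: "z \<in> unit_disc" and w: "w \<in> unit_disc"
  shows "(cmod (1 - cnj (f w) * f z))\<^sup>2 * ((1 - (cmod z)\<^sup>2) * (1 - (cmod w)\<^sup>2))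
     \<le> (cmod (1 - cnj w * z))\<^sup>2 * ((1 - (cmod (f z))\<^sup>2) * (1 - (cmod (f w))\<^sup>2))"
proof -
  have n: "cmod w < 1" "cmod z < 1" "cmod (f w) < 1" "cmod (f z) < 1" using f(2) z w by (auto simp: image_subset_iff)
  define g where "g = Moebius_function 0 (f w) \<circ> f \<circ> Moebius_function 0 (-w)"
  have M: "Moebius_function 0 (-w) ` unit_disc \<subseteq> unit_disc"
    using Moebius_function_norm_lt_1[of "-w"] n by auto
  have gh: "g holomorphic_on unit_disc"
    unfolding g_def using n f M
    by (intro holomorphic_on_compose_gen[where t = unit_disc] Moebius_function_holomorphic) auto
  have g0: "g 0 = 0"
    by (simp add: g_def Moebius_function_of_zero Moebius_function_eq_zero)
  have gn: "cmod (g x) < 1" if "cmod x < 1" for x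
    unfolding g_def o_def using that M f(2) n by (intro Moebius_function_norm_lt_1) (auto simp: image_subset_iff)
  have zeta: "cmod (Moebius_function 0 w z) < 1" using n by (intro Moebius_function_norm_lt_1)
  have "g (Moebius_function 0 w z) = Moebius_function 0 (f w) (f z)"
    unfolding g_def o_def using n by (subst Moebius_function_compose) auto
  with Schwarz_Lemma(1)[OF gh g0 gn zeta]
  have le: "cmod (Moebius_function 0 (f w) (f z)) \<le> cmod (Moebius_function 0 w z)" by simp
  let ?A = "1 - (cmod (Moebius_function 0 w z))\<^sup>2" and ?B = "1 - (cmod (Moebius_function 0 (f w) (f z)))\<^sup>2"
  have AB: "?A \<le> ?B" using le by (simp add: power_mono)
  have "(cmod (1 - cnj (f w) * f z))\<^sup>2 * ((1 - (cmod z)\<^sup>2) * (1 - (cmod w)\<^sup>2))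
     = (cmod (1 - cnj (f w) * f z))\<^sup>2 * (cmod (1 - cnj w * z))\<^sup>2 * ?A"
    using one_minus_Moebius_norm[of w z] n by (simp add: mult_ac)
  also have "\<dots> \<le> (cmod (1 - cnj (f w) * f z))\<^sup>2 * (cmod (1 - cnj w * z))\<^sup>2 * ?B"
    by (intro mult_left_mono AB) auto
  also have "\<dots> = (cmod (1 - cnj w * z))\<^sup>2 * ((1 - (cmod (f z))\<^sup>2) * (1 - (cmod (f w))\<^sup>2))"
    using one_minus_Moebius_norm[of "f w" "f z"] n by (simp add: mult_ac)
  finally show ?thesis .
qed

text \<open>The Schwarz--Pick inequality at \<open>\<zeta> n\<close>, after the ratio bound has removed \<open>1 - |\<zeta> n|\<^sup>2\<close>, in the limit.\<close>
lemma Julia: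
  assumes f: "f holomorphic_on unit_disc" "f ` unit_disc \<subseteq> unit_disc"
    and \<tau>: "cmod \<tau> = 1"
    and \<zeta>: "\<And>n. \<zeta> n \<in> unit_disc" "\<zeta> \<longlonglongrightarrow> \<tau>" "(\<lambda>n. f (\<zeta> n)) \<longlonglongrightarrow> \<tau>"
    and ratio: "\<And>n. 1 - (cmod (f (\<zeta> n)))\<^sup>2 \<le> \<kappa> * (1 - (cmod (\<zeta> n))\<^sup>2)"
    and z: "z \<in> unit_disc"
  shows "(cmod (\<tau> - f z))\<^sup>2 * (1 - (cmod z)\<^sup>2) \<le> \<kappa> * ((cmod (\<tau> - z))\<^sup>2 * (1 - (cmod (f z))\<^sup>2))"
proof -
  have cn: "cmod (1 - cnj \<tau> * x) = cmod (\<tau> - x)" for x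
  proof -
    have "cmod (1 - cnj \<tau> * x) = cmod \<tau> * cmod (1 - cnj \<tau> * x)" using \<tau> by simp
    also have "\<dots> = cmod (\<tau> - \<tau> * cnj \<tau> * x)" by (simp add: norm_mult[symmetric] algebra_simps)
    also have "\<tau> * cnj \<tau> = 1" using \<tau> complex_norm_square[of \<tau>] by simp
    finally show ?thesis by simp
  qed
  have fz: "cmod (f z) < 1" using f(2) z by (auto simp: image_subset_iff)
  have "(cmod (1 - cnj (f (\<zeta> n)) * f z))\<^sup>2 * (1 - (cmod z)\<^sup>2)
     \<le> \<kappa> * ((cmod (1 - cnj (\<zeta> n) * z))\<^sup>2 * (1 - (cmod (f z))\<^sup>2))" (is "?L n \<le> ?R n") for n
  proof -
    have p: "1 - (cmod (\<zeta> n))\<^sup>2 > 0" using \<zeta>(1)[of n] by (simp add: abs_square_less_1)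
    have q: "1 - (cmod (f z))\<^sup>2 > 0" using fz by (simp add: abs_square_less_1)
    have "?L n * (1 - (cmod (\<zeta> n))\<^sup>2) \<le> (cmod (1 - cnj (\<zeta> n) * z))\<^sup>2 * ((1 - (cmod (f z))\<^sup>2) * (1 - (cmod (f (\<zeta> n)))\<^sup>2))"
      using Schwarz_Pick[OF f z \<zeta>(1)[of n]] by (simp add: mult_ac)
    also have "\<dots> \<le> (cmod (1 - cnj (\<zeta> n) * z))\<^sup>2 * ((1 - (cmod (f z))\<^sup>2) * (\<kappa> * (1 - (cmod (\<zeta> n))\<^sup>2)))"
      using q by (intro mult_left_mono ratio) auto
    also have "\<dots> = ?R n * (1 - (cmod (\<zeta> n))\<^sup>2)" by (simp add: mult_ac)
    finally show ?thesis using p by (simp add: mult_le_cancel_right)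
  qed
  moreover have "?L \<longlonglongrightarrow> (cmod (1 - cnj \<tau> * f z))\<^sup>2 * (1 - (cmod z)\<^sup>2)"
    by (intro tendsto_intros \<zeta>)
  moreover have "?R \<longlonglongrightarrow> \<kappa> * ((cmod (1 - cnj \<tau> * z))\<^sup>2 * (1 - (cmod (f z))\<^sup>2))"
    by (intro tendsto_intros \<zeta>)
  ultimately show ?thesis unfolding cn by (intro LIMSEQ_le) auto
qed

lemma frequently_decreasing:
  fixes a :: "nat \<Rightarrow> real"
  assumes pos: "\<And>n. a n > 0" and lim: "a \<longlonglongrightarrow> 0"
  shows "\<exists>n\<ge>N. a (Suc n) \<le> a n"
proof (rule ccontr)
  assume "\<not> ?thesis"
  then have inc: "a n < a (Suc n)" if "n \<ge> N" for n using that by force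
  have ge: "a N \<le> a (N + k)" for k
    by (induction k) (use inc[of "N + _"] in \<open>auto intro: order_trans less_imp_le\<close>)
  have "\<forall>\<^sub>F n in sequentially. a n < a N" using lim pos by (simp add: order_tendsto_iff)
  then obtain M where "\<And>n. n \<ge> M \<Longrightarrow> a n < a N" by (auto simp: eventually_sequentially)
  from this[of "N + M"] ge[of M] show False by simp
qed

text \<open>Along the orbit of 0, which tends to \<open>\<tau>\<close>, the quantity \<open>1 - |z|\<^sup>2\<close> decreases infinitely often, so
  Julia's lemma applies with constant 1 (Wolff's lemma); in particular \<open>\<phi>\<^sub>1(r\<tau>) \<longlonglongrightarrow> \<tau>\<close> as \<open>r \<longlonglongrightarrow> 1\<close>. Since
  \<open>\<phi>\<^sub>1'\<close> tends to \<open>exp \<alpha> < 1\<close> along the radius, \<open>1 - |\<phi>\<^sub>1(r\<tau>)|\<close> is at most \<open>\<kappa> (1 - r)\<close> for some \<open>\<kappa> < 1\<close> and \<open>r\<close>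
  near 1, and Julia's lemma along the radius gives a constant below 1.\<close>
lemma hyperbolic_semiflow_contracts_horodiscs:
  assumes hyp: "hyperbolic_semiflow \<phi>"
  obtains \<tau> K where "cmod \<tau> = 1" "K > 1"
    "\<And>z. z \<in> unit_disc \<Longrightarrow> K * ((cmod (\<tau> - \<phi> 1 z))\<^sup>2 * (1 - (cmod z)\<^sup>2)) \<le> (cmod (\<tau> - z))\<^sup>2 * (1 - (cmod (\<phi> 1 z))\<^sup>2)"
proof -
  from hyp obtain \<tau> \<alpha> where sf: "holomorphic_semiflow \<phi>" and dw: "denjoy_wolff_point \<phi> \<tau>" and \<alpha>: "\<alpha> < 0"
    and nt: "nontangential_limit (deriv (\<phi> 1)) \<tau> (of_real (exp \<alpha>))"
    unfolding hyperbolic_semiflow_def by (metis mult_1 zero_le_one)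
  define f where "f = \<phi> 1"
  have f: "f holomorphic_on unit_disc" "f ` unit_disc \<subseteq> unit_disc"
    using sf unfolding holomorphic_semiflow_def f_def by auto
  have \<tau>: "cmod \<tau> = 1" using dw by (simp add: denjoy_wolff_point_def)
  define c where "c = exp \<alpha>"
  have c: "0 < c" "c < 1" using \<alpha> by (auto simp: c_def)
  \<comment> \<open>Julia's lemma along the orbit of the origin\<close>
  define o' where "o' = (\<lambda>n::nat. \<phi> (real n) 0)"
  have o_disc: "o' n \<in> unit_disc" for n
    using sf unfolding holomorphic_semiflow_def o'_def by (metis centre_in_ball image_subset_iff of_nat_0_le_iff zero_less_one)
  have o_Suc: "o' (Suc n) = f (o' n)" for n
    using sf unfolding holomorphic_semiflow_def o'_def f_def
    by (metis (no_types) add.commute centre_in_ball of_nat_0_le_iff of_nat_Suc zero_le_one zero_less_one)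
  have "uniform_limit {0} \<phi> (\<lambda>z. \<tau>) at_top"
    using dw unfolding denjoy_wolff_point_def by (metis centre_in_ball compact_sing empty_subsetI insert_subset zero_less_one)
  then have "((\<lambda>t. \<phi> t 0) \<longlongrightarrow> \<tau>) at_top" by (rule tendsto_uniform_limitI) simp
  then have o_lim: "o' \<longlonglongrightarrow> \<tau>"
    unfolding o'_def by (rule filterlim_compose) (rule filterlim_real_sequentially)
  define a where "a = (\<lambda>n. 1 - (cmod (o' n))\<^sup>2)"
  have a_pos: "a n > 0" for n using o_disc[of n] by (simp add: a_def abs_square_less_1)
  have "a \<longlonglongrightarrow> 1 - (cmod \<tau>)\<^sup>2" unfolding a_def by (intro tendsto_intros o_lim)
  then have a_lim: "a \<longlonglongrightarrow> 0" using \<tau> by simp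
  obtain s where s: "\<And>N. s N \<ge> N" "\<And>N. a (Suc (s N)) \<le> a (s N)"
    using frequently_decreasing[OF a_pos a_lim] by metis
  have s_top: "filterlim s at_top sequentially"
    by (rule filterlim_at_top_mono[OF filterlim_ident]) (use s in auto)
  have wolff: "(cmod (\<tau> - f z))\<^sup>2 * (1 - (cmod z)\<^sup>2) \<le> 1 * ((cmod (\<tau> - z))\<^sup>2 * (1 - (cmod (f z))\<^sup>2))"
    if "z \<in> unit_disc" for z
  proof (rule Julia[OF f \<tau> _ _ _ _ that])
    show "(\<lambda>N. o' (s N)) \<longlonglongrightarrow> \<tau>" by (rule filterlim_compose[OF o_lim s_top])
    show "(\<lambda>N. f (o' (s N))) \<longlonglongrightarrow> \<tau>"
      using filterlim_compose[OF LIMSEQ_Suc[OF o_lim] s_top] by (simp add: o_Suc)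
    show "1 - (cmod (f (o' (s N))))\<^sup>2 \<le> 1 * (1 - (cmod (o' (s N)))\<^sup>2)" for N
      using s(2)[of N] by (simp add: a_def o_Suc)
  qed (rule o_disc)
  \<comment> \<open>The radial limit at \<open>\<tau>\<close>, with a rate that is refined in \<open>lip\<close>\<close>
  have rad_bound: "(cmod (\<tau> - f (of_real r * \<tau>)))\<^sup>2 \<le> 1 - r" if r: "0 < r" "r < 1" for r
  proof -
    have rd: "of_real r * \<tau> \<in> unit_disc" using r \<tau> by (simp add: norm_mult)
    have "\<tau> - of_real r * \<tau> = of_real (1 - r) * \<tau>" by (simp add: algebra_simps)
    then have e: "cmod (\<tau> - of_real r * \<tau>) = 1 - r" using r \<tau> by (simp only: norm_mult norm_of_real) simp
    have "(cmod (\<tau> - f (of_real r * \<tau>)))\<^sup>2 * (1 - r\<^sup>2) \<le> (1 - r)\<^sup>2 * (1 - (cmod (f (of_real r * \<tau>)))\<^sup>2)"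
      using wolff[OF rd] e \<tau> r by (simp add: norm_mult)
    also have "\<dots> \<le> (1 - r)\<^sup>2" by (simp add: mult_left_le)
    also have "\<dots> \<le> (1 - r) * (1 - r\<^sup>2)"
    proof -
      have "1 - r \<le> 1 - r\<^sup>2" using r by (simp add: power2_eq_square mult_left_le)
      then show ?thesis using r by (simp add: power2_eq_square mult_left_mono)
    qed
    finally have le: "(cmod (\<tau> - f (of_real r * \<tau>)))\<^sup>2 * (1 - r\<^sup>2) \<le> (1 - r) * (1 - r\<^sup>2)" .
    have "0 < 1 - r\<^sup>2" using r by (simp add: abs_square_less_1)
    with le show ?thesis by (simp only: mult_le_cancel_right_pos)
  qed
  \<comment> \<open>Two constants with \<open>c < \<kappa> < \<kappa>' < 1\<close>: \<open>\<kappa>\<close> absorbs the error in the derivative, \<open>\<kappa>'\<close> the factor \<open>2 / (1 + r)\<close>\<close>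
  define \<kappa> where "\<kappa> = (1 + 2 * c) / 3"
  define \<kappa>' where "\<kappa>' = (2 + c) / 3"
  have \<kappa>: "c < \<kappa>" "\<kappa> < \<kappa>'" "\<kappa>' < 1" "0 < \<kappa>" using c by (auto simp: \<kappa>_def \<kappa>'_def)
  have "((deriv f) \<longlongrightarrow> of_real c) (at \<tau> within stolz_region \<tau> 2)"
    using nt unfolding nontangential_limit_def f_def c_def by auto
  then have "\<forall>\<^sub>F z in at \<tau> within stolz_region \<tau> 2. dist (deriv f z) (of_real c) < \<kappa> - c"
    using \<kappa> by (simp add: tendsto_iff)
  then obtain d where d: "d > 0" "\<And>z. z \<in> stolz_region \<tau> 2 \<Longrightarrow> z \<noteq> \<tau> \<Longrightarrow> dist z \<tau> < d \<Longrightarrow> dist (deriv f z) (of_real c) < \<kappa> - c"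
    unfolding eventually_at by blast
  have der_bound: "cmod (deriv f (of_real r * \<tau>)) \<le> \<kappa>" if r: "0 < r" "r < 1" "1 - r < d" for r
  proof -
    have "of_real r * \<tau> - \<tau> = of_real (r - 1) * \<tau>" by (simp add: algebra_simps)
    then have e: "cmod (of_real r * \<tau> - \<tau>) = 1 - r" using r \<tau> by (simp only: norm_mult norm_of_real) simp
    have "of_real r * \<tau> \<in> stolz_region \<tau> 2" using e r \<tau> by (simp add: stolz_region_def norm_mult)
    moreover have "of_real r * \<tau> \<noteq> \<tau>" using e r by auto
    ultimately have "dist (deriv f (of_real r * \<tau>)) (of_real c) < \<kappa> - c"
      using d(2) e r by (simp add: dist_norm)
    moreover have "cmod (deriv f (of_real r * \<tau>)) \<le> cmod (of_real c) + dist (deriv f (of_real r * \<tau>)) (of_real c)"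
      by (simp add: dist_norm) (metis norm_triangle_sub norm_of_real add.commute)
    ultimately show ?thesis using c by simp
  qed
  have lip: "cmod (\<tau> - f (of_real r * \<tau>)) \<le> \<kappa> * (1 - r)" if r: "0 < r" "r < 1" "1 - r < d" for r
  proof -
    have step: "cmod (f (of_real s * \<tau>) - f (of_real r * \<tau>)) \<le> \<kappa> * (1 - r)" if s: "r < s" "s < 1" for s
    proof -
      let ?S = "(\<lambda>t. of_real t * \<tau>) ` {r..s}"
      have conv: "convex ?S"
        by (intro convex_linear_image) (auto intro!: linearI simp: algebra_simps scaleR_conv_of_real)
      have "cmod (f (of_real s * \<tau>) - f (of_real r * \<tau>)) \<le> \<kappa> * cmod (of_real s * \<tau> - of_real r * \<tau>)"
      proof (rule field_differentiable_bound[OF conv, of f "deriv f"])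
        fix x assume "x \<in> ?S"
        then obtain t where t: "x = of_real t * \<tau>" "t \<in> {r..s}" by blast
        have "x \<in> unit_disc" using t s r \<tau> by (simp add: norm_mult)
        then show "(f has_field_derivative deriv f x) (at x within ?S)"
          using f(1) by (intro DERIV_subset[OF holomorphic_derivI[of f unit_disc]]) auto
        show "cmod (deriv f x) \<le> \<kappa>" using der_bound[of t] t s r by auto
      qed (use s in auto)
      also have "of_real s * \<tau> - of_real r * \<tau> = of_real (s - r) * \<tau>" by (simp add: algebra_simps)
      also have "cmod \<dots> = s - r" using s \<tau> by (simp only: norm_mult norm_of_real) simp
      also have "\<kappa> * (s - r) \<le> \<kappa> * (1 - r)" using s \<kappa> by simp
      finally show ?thesis .
    qed
    have "((\<lambda>s. cmod (f (of_real s * \<tau>) - f (of_real r * \<tau>))) \<longlongrightarrow> cmod (\<tau> - f (of_real r * \<tau>))) (at_left 1)"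
    proof (intro tendsto_intros)
      have "((\<lambda>s. sqrt (1 - s)) \<longlongrightarrow> sqrt (1 - 1)) (at_left 1)" by (intro tendsto_intros)
      moreover have "\<forall>\<^sub>F s in at_left 1. cmod (f (of_real s * \<tau>) - \<tau>) \<le> sqrt (1 - s)"
      proof (rule eventually_at_leftI[of 0])
        fix s :: real assume s: "s \<in> {0<..<1}"
        show "cmod (f (of_real s * \<tau>) - \<tau>) \<le> sqrt (1 - s)"
          using rad_bound[of s] s by (intro real_le_rsqrt) (auto simp: norm_minus_commute)
      qed simp
      ultimately have "((\<lambda>s. f (of_real s * \<tau>) - \<tau>) \<longlongrightarrow> 0) (at_left 1)"
        using Lim_null_comparison[of "\<lambda>s. f (of_real s * \<tau>) - \<tau>" "\<lambda>s. sqrt (1 - s)"] by simp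
      then show "((\<lambda>s. f (of_real s * \<tau>)) \<longlongrightarrow> \<tau>) (at_left 1)" by (simp add: LIM_zero_iff)
    qed
    then show ?thesis
    proof (rule tendsto_upperbound)
      show "\<forall>\<^sub>F s in at_left 1. cmod (f (of_real s * \<tau>) - f (of_real r * \<tau>)) \<le> \<kappa> * (1 - r)"
        by (rule eventually_at_leftI[of r]) (use step r in auto)
    qed simp
  qed
  \<comment> \<open>Beyond \<open>r0\<close> the bound on the derivative holds and \<open>2 \<kappa> \<le> \<kappa>' (1 + r)\<close>\<close>
  define r0 where "r0 = max (1 - d) (max 0 (2 * \<kappa> / \<kappa>' - 1))"
  have r0: "r0 < 1" using d \<kappa> by (auto simp: r0_def field_simps)
  define \<rho> where "\<rho> = (\<lambda>n::nat. 1 - (1 - r0) / (real n + 2))"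
  have \<rho>: "r0 < \<rho> n" "\<rho> n < 1" for n
  proof -
    have "(1 - r0) / (real n + 2) > 0" using r0 by simp
    moreover have "(1 - r0) / (real n + 2) < (1 - r0) / 1" using r0 by (intro divide_strict_left_mono) auto
    ultimately show "r0 < \<rho> n" "\<rho> n < 1" by (simp_all add: \<rho>_def)
  qed
  have \<rho>lim: "\<rho> \<longlonglongrightarrow> 1"
  proof -
    have "(\<lambda>n. 1 - (1 - r0) * (1 / real (n + 2))) \<longlonglongrightarrow> 1 - (1 - r0) * 0"
      by (intro tendsto_intros LIMSEQ_ignore_initial_segment[OF lim_1_over_n])
    then show ?thesis by (simp add: \<rho>_def add.commute)
  qed
  have key: "(cmod (\<tau> - f z))\<^sup>2 * (1 - (cmod z)\<^sup>2) \<le> \<kappa>' * ((cmod (\<tau> - z))\<^sup>2 * (1 - (cmod (f z))\<^sup>2))"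
    if "z \<in> unit_disc" for z
  proof (rule Julia[OF f \<tau> _ _ _ _ that])
    have r: "0 < \<rho> n" "\<rho> n < 1" "1 - \<rho> n < d" "2 * \<kappa> \<le> \<kappa>' * (1 + \<rho> n)" for n
    proof -
      have "2 * \<kappa> / \<kappa>' - 1 < \<rho> n" using \<rho>[of n] by (simp add: r0_def)
      then show "2 * \<kappa> \<le> \<kappa>' * (1 + \<rho> n)" using \<kappa> by (simp add: field_simps)
    qed (use \<rho>[of n] in \<open>auto simp: r0_def\<close>)
    show mem: "of_real (\<rho> n) * \<tau> \<in> unit_disc" for n using r[of n] \<tau> by (simp add: norm_mult)
    have "(\<lambda>n. of_real (\<rho> n) * \<tau>) \<longlonglongrightarrow> of_real 1 * \<tau>" by (intro tendsto_intros \<rho>lim)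
    then show "(\<lambda>n. of_real (\<rho> n) * \<tau>) \<longlonglongrightarrow> \<tau>" by simp
    have "(\<lambda>n. \<kappa> * (1 - \<rho> n)) \<longlonglongrightarrow> \<kappa> * (1 - 1)" by (intro tendsto_intros \<rho>lim)
    then have "(\<lambda>n. f (of_real (\<rho> n) * \<tau>) - \<tau>) \<longlonglongrightarrow> 0"
      using Lim_null_comparison[of "\<lambda>n. f (of_real (\<rho> n) * \<tau>) - \<tau>" "\<lambda>n. \<kappa> * (1 - \<rho> n)"] lip r
      by (simp add: norm_minus_commute)
    then show "(\<lambda>n. f (of_real (\<rho> n) * \<tau>)) \<longlonglongrightarrow> \<tau>" by (simp add: LIM_zero_iff)
    fix n
    let ?F = "cmod (f (of_real (\<rho> n) * \<tau>))"
    have F1: "?F < 1" using f(2) mem[of n] by (metis image_subset_iff mem_ball_0)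
    have "1 - ?F \<le> cmod (\<tau> - f (of_real (\<rho> n) * \<tau>))" using \<tau> norm_triangle_ineq2[of \<tau>] by metis
    also have "\<dots> \<le> \<kappa> * (1 - \<rho> n)" using lip r by blast
    finally have 1: "1 - ?F \<le> \<kappa> * (1 - \<rho> n)" .
    have "1 - ?F\<^sup>2 = (1 - ?F) * (1 + ?F)" by (simp add: power2_eq_square algebra_simps)
    also have "\<dots> \<le> (\<kappa> * (1 - \<rho> n)) * 2"
      using 1 F1 r(2)[of n] \<kappa> by (intro mult_mono) auto
    also have "\<dots> = (2 * \<kappa>) * (1 - \<rho> n)" by simp
    also have "\<dots> \<le> (\<kappa>' * (1 + \<rho> n)) * (1 - \<rho> n)"
      using r(2,4)[of n] by (intro mult_right_mono) auto
    also have "\<dots> = \<kappa>' * (1 - (\<rho> n)\<^sup>2)" by (simp add: power2_eq_square algebra_simps)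
    finally show "1 - ?F\<^sup>2 \<le> \<kappa>' * (1 - (cmod (of_real (\<rho> n) * \<tau>))\<^sup>2)"
      using \<tau> by (simp add: norm_mult)
  qed
  show ?thesis
  proof (rule that[OF \<tau>, of "1 / \<kappa>'"])
    show "1 / \<kappa>' > 1" using \<kappa> by simp
    fix z assume "z \<in> unit_disc"
    from key[OF this] show "1 / \<kappa>' * ((cmod (\<tau> - \<phi> 1 z))\<^sup>2 * (1 - (cmod z)\<^sup>2)) \<le> (cmod (\<tau> - z))\<^sup>2 * (1 - (cmod (\<phi> 1 z))\<^sup>2)"
      using \<kappa> by (simp add: f_def[symmetric] field_simps)
  qed
qed

section \<open>The Koenigs domain of a hyperbolic semiflow lies in a strip\<close>

text \<open>Schwarz's lemma for the Cayley transform of \<open>Q\<close>. As a bound for \<open>Q\<close> itself, not only for \<open>Re Q\<close>, it also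
  provides the local bounds needed for Montel's theorem.\<close>
lemma right_half_plane_Harnack:
  assumes Q: "Q holomorphic_on ball a R" and pos: "\<And>w. w \<in> ball a R \<Longrightarrow> Re (Q w) > 0"
    and w: "w \<in> ball a R"
  shows "cmod (Q w - Q a) * (R - dist a w) \<le> 2 * dist a w * Re (Q a)"
proof -
  have R: "R > 0" using w zero_le_dist[of a w] unfolding mem_ball by linarith
  have inb: "a + of_real R * \<zeta> \<in> ball a R" if "\<zeta> \<in> unit_disc" for \<zeta>
    using that R by (simp add: dist_norm norm_mult)
  define S where "S = (\<lambda>\<zeta>. (Q (a + of_real R * \<zeta>) - Q a) / (Q (a + of_real R * \<zeta>) + cnj (Q a)))"
  have posa: "Re (Q a) > 0" using pos R by simp
  have nz: "Q v + cnj (Q a) \<noteq> 0" if "v \<in> ball a R" for v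
  proof
    assume "Q v + cnj (Q a) = 0"
    then have "Re (Q v + cnj (Q a)) = 0" by simp
    then show False using pos[OF that] posa by simp
  qed
  have lt: "cmod (Q v - Q a) < cmod (Q v + cnj (Q a))" if "v \<in> ball a R" for v
  proof -
    have "(cmod (Q v + cnj (Q a)))\<^sup>2 - (cmod (Q v - Q a))\<^sup>2 = 4 * Re (Q v) * Re (Q a)"
      unfolding cmod_power2 by (simp add: algebra_simps power2_eq_square)
    moreover have "\<dots> > 0" using pos[OF that] posa by simp
    ultimately have "(cmod (Q v - Q a))\<^sup>2 < (cmod (Q v + cnj (Q a)))\<^sup>2" by linarith
    then show ?thesis by (rule power_less_imp_less_base) simp
  qed
  have S: "S holomorphic_on unit_disc"
    unfolding S_def
  proof (intro holomorphic_on_divide holomorphic_on_add holomorphic_on_diff holomorphic_on_const)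
    show "(\<lambda>\<zeta>. Q (a + of_real R * \<zeta>)) holomorphic_on unit_disc"
    proof (rule holomorphic_on_compose_gen[of _ _ Q "ball a R", unfolded o_def])
      show "(\<lambda>\<zeta>. a + of_real R * \<zeta>) holomorphic_on unit_disc" by (intro holomorphic_intros)
    qed (use inb Q in blast)+
    then show "(\<lambda>\<zeta>. Q (a + of_real R * \<zeta>)) holomorphic_on unit_disc" .
  qed (use nz inb in blast)
  have S0: "S 0 = 0" by (simp add: S_def)
  have Sn: "cmod (S \<zeta>) < 1" if "cmod \<zeta> < 1" for \<zeta>
  proof -
    have v: "a + of_real R * \<zeta> \<in> ball a R" using inb that by simp
    show ?thesis using lt[OF v] nz[OF v] unfolding S_def norm_divide by (simp add: divide_less_eq)
  qed
  define \<zeta> where "\<zeta> = (w - a) / of_real R"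
  have \<zeta>: "cmod \<zeta> = dist a w / R" using R by (simp add: \<zeta>_def norm_divide dist_norm norm_minus_commute)
  have \<zeta>1: "cmod \<zeta> < 1" using \<zeta> R w by simp
  have "a + of_real R * \<zeta> = w" using R by (simp add: \<zeta>_def)
  then have "cmod (Q w - Q a) / cmod (Q w + cnj (Q a)) \<le> dist a w / R"
    using Schwarz_Lemma(1)[OF S S0 Sn \<zeta>1] \<zeta> by (simp add: S_def norm_divide)
  moreover have "0 < cmod (Q w + cnj (Q a))" using nz[OF w] by simp
  ultimately have "R * cmod (Q w - Q a) \<le> dist a w * cmod (Q w + cnj (Q a))"
    using R by (simp only: divide_le_eq) (simp add: field_simps)
  also have "\<dots> \<le> dist a w * (cmod (Q w - Q a) + 2 * Re (Q a))"
  proof (intro mult_left_mono)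
    have eq: "Q w + cnj (Q a) = (Q w - Q a) + of_real (2 * Re (Q a))" by (rule complex_eqI) simp_all
    have "cmod (Q w + cnj (Q a)) \<le> cmod (Q w - Q a) + cmod (of_real (2 * Re (Q a)))"
      unfolding eq by (rule norm_triangle_ineq)
    then show "cmod (Q w + cnj (Q a)) \<le> cmod (Q w - Q a) + 2 * Re (Q a)" using posa by (simp only: norm_of_real)
  qed simp
  finally show ?thesis by (simp add: algebra_simps)
qed

text \<open>With \<open>k\<close> the inverse of \<open>h\<close>, the function \<open>Q = (\<tau> + k) / (\<tau> - k)\<close> has positive real part on \<open>\<Omega>\<close>, and
  \<open>Re (Q (w + 1)) \<ge> K Re (Q w)\<close>. On a large disc this contradicts Harnack's inequality, which bounds the
  radius of discs in \<open>\<Omega>\<close>. Two points of \<open>\<Omega>\<close> whose heights differ by \<open>2 \<rho>\<close> produce a disc of radius \<open>\<rho>\<close>: a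
  path between them, translated to the right, sweeps out a half strip.\<close>
lemma Koenigs_domain_in_strip:
  assumes hyp: "hyperbolic_semiflow \<phi>" and koe: "koenigs_function \<phi> h"
  obtains b where "b > 0" "\<And>z. z \<in> unit_disc \<Longrightarrow> \<bar>Im (h z)\<bar> < b"
proof -
  obtain \<tau> K where \<tau>: "cmod \<tau> = 1" and K: "K > 1"
    and exp: "\<And>z. z \<in> unit_disc \<Longrightarrow> K * ((cmod (\<tau> - \<phi> 1 z))\<^sup>2 * (1 - (cmod z)\<^sup>2)) \<le> (cmod (\<tau> - z))\<^sup>2 * (1 - (cmod (\<phi> 1 z))\<^sup>2)"
    using hyperbolic_semiflow_contracts_horodiscs[OF hyp] by blast
  have h: "h holomorphic_on unit_disc" "inj_on h unit_disc"
    and inv: "\<And>t z. t \<ge> 0 \<Longrightarrow> z \<in> unit_disc \<Longrightarrow> h z + of_real t \<in> h ` unit_disc"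
    and \<phi>: "\<And>t z. t \<ge> 0 \<Longrightarrow> z \<in> unit_disc \<Longrightarrow> \<phi> t z = inv_into unit_disc h (h z + of_real t)"
    using koe unfolding koenigs_function_def by auto
  define \<Omega> where "\<Omega> = h ` unit_disc"
  have op: "open \<Omega>" unfolding \<Omega>_def by (rule open_mapping_thm3[OF h(1) _ h(2)]) simp
  have conn: "connected \<Omega>" unfolding \<Omega>_def
    by (intro connected_continuous_image holomorphic_on_imp_continuous_on h) auto
  have shift: "w + of_real t \<in> \<Omega>" if "w \<in> \<Omega>" "t \<ge> 0" for w t
    using inv that by (auto simp: \<Omega>_def)
  obtain k where k: "k holomorphic_on \<Omega>" "\<And>z. z \<in> unit_disc \<Longrightarrow> k (h z) = z"
    using holomorphic_has_inverse[OF h(1) _ h(2)] unfolding \<Omega>_def by (metis open_ball)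
  have kd: "k w \<in> unit_disc" "h (k w) = w" if "w \<in> \<Omega>" for w using that k by (auto simp: \<Omega>_def)
  have k1: "k (w + 1) = \<phi> 1 (k w)" if w: "w \<in> \<Omega>" for w
  proof -
    have "\<phi> 1 (k w) = inv_into unit_disc h (w + 1)" using \<phi>[of 1 "k w"] kd[OF w] by simp
    moreover have "w + 1 \<in> \<Omega>" using shift[OF w, of 1] by simp
    ultimately show ?thesis using h(2) kd[of "w + 1"] by (metis inv_into_f_f)
  qed
  define Q where "Q = (\<lambda>w. (\<tau> + k w) / (\<tau> - k w))"
  have nz: "\<tau> - k w \<noteq> 0" if "w \<in> \<Omega>" for w using kd[OF that] \<tau> by auto
  have Q: "Q holomorphic_on \<Omega>" unfolding Q_def by (intro holomorphic_intros k nz)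
  have ReQ: "Re (Q w) = (1 - (cmod (k w))\<^sup>2) / (cmod (\<tau> - k w))\<^sup>2" for w
  proof -
    have "Re (Q w) = ((cmod \<tau>)\<^sup>2 - (cmod (k w))\<^sup>2) / (cmod (\<tau> - k w))\<^sup>2"
      unfolding Q_def Re_divide cmod_power2
      by (simp add: diff_divide_distrib[symmetric] add_divide_distrib[symmetric]) (simp add: algebra_simps power2_eq_square)
    then show ?thesis using \<tau> by simp
  qed
  have posQ: "Re (Q w) > 0" if "w \<in> \<Omega>" for w
    unfolding ReQ using kd[OF that] nz[OF that] by (simp add: abs_square_less_1)
  have grow: "K * Re (Q w) \<le> Re (Q (w + 1))" if w: "w \<in> \<Omega>" for w
  proof -
    have w1: "w + 1 \<in> \<Omega>" using shift[OF w, of 1] by simp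
    show ?thesis using exp[OF kd(1)[OF w]] nz[OF w] nz[OF w1]
      unfolding ReQ k1[OF w] by (simp add: field_simps)
  qed
  have radius: "R \<le> 1 + 2 / (K - 1)" if "ball w R \<subseteq> \<Omega>" for w R
  proof (cases "R \<le> 1")
    case True moreover have "0 \<le> 2 / (K - 1)" using K by simp
    ultimately show ?thesis by linarith
  next
    case False
    then have w: "w \<in> \<Omega>" using that by (meson centre_in_ball less_le_trans not_le subsetD zero_less_one less_trans)
    have "cmod (Q (w + 1) - Q w) * (R - dist w (w + 1)) \<le> 2 * dist w (w + 1) * Re (Q w)"
      by (rule right_half_plane_Harnack)
         (use that Q posQ False in \<open>auto intro: holomorphic_on_subset simp: dist_norm\<close>)
    then have "cmod (Q (w + 1) - Q w) * (R - 1) \<le> 2 * Re (Q w)" by (simp add: dist_norm)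
    moreover have "(K - 1) * Re (Q w) \<le> cmod (Q (w + 1) - Q w)"
      using grow[OF w] complex_Re_le_cmod[of "Q (w + 1) - Q w"] by (simp add: algebra_simps)
    ultimately have "(K - 1) * Re (Q w) * (R - 1) \<le> 2 * Re (Q w)"
      using False mult_right_mono[of "(K - 1) * Re (Q w)" "cmod (Q (w + 1) - Q w)" "R - 1"] by linarith
    then have "((K - 1) * (R - 1)) * Re (Q w) \<le> 2 * Re (Q w)" by (simp add: mult_ac)
    then have "(K - 1) * (R - 1) \<le> 2" using posQ[OF w] by (simp only: mult_le_cancel_right_pos)
    then show ?thesis using K by (simp add: field_simps)
  qed
  define D where "D = 2 * (1 + 2 / (K - 1))"
  have diff: "Im q - Im p \<le> D" if p: "p \<in> \<Omega>" and q: "q \<in> \<Omega>" for p q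
  proof (cases "Im p < Im q")
    case True
    have "path_connected \<Omega>" using conn op connected_open_path_connected by blast
    then obtain g where g: "path g" "path_image g \<subseteq> \<Omega>" "pathstart g = p" "pathfinish g = q"
      using p q unfolding path_connected_def by blast
    have "bounded (path_image g)" using compact_path_image[OF g(1)] by (rule compact_imp_bounded)
    then obtain T where T: "\<And>w. w \<in> path_image g \<Longrightarrow> cmod w \<le> T" unfolding bounded_iff by blast
    have mem: "Complex x y \<in> \<Omega>" if xy: "x \<ge> T" "Im p \<le> y" "y \<le> Im q" for x y
    proof -
      have "connected (Im ` path_image g)"
        by (intro connected_continuous_image connected_path_image g continuous_intros)
      moreover have "Im p \<in> Im ` path_image g" "Im q \<in> Im ` path_image g"
        using g(3,4) pathstart_in_path_image[of g] pathfinish_in_path_image[of g] by auto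
      ultimately have "y \<in> Im ` path_image g" using xy unfolding connected_iff_interval by blast
      then obtain w where w: "w \<in> path_image g" "Im w = y" by auto
      have "Re w \<le> T" using T[OF w(1)] complex_Re_le_cmod[of w] by linarith
      then have "w + of_real (x - Re w) \<in> \<Omega>" using w g xy by (intro shift) auto
      moreover have "w + of_real (x - Re w) = Complex x y" using w by (simp add: complex_eq_iff)
      ultimately show ?thesis by simp
    qed
    define \<rho> where "\<rho> = (Im q - Im p) / 2"
    have "ball (Complex (T + \<rho>) (Im p + \<rho>)) \<rho> \<subseteq> \<Omega>"
    proof
      fix w assume "w \<in> ball (Complex (T + \<rho>) (Im p + \<rho>)) \<rho>"
      then have "cmod (w - Complex (T + \<rho>) (Im p + \<rho>)) < \<rho>" by (simp add: dist_norm norm_minus_commute)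
      then have "\<bar>Re w - (T + \<rho>)\<bar> < \<rho>" "\<bar>Im w - (Im p + \<rho>)\<bar> < \<rho>"
        using abs_Re_le_cmod[of "w - Complex (T + \<rho>) (Im p + \<rho>)"] abs_Im_le_cmod[of "w - Complex (T + \<rho>) (Im p + \<rho>)"] by auto
      moreover have "2 * \<rho> = Im q - Im p" by (simp add: \<rho>_def)
      ultimately have "Complex (Re w) (Im w) \<in> \<Omega>" by (intro mem) auto
      then show "w \<in> \<Omega>" by simp
    qed
    from radius[OF this] show ?thesis by (simp add: D_def \<rho>_def)
  next
    case False moreover have "0 \<le> 2 / (K - 1)" using K by simp
    then have "0 \<le> D" unfolding D_def by simp
    ultimately show ?thesis by linarith
  qed
  have D0: "D \<ge> 0" using diff[of "h 0" "h 0"] by (simp add: \<Omega>_def)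
  show ?thesis
  proof (rule that[of "\<bar>Im (h 0)\<bar> + D + 1"])
    fix z assume "z \<in> unit_disc"
    then have "h z \<in> \<Omega>" "h 0 \<in> \<Omega>" by (auto simp: \<Omega>_def)
    from diff[OF this] diff[OF this(2,1)] show "\<bar>Im (h z)\<bar> < \<bar>Im (h 0)\<bar> + D + 1" by linarith
  qed (use D0 in auto)
qed

section \<open>Domains in a strip that are invariant under translations\<close>

definition thickening :: "real \<Rightarrow> complex set \<Rightarrow> complex set" where
  "thickening \<epsilon> S = (\<Union>w\<in>S. ball w \<epsilon>)"

lemma open_thickening: "open (thickening \<epsilon> S)"
  by (auto simp: thickening_def)

lemma subset_thickening: "\<epsilon> > 0 \<Longrightarrow> S \<subseteq> thickening \<epsilon> S"
  by (auto simp: thickening_def intro: bexI[of _ "_"])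

text \<open>The properties of a Koenigs function that the density argument uses.\<close>
locale strip_domain =
  fixes h :: "complex \<Rightarrow> complex" and \<Omega> :: "complex set" and b :: real
  assumes hol_h: "h holomorphic_on unit_disc" and inj_h: "inj_on h unit_disc"
    and Omega: "\<Omega> = h ` unit_disc"
    and shift: "w \<in> \<Omega> \<Longrightarrow> t \<ge> 0 \<Longrightarrow> w + of_real t \<in> \<Omega>"
    and strip: "w \<in> \<Omega> \<Longrightarrow> \<bar>Im w\<bar> < b"
begin

lemma h_in: "z \<in> unit_disc \<Longrightarrow> h z \<in> \<Omega>"
  by (simp add: Omega)

lemma b_pos: "b > 0"
  using strip[OF h_in[of 0]] by simp

lemma open_Omega: "open \<Omega>"
  unfolding Omega by (rule open_mapping_thm3[OF hol_h _ inj_h]) simp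

lemma connected_Omega: "connected \<Omega>"
  unfolding Omega by (intro connected_continuous_image holomorphic_on_imp_continuous_on hol_h) auto

lemma closure_shift:
  assumes "w \<in> closure \<Omega>" "t \<ge> 0"
  shows "w + of_real t \<in> closure \<Omega>"
proof -
  obtain x where x: "\<And>n. x n \<in> \<Omega>" "x \<longlonglongrightarrow> w" using assms(1) unfolding closure_sequential by auto
  have "(\<lambda>n. x n + of_real t) \<longlonglongrightarrow> w + of_real t" by (intro tendsto_intros x)
  moreover have "\<forall>n. x n + of_real t \<in> \<Omega>" using shift[OF x(1) assms(2)] by blast
  ultimately show ?thesis unfolding closure_sequential by (intro exI[of _ "\<lambda>n. x n + of_real t"]) simp
qed

lemma closure_strip:
  assumes "w \<in> closure \<Omega>" shows "\<bar>Im w\<bar> \<le> b"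
proof -
  have "closed {w. \<bar>Im w\<bar> \<le> b}" by (intro closed_Collect_le continuous_intros)
  moreover have "\<Omega> \<subseteq> {w. \<bar>Im w\<bar> \<le> b}" using strip by (auto intro: less_imp_le)
  ultimately show ?thesis using assms closure_minimal by blast
qed

text \<open>Let \<open>CU\<close> and \<open>CL\<close> be the components containing the upper and the lower half plane. If they differ, there
  is no third component. If they coincide, a path in \<open>CU\<close> from top to bottom crosses every height
  in the strip; as the complement is invariant under translations to the left, any point of it and the
  point of the path at the same height can be moved left until they meet.\<close>
lemma complement_component_contains_half_plane:
  assumes fin: "finite (components (- closure \<Omega>))" and two: "card (components (- closure \<Omega>)) \<le> 2"
    and C: "C \<in> components (- closure \<Omega>)"
  shows "{w. Im w > b} \<subseteq> C \<or> {w. Im w < - b} \<subseteq> C"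
proof -
  let ?S = "- closure \<Omega>" and ?U = "{w. Im w > b}" and ?L = "{w. Im w < - b}"
  define up lo where "up = Complex 0 (b + 1)" and "lo = Complex 0 (- b - 1)"
  have conn: "connected ?U" "connected ?L"
    by (auto intro!: convex_connected convex_halfspace_Im_gt convex_halfspace_Im_lt)
  have U: "?U \<subseteq> ?S" and L: "?L \<subseteq> ?S" using closure_strip by fastforce+
  have up: "up \<in> ?U" and lo: "lo \<in> ?L" by (auto simp: up_def lo_def)
  define CU CL where "CU = connected_component_set ?S up" and "CL = connected_component_set ?S lo"
  have CU: "CU \<in> components ?S" "up \<in> CU" and CL: "CL \<in> components ?S" "lo \<in> CL"
    using up lo U L by (auto simp: CU_def CL_def componentsI)
  have UCU: "?U \<subseteq> CU" by (rule components_maximal[OF CU(1) conn(1) U]) (use up CU in blast)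
  have LCL: "?L \<subseteq> CL" by (rule components_maximal[OF CL(1) conn(2) L]) (use lo CL in blast)
  consider "C = CU" | "C = CL" | "C \<noteq> CU" "C \<noteq> CL" "CU = CL" | "C \<noteq> CU" "C \<noteq> CL" "CU \<noteq> CL" by blast
  then show ?thesis
  proof cases
    case 4
    then have "card {C, CU, CL} = 3" by simp
    moreover have "card {C, CU, CL} \<le> card (components ?S)" using C CU CL fin by (intro card_mono) auto
    ultimately show ?thesis using two by simp
  next
    case 3
    have opS: "open ?S" using closed_closure by (rule open_Compl)
    have "path_connected CU"
      using connected_open_path_connected open_components[OF opS CU(1)] in_components_connected[OF CU(1)] by blast
    then obtain g where g: "path g" "path_image g \<subseteq> CU" "pathstart g = up" "pathfinish g = lo"
      using CU(2) CL(2) 3(3) unfolding path_connected_def by blast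
    obtain v where v: "v \<in> C" using in_components_nonempty[OF C] by blast
    have vS: "v \<in> ?S" using v in_components_subset[OF C] by blast
    have disj: "C \<inter> CU = {}" using components_nonoverlap[OF C CU(1)] 3(1) by blast
    have Imv: "- b \<le> Im v" "Im v \<le> b"
      using disj v UCU LCL 3(3) by (auto simp: not_less[symmetric])
    have "connected (Im ` path_image g)"
      by (intro connected_continuous_image connected_path_image g continuous_intros)
    moreover have "Im up \<in> Im ` path_image g" "Im lo \<in> Im ` path_image g"
      using g(3,4) pathstart_in_path_image[of g] pathfinish_in_path_image[of g] by auto
    ultimately have "Im v \<in> Im ` path_image g"
      using Imv unfolding connected_iff_interval by (auto simp: up_def lo_def)
    then obtain u where u: "u \<in> CU" "Im u = Im v" using g(2) by auto
    have uS: "u \<in> ?S" using u in_components_subset[OF CU(1)] by blast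
    define ray where "ray = (\<lambda>p::complex. (\<lambda>t. p - of_real t) ` {0::real..})"
    have ray_conn: "connected (ray p)" for p
      unfolding ray_def by (intro connected_continuous_image continuous_intros convex_connected) auto
    have ray_S: "ray p \<subseteq> ?S" if "p \<in> ?S" for p
      using that closure_shift by (fastforce simp: ray_def)
    have ray_in: "p \<in> ray p" for p unfolding ray_def by (rule image_eqI[of _ _ 0]) auto
    have "ray v \<subseteq> C" by (rule components_maximal[OF C ray_conn ray_S[OF vS]]) (use ray_in v in blast)
    moreover have "ray u \<subseteq> CU" by (rule components_maximal[OF CU(1) ray_conn ray_S[OF uS]]) (use ray_in u in blast)
    moreover define m where "m = Complex (min (Re u) (Re v)) (Im v)"
    have "m \<in> ray v" unfolding ray_def m_def
      by (rule image_eqI[of _ _ "Re v - min (Re u) (Re v)"]) (auto simp: complex_eq_iff)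
    moreover have "m \<in> ray u" unfolding ray_def m_def
      by (rule image_eqI[of _ _ "Re u - min (Re u) (Re v)"]) (auto simp: complex_eq_iff u)
    ultimately show ?thesis using disj by blast
  qed (use UCU LCL in auto)
qed

lemma thickening_shift:
  assumes "w \<in> thickening \<epsilon> \<Omega>" "t \<ge> 0"
  shows "w + of_real t \<in> thickening \<epsilon> \<Omega>"
proof -
  obtain v where v: "v \<in> \<Omega>" "dist v w < \<epsilon>" using assms by (auto simp: thickening_def)
  have "dist (v + of_real t) (w + of_real t) < \<epsilon>" using v by (simp add: dist_norm)
  then show ?thesis using shift[OF v(1) assms(2)] unfolding thickening_def by (intro UN_I[of "v + of_real t"]) auto
qed

lemma thickening_strip:
  assumes "w \<in> thickening \<epsilon> \<Omega>" shows "\<bar>Im w\<bar> < b + \<epsilon>"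
proof -
  obtain v where v: "v \<in> \<Omega>" "dist v w < \<epsilon>" using assms by (auto simp: thickening_def)
  have "\<bar>Im w - Im v\<bar> < \<epsilon>" using abs_Im_le_cmod[of "w - v"] v by (simp add: dist_norm norm_minus_commute)
  then show ?thesis using strip[OF v(1)] by linarith
qed

text \<open>The complement is invariant under translations to the left, so each of its components is unbounded.\<close>
lemma simply_connected_thickening:
  assumes \<epsilon>: "\<epsilon> > 0"
  shows "simply_connected (thickening \<epsilon> \<Omega>)"
proof -
  have "thickening \<epsilon> \<Omega> = (\<lambda>(x, y). x + y) ` (\<Omega> \<times> ball 0 \<epsilon>)"
  proof (intro set_eqI iffI)
    fix w assume "w \<in> thickening \<epsilon> \<Omega>"
    then obtain v where v: "v \<in> \<Omega>" "dist v w < \<epsilon>" by (auto simp: thickening_def)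
    then show "w \<in> (\<lambda>(x, y). x + y) ` (\<Omega> \<times> ball 0 \<epsilon>)"
      by (intro image_eqI[of _ _ "(v, w - v)"]) (auto simp: dist_norm norm_minus_commute)
  next
    fix w assume "w \<in> (\<lambda>(x, y). x + y) ` (\<Omega> \<times> ball 0 \<epsilon>)"
    then obtain x y where "x \<in> \<Omega>" "cmod y < \<epsilon>" "w = x + y" by auto
    then show "w \<in> thickening \<epsilon> \<Omega>" unfolding thickening_def by (intro UN_I[of x]) (auto simp: dist_norm)
  qed
  moreover have "connected ((\<lambda>(x, y). x + y) ` (\<Omega> \<times> ball (0::complex) \<epsilon>))"
    unfolding case_prod_unfold
    by (intro connected_continuous_image continuous_intros connected_Times connected_Omega) auto
  ultimately have conn: "connected (thickening \<epsilon> \<Omega>)" by (simp only:)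
  have "\<not> bounded C" if C: "C \<in> components (- thickening \<epsilon> \<Omega>)" for C
  proof
    assume "bounded C"
    obtain v where v: "v \<in> C" using in_components_nonempty[OF C] by blast
    have vS: "v \<notin> thickening \<epsilon> \<Omega>" using v in_components_subset[OF C] by blast
    let ?ray = "(\<lambda>t. v - of_real t) ` {0::real..}"
    have "?ray \<subseteq> C"
    proof (rule components_maximal[OF C])
      show "connected ?ray" by (intro connected_continuous_image continuous_intros convex_connected) auto
      show "?ray \<subseteq> - thickening \<epsilon> \<Omega>" 
      proof
        fix x assume "x \<in> ?ray"
        then obtain t where t: "t \<ge> 0" "x = v - of_real t" by auto
        then have "x + of_real t \<notin> thickening \<epsilon> \<Omega>" using vS by simp
        then show "x \<in> - thickening \<epsilon> \<Omega>" using thickening_shift[of x \<epsilon> t] t by blast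
      qed
      have "v \<in> ?ray" by (rule image_eqI[of _ _ 0]) auto
      then show "C \<inter> ?ray \<noteq> {}" using v by blast
    qed
    then have "bounded ?ray" using \<open>bounded C\<close> bounded_subset by blast
    then obtain B where B: "\<And>t. t \<ge> 0 \<Longrightarrow> cmod (v - of_real t) \<le> B" unfolding bounded_iff by auto
    have "B \<ge> 0" using B[of 0] by (metis norm_ge_zero order.refl order.trans)
    then have "cmod (of_real (cmod v + B + 1)) \<le> cmod v + cmod (v - of_real (cmod v + B + 1))"
      by (metis norm_triangle_sub norm_minus_commute)
    moreover have "cmod (v - of_real (cmod v + B + 1)) \<le> B" by (rule B) (use \<open>B \<ge> 0\<close> in auto)
    moreover have "cmod (of_real (cmod v + B + 1)) = cmod v + B + 1" unfolding norm_of_real using \<open>B \<ge> 0\<close> by simp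
    ultimately show False by linarith
  qed
  then show ?thesis
    using simply_connected_eq_unbounded_complement_components[OF open_thickening] conn by blast
qed

lemma Riemann_map_thickening:
  assumes \<epsilon>: "\<epsilon> > 0"
  obtains f g where "f holomorphic_on thickening \<epsilon> \<Omega>" "g holomorphic_on unit_disc"
    "\<And>w. w \<in> thickening \<epsilon> \<Omega> \<Longrightarrow> f w \<in> unit_disc \<and> g (f w) = w"
    "\<And>z. z \<in> unit_disc \<Longrightarrow> g z \<in> thickening \<epsilon> \<Omega> \<and> f (g z) = z"
    "f (h 0) = 0"
proof -
  let ?N = "thickening \<epsilon> \<Omega>"
  have h0: "h 0 \<in> ?N" using subset_thickening[OF \<epsilon>, of \<Omega>] h_in[of 0] by auto
  have "Complex 0 (b + \<epsilon>) \<notin> ?N" using thickening_strip[of "Complex 0 (b + \<epsilon>)" \<epsilon>] \<epsilon> b_pos by auto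
  then have "?N \<noteq> UNIV" by blast
  moreover have "?N \<noteq> {}" using h0 by blast
  ultimately have "\<exists>f g. f holomorphic_on ?N \<and> g holomorphic_on unit_disc \<and>
     (\<forall>w\<in>?N. f w \<in> unit_disc \<and> g (f w) = w) \<and> (\<forall>z\<in>unit_disc. g z \<in> ?N \<and> f (g z) = z)"
    using simply_connected_thickening[OF \<epsilon>]
    unfolding simply_connected_eq_biholomorphic_to_disc[OF open_thickening] by simp
  then obtain f g where f: "f holomorphic_on ?N" "\<And>w. w \<in> ?N \<Longrightarrow> f w \<in> unit_disc \<and> g (f w) = w"
    and g: "g holomorphic_on unit_disc" "\<And>z. z \<in> unit_disc \<Longrightarrow> g z \<in> ?N \<and> f (g z) = z"
    by (elim exE conjE) (rule that, auto)
  have f0: "f (h 0) \<in> unit_disc" using f h0 by blast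
  obtain m m' where m: "m (f (h 0)) = 0" "m holomorphic_on unit_disc" "m ` unit_disc \<subseteq> unit_disc"
     "m' holomorphic_on unit_disc" "m' ` unit_disc \<subseteq> unit_disc"
     "\<And>z. z \<in> unit_disc \<Longrightarrow> m (m' z) = z" "\<And>z. z \<in> unit_disc \<Longrightarrow> m' (m z) = z"
    using ball_biholomorphism_exists[OF f0] by metis
  show ?thesis
  proof (rule that[of "m \<circ> f" "g \<circ> m'"])
    show "m \<circ> f holomorphic_on ?N"
      by (rule holomorphic_on_compose_gen[OF f(1) m(2)]) (use f in blast)
    show "g \<circ> m' holomorphic_on unit_disc"
      by (rule holomorphic_on_compose_gen[OF m(4) g(1) m(5)])
  qed (use m f g in \<open>simp_all add: image_subset_iff\<close>)
qed

lemma inverse_holomorphic: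
  obtains k where "k holomorphic_on \<Omega>" "\<And>z. z \<in> unit_disc \<Longrightarrow> k (h z) = z"
    "\<And>w. w \<in> \<Omega> \<Longrightarrow> k w \<in> unit_disc \<and> h (k w) = w"
proof -
  obtain k where k: "k holomorphic_on \<Omega>" "\<And>z. z \<in> unit_disc \<Longrightarrow> k (h z) = z"
    using holomorphic_has_inverse[OF hol_h _ inj_h] unfolding Omega by (metis open_ball)
  show ?thesis by (rule that[OF k]) (use k(2) Omega in auto)
qed

lemma deriv_inverse_mult:
  assumes "f holomorphic_on S" "open S" "g holomorphic_on unit_disc" "g ` unit_disc \<subseteq> S"
    "\<And>z. z \<in> unit_disc \<Longrightarrow> f (g z) = z"
  shows "deriv f (g 0) * deriv g 0 = 1"
proof -
  have "deriv (f \<circ> g) 0 = deriv f (g 0) * deriv g 0"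
    by (rule deriv_chain) (use assms in \<open>auto intro!: holomorphic_on_imp_differentiable_at simp: image_subset_iff\<close>)
  moreover have "deriv (f \<circ> g) 0 = deriv (\<lambda>z. z) (0::complex)"
    by (rule deriv_cong_ev) (auto intro!: eventually_nhds_in_open[of unit_disc, THEN eventually_mono] assms)
  ultimately show ?thesis by simp
qed

text \<open>A case of Caratheodory's kernel theorem. Normalised Riemann maps \<open>g\<^sub>n\<close> from the disc onto the
  \<open>\<epsilon>\<^sub>n\<close>-neighbourhoods of \<open>\<Omega>\<close> have a limit \<open>G\<close> along a subsequence, by Montel's theorem. Schwarz's lemma for
  \<open>g\<^sub>n\<^sup>-\<^sup>1 \<circ> h\<close> gives \<open>|g\<^sub>n'(0)| \<ge> |h'(0)|\<close>, so \<open>G\<close> is not constant; its image is open and contained in the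
  closure of \<open>\<Omega>\<close>, hence in \<open>\<Omega>\<close>. Now Schwarz's lemma for \<open>h\<^sup>-\<^sup>1 \<circ> G\<close> gives \<open>|G'(0)| \<le> |h'(0)|\<close>. Therefore the
  derivatives \<open>h'(0) / g\<^sub>n'(0)\<close> of \<open>g\<^sub>n\<^sup>-\<^sup>1 \<circ> h\<close> at 0 tend to 1 in modulus along the subsequence, and a rotation
  makes them positive.\<close>
lemma kernel_approximation:
  assumes int: "interior (closure \<Omega>) = \<Omega>" and e: "e > 0"
  obtains \<epsilon> v where "\<epsilon> > 0" "v holomorphic_on thickening \<epsilon> \<Omega>" "v ` thickening \<epsilon> \<Omega> \<subseteq> unit_disc"
    "v (h 0) = 0" "Re (deriv (v \<circ> h) 0) > 1 - e"
proof -
  define \<epsilon> where "\<epsilon> = (\<lambda>n. 1 / (real n + 1))"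
  have \<epsilon>: "\<epsilon> n > 0" "\<epsilon> n \<le> 1" for n by (auto simp: \<epsilon>_def)
  have "\<forall>n. \<exists>f g. f holomorphic_on thickening (\<epsilon> n) \<Omega> \<and> g holomorphic_on unit_disc \<and>
    (\<forall>w \<in> thickening (\<epsilon> n) \<Omega>. f w \<in> unit_disc \<and> g (f w) = w) \<and>
    (\<forall>z \<in> unit_disc. g z \<in> thickening (\<epsilon> n) \<Omega> \<and> f (g z) = z) \<and> f (h 0) = 0"
    using Riemann_map_thickening[OF \<epsilon>(1)] by metis
  then obtain f g where f: "\<And>n. f n holomorphic_on thickening (\<epsilon> n) \<Omega>" and g: "\<And>n. g n holomorphic_on unit_disc"
    and fg: "\<And>n w. w \<in> thickening (\<epsilon> n) \<Omega> \<Longrightarrow> f n w \<in> unit_disc \<and> g n (f n w) = w"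
    and gf: "\<And>n z. z \<in> unit_disc \<Longrightarrow> g n z \<in> thickening (\<epsilon> n) \<Omega> \<and> f n (g n z) = z"
    and f0: "\<And>n. f n (h 0) = 0" by metis
  have h0: "h 0 \<in> thickening (\<epsilon> n) \<Omega>" for n using subset_thickening[OF \<epsilon>(1), of \<Omega>] h_in[of 0] by auto
  have g0: "g n 0 = h 0" for n using fg[OF h0, of n] f0[of n] by simp
  define B where "B = b + 1"
  have Img: "Im (g n z) < B" if "z \<in> unit_disc" for n z
    using thickening_strip[of "g n z" "\<epsilon> n"] gf[OF that, of n] \<epsilon>(2)[of n] by (simp add: B_def)
  have bound: "cmod (g n z) \<le> cmod (h 0) + 2 * (B - Im (h 0)) / (1 - \<rho>)" if z: "cmod z \<le> \<rho>" "\<rho> < 1" for n z \<rho>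
  proof -
    have zd: "z \<in> ball 0 1" using z by simp
    have pos: "B - Im (h 0) > 0" using Img[of 0 n] g0 by simp
    have "cmod ((of_real B + \<i> * g n z) - (of_real B + \<i> * g n 0)) * (1 - dist 0 z) \<le> 2 * dist 0 z * Re (of_real B + \<i> * g n 0)"
      by (rule right_half_plane_Harnack) (use Img g zd in \<open>auto intro!: holomorphic_intros\<close>)
    moreover have "(of_real B + \<i> * g n z) - (of_real B + \<i> * g n 0) = \<i> * (g n z - h 0)" by (simp add: g0 algebra_simps)
    ultimately have "cmod (g n z - h 0) * (1 - cmod z) \<le> 2 * cmod z * (B - Im (h 0))"
      by (simp add: norm_mult g0)
    also have "\<dots> \<le> 2 * 1 * (B - Im (h 0))" using z pos by (intro mult_right_mono) auto
    finally have "cmod (g n z - h 0) * (1 - cmod z) \<le> 2 * (B - Im (h 0))" by simp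
    moreover have "cmod (g n z - h 0) * (1 - \<rho>) \<le> cmod (g n z - h 0) * (1 - cmod z)"
      using z by (intro mult_left_mono) auto
    ultimately have "cmod (g n z - h 0) \<le> 2 * (B - Im (h 0)) / (1 - \<rho>)" using z by (simp add: pos_le_divide_eq)
    then show ?thesis using norm_triangle_sub[of "g n z" "h 0"] by linarith
  qed
  obtain G r where G: "G holomorphic_on unit_disc" and r: "strict_mono r"
    and lim: "\<And>x. x \<in> unit_disc \<Longrightarrow> (\<lambda>n. g (r n) x) \<longlonglongrightarrow> G x"
    and ulim: "\<And>K. compact K \<Longrightarrow> K \<subseteq> unit_disc \<Longrightarrow> uniform_limit K (g \<circ> r) G sequentially"
  proof (rule Montel[of unit_disc "range g" g])
    fix K :: "complex set" assume K: "compact K" "K \<subseteq> unit_disc"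
    show "\<exists>B. \<forall>h\<in>range g. \<forall>z\<in>K. cmod (h z) \<le> B"
    proof (cases "K = {}")
      case False
      obtain x where x: "x \<in> K" "\<And>z. z \<in> K \<Longrightarrow> cmod z \<le> cmod x"
        using continuous_attains_sup[OF K(1) False, of cmod] by (auto intro: continuous_intros)
      then have "cmod x < 1" using K by auto
      then show ?thesis using bound x by blast
    qed auto
  qed (use g in auto)
  have \<epsilon>lim: "\<epsilon> \<longlonglongrightarrow> 0" unfolding \<epsilon>_def using LIMSEQ_Suc[OF lim_1_over_n] by (simp add: add.commute)
  have rtop: "filterlim r at_top sequentially" using r by (rule filterlim_subseq)
  have G_cl: "G z \<in> closure \<Omega>" if z: "z \<in> unit_disc" for z
  proof (rule closure_approachable[THEN iffD2], intro allI impI)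
    fix d :: real assume d: "d > 0"
    have "\<forall>\<^sub>F n in sequentially. dist (g (r n) z) (G z) < d / 2" by (rule tendstoD[OF lim[OF z]]) (use d in simp)
    moreover have "\<forall>\<^sub>F n in sequentially. \<epsilon> (r n) < d / 2"
      by (rule order_tendstoD(2)[OF filterlim_compose[OF \<epsilon>lim rtop]]) (use d in simp)
    ultimately have "\<forall>\<^sub>F n in sequentially. dist (g (r n) z) (G z) < d / 2 \<and> \<epsilon> (r n) < d / 2"
      by (rule eventually_conj)
    then obtain n where n: "dist (g (r n) z) (G z) < d / 2" "\<epsilon> (r n) < d / 2" by (auto simp: eventually_sequentially)
    obtain v where v: "v \<in> \<Omega>" "dist v (g (r n) z) < \<epsilon> (r n)" using gf[OF z, of "r n"] by (auto simp: thickening_def)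
    then show "\<exists>y\<in>\<Omega>. dist y (G z) < d" using n dist_triangle[of v "G z" "g (r n) z"] by (intro bexI[of _ v]) auto
  qed
  have G0: "G 0 = h 0" using lim[of 0] g0 by (simp add: LIMSEQ_const_iff)
  have dlim: "(\<lambda>n. deriv (g (r n)) 0) \<longlonglongrightarrow> deriv G 0"
  proof -
    have ul: "uniform_limit (ball 0 (1/2)) (g \<circ> r) G sequentially"
      by (rule uniform_limit_on_subset[OF ulim[of "cball 0 (1/2)"]]) auto
    have "\<forall>\<^sub>F n in sequentially. (g \<circ> r) n holomorphic_on ball 0 (1/2)"
      by (intro always_eventually allI) (auto intro: holomorphic_on_subset[OF g])
    from higher_deriv_complex_uniform_limit[OF ul this, of 0 1] show ?thesis by simp
  qed
  have ps: "(f n \<circ> h) holomorphic_on unit_disc" "(f n \<circ> h) ` unit_disc \<subseteq> unit_disc" "(f n \<circ> h) 0 = 0" for n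
  proof -
    have sub: "h ` unit_disc \<subseteq> thickening (\<epsilon> n) \<Omega>" using subset_thickening[OF \<epsilon>(1)] Omega by auto
    show "(f n \<circ> h) holomorphic_on unit_disc" by (rule holomorphic_on_compose_gen[OF hol_h f sub])
    show "(f n \<circ> h) ` unit_disc \<subseteq> unit_disc" using fg sub by (auto simp: image_subset_iff)
  qed (simp add: f0)
  have d_ps: "deriv (f n \<circ> h) 0 = deriv h 0 / deriv (g n) 0" and d_nz: "deriv (g n) 0 \<noteq> 0" for n
  proof -
    have 1: "deriv (f n) (g n 0) * deriv (g n) 0 = 1"
      by (rule deriv_inverse_mult[OF f open_thickening g]) (use gf in blast)+
    then show "deriv (g n) 0 \<noteq> 0" by auto
    have "deriv (f n \<circ> h) 0 = deriv (f n) (h 0) * deriv h 0"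
      by (rule deriv_chain)
         (use hol_h f[of n] h0[of n] open_thickening in \<open>auto intro!: holomorphic_on_imp_differentiable_at\<close>)
    then show "deriv (f n \<circ> h) 0 = deriv h 0 / deriv (g n) 0"
      using 1 \<open>deriv (g n) 0 \<noteq> 0\<close> by (simp add: g0 field_simps)
  qed
  obtain k where k: "k holomorphic_on \<Omega>" "\<And>z. z \<in> unit_disc \<Longrightarrow> k (h z) = z"
    "\<And>w. w \<in> \<Omega> \<Longrightarrow> k w \<in> unit_disc \<and> h (k w) = w" using inverse_holomorphic by blast
  have kh: "deriv k (h 0) * deriv h 0 = 1"
    by (rule deriv_inverse_mult[OF k(1) open_Omega hol_h]) (use k Omega in auto)
  then have dh: "deriv h 0 \<noteq> 0" by auto
  have ge: "cmod (deriv (g n) 0) \<ge> cmod (deriv h 0)" for n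
  proof -
    have "cmod (deriv (f n \<circ> h) 0) \<le> 1"
      by (rule Schwarz_Lemma(2)[OF ps(1) ps(3), of n 0]) (use ps(2)[of n] in \<open>auto simp: image_subset_iff\<close>)
    then show ?thesis using d_nz[of n] by (simp add: d_ps norm_divide)
  qed
  have dG: "cmod (deriv G 0) \<ge> cmod (deriv h 0)"
    by (rule tendsto_lowerbound[OF tendsto_norm[OF dlim]]) (use ge in auto)
  have "\<not> G constant_on unit_disc"
  proof
    assume "G constant_on unit_disc"
    then obtain c where c: "\<And>z. z \<in> unit_disc \<Longrightarrow> G z = c" by (auto simp: constant_on_def)
    have "deriv G 0 = deriv (\<lambda>z. c) 0"
      by (rule deriv_cong_ev) (auto intro!: eventually_nhds_in_open[of unit_disc, THEN eventually_mono] c)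
    then show False using dG dh by simp
  qed
  then have "open (G ` unit_disc)" by (intro open_mapping_thm[OF G]) auto
  moreover have "G ` unit_disc \<subseteq> closure \<Omega>" using G_cl by blast
  ultimately have G_in: "G ` unit_disc \<subseteq> \<Omega>" using interior_maximal int by metis
  have kG: "cmod (deriv (k \<circ> G) 0) \<le> 1"
  proof (rule Schwarz_Lemma(2)[of "k \<circ> G" 0])
    show "k \<circ> G holomorphic_on ball 0 1" by (rule holomorphic_on_compose_gen[OF G k(1) G_in])
    show "(k \<circ> G) 0 = 0" using k(2)[of 0] by (simp add: G0)
    show "cmod ((k \<circ> G) z) < 1" if "cmod z < 1" for z using k(3)[of "G z"] G_in that by (auto simp: image_subset_iff)
  qed auto
  have "deriv (k \<circ> G) 0 = deriv k (G 0) * deriv G 0"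
    by (rule deriv_chain)
       (use G k(1) open_Omega h_in[of 0] in \<open>auto intro!: holomorphic_on_imp_differentiable_at simp: G0\<close>)
  then have "cmod (deriv k (h 0)) * cmod (deriv G 0) \<le> 1" using kG by (simp add: G0 norm_mult)
  moreover have "cmod (deriv k (h 0)) * cmod (deriv h 0) = 1" using kh by (metis norm_mult norm_one)
  ultimately have "cmod (deriv k (h 0)) * cmod (deriv G 0) \<le> cmod (deriv k (h 0)) * cmod (deriv h 0)" by simp
  moreover have "deriv k (h 0) \<noteq> 0" using kh by auto
  ultimately have "cmod (deriv G 0) \<le> cmod (deriv h 0)" by simp
  with dG have eq: "cmod (deriv G 0) = cmod (deriv h 0)" by simp
  have "(\<lambda>n. cmod (deriv (f (r n) \<circ> h) 0)) \<longlonglongrightarrow> cmod (deriv h 0 / deriv G 0)"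
    unfolding d_ps by (intro tendsto_intros dlim) (use dG dh in auto)
  moreover have "cmod (deriv h 0 / deriv G 0) = 1" using eq dh by (simp add: norm_divide)
  ultimately have "\<forall>\<^sub>F n in sequentially. 1 - e < cmod (deriv (f (r n) \<circ> h) 0)"
    using e by (simp add: order_tendsto_iff)
  then obtain n where n: "1 - e < cmod (deriv (f (r n) \<circ> h) 0)" by (auto simp: eventually_sequentially)
  define d where "d = deriv (f (r n) \<circ> h) 0"
  have d: "d \<noteq> 0" unfolding d_def d_ps using dh d_nz by simp
  \<comment> \<open>The rotation that makes the derivative of \<open>f \<circ> h\<close> at 0 positive\<close>
  define c where "c = cnj d / of_real (cmod d)"
  have c: "cmod c = 1" using d by (simp add: c_def norm_divide)
  show ?thesis
  proof (rule that[of "\<epsilon> (r n)" "\<lambda>w. c * f (r n) w"])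
    show "(\<lambda>w. c * f (r n) w) holomorphic_on thickening (\<epsilon> (r n)) \<Omega>" by (intro holomorphic_intros f)
    show "(\<lambda>w. c * f (r n) w) ` thickening (\<epsilon> (r n)) \<Omega> \<subseteq> unit_disc"
      using fg c by (auto simp: norm_mult image_subset_iff)
    have "((\<lambda>w. c * f (r n) w) \<circ> h) = (\<lambda>z. c * (f (r n) \<circ> h) z)" by (rule ext) simp
    moreover have "deriv (\<lambda>z. c * (f (r n) \<circ> h) z) 0 = c * deriv (f (r n) \<circ> h) 0"
      by (rule deriv_cmult, rule holomorphic_on_imp_differentiable_at[OF ps(1)]) auto
    ultimately have "deriv ((\<lambda>w. c * f (r n) w) \<circ> h) 0 = c * d" by (simp only: d_def)
    also have "\<dots> = of_real (cmod d)"
    proof -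
      have "c * d = of_real ((cmod d)\<^sup>2) / of_real (cmod d)"
        unfolding complex_norm_square c_def by (simp add: mult.commute)
      then show ?thesis by (simp add: power2_eq_square)
    qed
    finally show "1 - e < Re (deriv ((\<lambda>w. c * f (r n) w) \<circ> h) 0)" using n by (simp add: d_def)
  qed (use \<epsilon> f0 in auto)
qed

end

section \<open>Functionals that annihilate the exponentials\<close>

lemma exp_minus_one_bound:
  assumes "Re s \<ge> 0" shows "cmod (exp (- s) - 1) \<le> cmod s"
proof -
  have "cmod (exp (- s) - exp (- 0)) \<le> 1 * cmod (s - 0)"
  proof (rule field_differentiable_bound[of "{w. 0 \<le> Re w}" "\<lambda>w. exp (- w)" "\<lambda>w. - exp (- w)"])
    show "convex {w. 0 \<le> Re w}" using convex_halfspace_Re_ge[of 0] by simp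
    show "((\<lambda>w. exp (- w)) has_field_derivative - exp (- w)) (at w within {w. 0 \<le> Re w})" for w :: complex
      by (auto intro!: derivative_eq_intros)
  qed (use assms in auto)
  then show ?thesis by simp
qed

lemma exp_quadratic_bound:
  assumes "Re s \<ge> 0" shows "cmod (exp (- s) - 1 + s) \<le> (cmod s)\<^sup>2"
proof -
  have "cmod ((exp (- s) - 1 + s) - (exp (- 0) - 1 + 0)) \<le> cmod s * cmod (s - 0)"
  proof (rule field_differentiable_bound[of "closed_segment 0 s" "\<lambda>w. exp (- w) - 1 + w" "\<lambda>w. 1 - exp (- w)"])
    show "((\<lambda>w. exp (- w) - 1 + w) has_field_derivative 1 - exp (- w)) (at w within closed_segment 0 s)" for w :: complex
      by (auto intro!: derivative_eq_intros)
    fix w assume "w \<in> closed_segment 0 s"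
    then obtain t where t: "0 \<le> t" "t \<le> 1" "w = t *\<^sub>R s" by (auto simp: closed_segment_def)
    have "cmod (1 - exp (- w)) \<le> cmod w"
      using exp_minus_one_bound[of w] t assms by (simp add: norm_minus_commute)
    also have "\<dots> \<le> cmod s" using t by (simp add: mult_left_le_one_le)
    finally show "cmod (1 - exp (- w)) \<le> cmod s" .
  qed auto
  then show ?thesis by (simp add: power2_eq_square)
qed

context strip_domain
begin

lemma bounded_holomorphic_exp: "bounded_holomorphic (\<lambda>z. exp (\<i> * of_real y * h z))"
proof (rule bounded_holomorphicI)
  show "(\<lambda>z. exp (\<i> * of_real y * h z)) holomorphic_on unit_disc" by (intro holomorphic_intros hol_h)
  fix z assume z: "z \<in> unit_disc"
  have "- (y * Im (h z)) \<le> \<bar>y\<bar> * \<bar>Im (h z)\<bar>" by (metis abs_ge_minus_self abs_mult)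
  also have "\<dots> \<le> \<bar>y\<bar> * b" using strip[OF h_in[OF z]] by (intro mult_left_mono) auto
  finally show "cmod (exp (\<i> * of_real y * h z)) \<le> exp (\<bar>y\<bar> * b)" by simp
qed

lemma bounded_holomorphic_comp_h:
  assumes F: "F holomorphic_on \<Omega>" and B: "\<And>w. w \<in> \<Omega> \<Longrightarrow> cmod (F w) \<le> B"
  shows "bounded_holomorphic (\<lambda>z. F (h z))"
proof (rule bounded_holomorphicI)
  show "(\<lambda>z. F (h z)) holomorphic_on unit_disc"
    by (rule holomorphic_on_compose_gen[of h _ F \<Omega>, unfolded o_def]) (use hol_h F h_in in auto)
qed (use B h_in in auto)

lemma bounded_holomorphic_resolvent:
  assumes "d > 0" "\<And>w. w \<in> \<Omega> \<Longrightarrow> d \<le> cmod (w - a)"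
  shows "bounded_holomorphic (\<lambda>z. 1 / (h z - a))"
proof (rule bounded_holomorphic_comp_h)
  show "(\<lambda>w. 1 / (w - a)) holomorphic_on \<Omega>"
    by (intro holomorphic_intros) (use assms in fastforce)
  show "cmod (1 / (w - a)) \<le> 1 / d" if "w \<in> \<Omega>" for w
    using assms(2)[OF that] assms(1) by (simp add: norm_divide frac_le)
qed

text \<open>The imaginary part of \<open>h\<close> is bounded, and it controls the real part in mean square.\<close>
lemma h_mean_square:
  obtains M where "M > 0" "\<And>r. 0 < r \<Longrightarrow> r < 1 \<Longrightarrow> hardy_mean 2 (\<lambda>z. h z - a) r \<le> M"
proof -
  define \<beta> where "\<beta> = b + cmod a"
  define u where "u = (\<lambda>z. h z - a)"
  have u: "u holomorphic_on unit_disc" unfolding u_def by (intro holomorphic_intros hol_h)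
  have Im: "(Im (u z))\<^sup>2 \<le> \<beta>\<^sup>2" if "z \<in> unit_disc" for z
  proof -
    have "\<bar>Im (u z)\<bar> \<le> \<beta>" unfolding u_def \<beta>_def
      using strip[OF h_in[OF that]] abs_Im_le_cmod[of a] by simp
    then show ?thesis by (metis abs_ge_zero power2_abs power_mono)
  qed
  show ?thesis
  proof (rule that[of "4 * pi * \<beta>\<^sup>2 + 2 * pi * (Re (u 0))\<^sup>2 + 1"])
    show "4 * pi * \<beta>\<^sup>2 + 2 * pi * (Re (u 0))\<^sup>2 + 1 > 0" by (intro add_nonneg_pos add_nonneg_nonneg) auto
    fix r :: real assume r: "0 < r" "r < 1"
    let ?I = "\<lambda>g. integral {0..2*pi} (\<lambda>\<theta>. (g (u (of_real r * cis \<theta>)))\<^sup>2)"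
    have cont: "continuous_on {0..2*pi} (\<lambda>\<theta>. u (of_real r * cis \<theta>))"
      by (rule continuous_on_circle[OF holomorphic_on_imp_continuous_on[OF u]]) (use r in auto)
    have "?I Im \<le> integral {0..2*pi} (\<lambda>\<theta>. \<beta>\<^sup>2)"
      by (intro integral_le integrable_continuous_real continuous_intros cont) (use Im circle_in_disc[OF r] in auto)
    then have I: "?I Im \<le> 2 * pi * \<beta>\<^sup>2" by simp
    have "?I Re - ?I Im = 2 * pi * ((Re (u 0))\<^sup>2 - (Im (u 0))\<^sup>2)"
      by (rule mean_square_Re_Im[OF u]) (use r in auto)
    also have "\<dots> \<le> 2 * pi * (Re (u 0))\<^sup>2" by simp
    finally have R: "?I Re \<le> 2 * pi * \<beta>\<^sup>2 + 2 * pi * (Re (u 0))\<^sup>2" using I by simp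
    have "hardy_mean 2 u r = ?I Re + ?I Im"
      unfolding hardy_mean_two cmod_power2
      by (intro integral_add integrable_continuous_real continuous_intros cont)
    then show "hardy_mean 2 (\<lambda>z. h z - a) r \<le> 4 * pi * \<beta>\<^sup>2 + 2 * pi * (Re (u 0))\<^sup>2 + 1"
      using R I unfolding u_def by simp
  qed
qed

end

locale strip_functional = strip_domain h \<Omega> b + hardy_functional p L C
  for h \<Omega> b p L C
begin

text \<open>The exponentials depend on \<open>y\<close> continuously in mean square. As \<open>h\<close> may be unbounded they need not do so
  uniformly; the estimate is \<open>|exp (\<i> y h) - exp (\<i> y' h)| \<le> B |y - y'| |h|\<close>.\<close>
lemma exponential_zero_closed:
  assumes near: "\<And>d. d > 0 \<Longrightarrow> \<exists>y'. \<bar>y - y'\<bar> < d \<and> \<Lambda> (\<lambda>z. exp (\<i> * of_real y' * h z)) = 0"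
  shows "\<Lambda> (\<lambda>z. exp (\<i> * of_real y * h z)) = 0"
proof -
  obtain M where M: "M > 0" "\<And>r. 0 < r \<Longrightarrow> r < 1 \<Longrightarrow> hardy_mean 2 (\<lambda>z. h z - 0) r \<le> M"
    using h_mean_square by blast
  define B where "B = exp ((\<bar>y\<bar> + 1) * b)"
  have B0: "B > 0" by (simp add: B_def)
  have eB: "cmod (exp (\<i> * of_real s * h z)) \<le> B" if "\<bar>s\<bar> \<le> \<bar>y\<bar> + 1" "z \<in> unit_disc" for s z
  proof -
    have "- (s * Im (h z)) \<le> \<bar>s\<bar> * \<bar>Im (h z)\<bar>" by (metis abs_ge_minus_self abs_mult)
    also have "\<dots> \<le> (\<bar>y\<bar> + 1) * b" using strip[OF h_in[OF that(2)]] that(1) by (intro mult_mono) auto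
    finally show ?thesis by (simp add: B_def)
  qed
  show ?thesis
  proof (rule \<Lambda>_eq_0_approx_mean_square[OF bounded_holomorphic_exp])
    fix \<delta> :: real assume \<delta>: "\<delta> > 0"
    define d where "d = min 1 (\<delta> / (B\<^sup>2 * M))"
    have d: "d > 0" using \<delta> B0 M by (simp add: d_def)
    obtain y' where y': "\<bar>y - y'\<bar> < d" "\<Lambda> (\<lambda>z. exp (\<i> * of_real y' * h z)) = 0" using near[OF d] by blast
    have y1: "\<bar>y'\<bar> \<le> \<bar>y\<bar> + 1"
    proof -
      have "\<bar>y - y'\<bar> < 1" using y'(1) by (simp add: d_def)
      then show ?thesis by linarith
    qed
    let ?D = "\<lambda>z. exp (\<i> * of_real y * h z) - exp (\<i> * of_real y' * h z)"
    have lip: "cmod (?D z) \<le> (d * B) * cmod (h z - 0)" if z: "z \<in> unit_disc" for z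
    proof -
      have "cmod (?D z) \<le> (B * cmod (h z)) * cmod (complex_of_real y - of_real y')"
      proof (rule field_differentiable_bound[of "closed_segment (of_real y') (of_real y)" "\<lambda>s. exp (\<i> * s * h z)" "\<lambda>s. exp (\<i> * s * h z) * (\<i> * h z)"])
        show "((\<lambda>s. exp (\<i> * s * h z)) has_field_derivative exp (\<i> * s * h z) * (\<i> * h z)) (at s within closed_segment (of_real y') (of_real y))" for s
          by (auto intro!: derivative_eq_intros)
        fix s :: complex assume "s \<in> closed_segment (of_real y') (of_real y)"
        then obtain t where t: "s = of_real t" "t \<in> closed_segment y' y" by (auto simp: closed_segment_of_real)
        have "\<bar>t\<bar> \<le> \<bar>y\<bar> + 1" using t(2) y1 by (auto simp: closed_segment_eq_real_ivl split: if_splits)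
        then show "cmod (exp (\<i> * s * h z) * (\<i> * h z)) \<le> B * cmod (h z)"
          using eB[of t z] z t(1) by (simp add: norm_mult mult_right_mono del: norm_exp_eq_Re)
      qed auto
      also have "cmod (complex_of_real y - of_real y') = \<bar>y - y'\<bar>" by (metis norm_of_real of_real_diff)
      also have "(B * cmod (h z)) * \<bar>y - y'\<bar> \<le> (B * cmod (h z)) * d" using y'(1) B0 by (intro mult_left_mono) auto
      finally show ?thesis by (simp add: mult_ac)
    qed
    have mean: "hardy_mean 2 ?D r \<le> \<delta>" if r: "0 < r" "r < 1" for r
    proof -
      have "hardy_mean 2 ?D r \<le> (d * B)\<^sup>2 * hardy_mean 2 (\<lambda>z. h z - 0) r"
        by (rule hardy_mean_two_dominated[OF _ _ _ lip r]) (use hol_h d B0 in \<open>auto intro!: holomorphic_intros\<close>)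
      also have "\<dots> \<le> (d * B)\<^sup>2 * M" using M(2)[OF r] by (intro mult_left_mono) auto
      also have "\<dots> = d * (d * (B\<^sup>2 * M))" by (simp add: power2_eq_square)
      also have "\<dots> \<le> 1 * (d * (B\<^sup>2 * M))" using d M by (intro mult_right_mono) (auto simp: d_def)
      also have "\<dots> \<le> \<delta> / (B\<^sup>2 * M) * (B\<^sup>2 * M)" unfolding mult_1 using M by (intro mult_right_mono) (auto simp: d_def)
      also have "\<dots> = \<delta>" using M B0 by simp
      finally show ?thesis .
    qed
    have "cmod (?D z) \<le> 2 * B" if z: "z \<in> unit_disc" for z
      using norm_triangle_ineq4[of "exp (\<i> * of_real y * h z)" "exp (\<i> * of_real y' * h z)"] eB[OF _ z, of y] eB[OF y1 z] by linarith
    then show "\<exists>g. bounded_holomorphic g \<and> \<Lambda> g = 0 \<and> (\<forall>z\<in>unit_disc. cmod (exp (\<i> * of_real y * h z) - g z) \<le> 2 * B) \<and>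
       (\<forall>r. 0 < r \<and> r < 1 \<longrightarrow> hardy_mean 2 (\<lambda>z. exp (\<i> * of_real y * h z) - g z) r \<le> \<delta>)"
      using y'(2) mean bounded_holomorphic_exp by (intro exI[of _ "\<lambda>z. exp (\<i> * of_real y' * h z)"]) blast
  qed
qed

end

text \<open>A functional that annihilates the exponentials. All further results about it serve to show that it is
  zero.\<close>
locale koenigs_functional = strip_functional +
  assumes exp_zero: "\<Lambda> (\<lambda>z. exp (\<i> * of_real y * h z)) = 0"
    and finite_complement: "finite (components (- closure \<Omega>))"
    and two_complement: "card (components (- closure \<Omega>)) \<le> 2"
    and int_closure: "interior (closure \<Omega>) = \<Omega>"
begin

text \<open>With \<open>s = \<i> \<sigma> \<delta> (h - a)\<close>, which has real part at least \<open>\<delta> c\<close>, the function \<open>g = \<i> \<sigma> \<delta> / (1 - exp (-s))\<close> is the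
  sum of a uniformly convergent geometric series of exponentials. It is a Riemann sum for the Laplace
  integral of \<open>1 / (h - a) = \<i> \<sigma> \<delta> / s\<close>, and differs from it by at most a multiple of \<open>\<delta> |h - a|\<close>, which is small in
  mean square. The sign \<open>\<sigma>\<close> tells whether \<open>a\<close> is above or below the strip.\<close>
lemma resolvent_far:
  assumes c: "c > 0" and \<sigma>: "\<sigma> = 1 \<or> \<sigma> = -1" and far: "\<And>w. w \<in> \<Omega> \<Longrightarrow> c \<le> \<sigma> * (Im a - Im w)"
  shows "\<Lambda> (\<lambda>z. 1 / (h z - a)) = 0"
proof -
  have dist: "c \<le> cmod (w - a)" if "w \<in> \<Omega>" for w
  proof -
    have "c \<le> \<bar>Im (w - a)\<bar>" using far[OF that] \<sigma> by auto
    then show ?thesis using abs_Im_le_cmod[of "w - a"] by linarith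
  qed
  obtain M where M: "M > 0" "\<And>r. 0 < r \<Longrightarrow> r < 1 \<Longrightarrow> hardy_mean 2 (\<lambda>z. h z - a) r \<le> M"
    using h_mean_square by blast
  have bhf: "bounded_holomorphic (\<lambda>z. 1 / (h z - a))" by (rule bounded_holomorphic_resolvent[OF c dist])
  have main: "\<exists>g. bounded_holomorphic g \<and> \<Lambda> g = 0 \<and> (\<forall>z\<in>unit_disc. cmod (1 / (h z - a) - g z) \<le> 1 / c + (1 + c) / c) \<and>
       (\<forall>r. 0 < r \<and> r < 1 \<longrightarrow> hardy_mean 2 (\<lambda>z. 1 / (h z - a) - g z) r \<le> (\<delta> * ((1 + c) / c))\<^sup>2 * M)"
    if \<delta>: "0 < \<delta>" "\<delta> \<le> 1" for \<delta>
  proof -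
    define s where "s = (\<lambda>w. \<i> * of_real (\<sigma> * \<delta>) * (w - a))"
    define q where "q = (\<lambda>z. exp (- s (h z)))"
    define \<rho> where "\<rho> = exp (- (\<delta> * c))"
    have \<rho>: "0 < \<rho>" "\<rho> < 1" using \<delta> c by (auto simp: \<rho>_def)
    have Res: "\<delta> * c \<le> Re (s w)" if "w \<in> \<Omega>" for w
      using mult_left_mono[OF far[OF that], of \<delta>] \<delta> by (simp add: s_def algebra_simps)
    have q: "cmod (q z) \<le> \<rho>" if "z \<in> unit_disc" for z
      using Res[OF h_in[OF that]] by (simp add: q_def \<rho>_def)
    have one: "1 - \<rho> \<le> cmod (1 - q z)" if "z \<in> unit_disc" for z
      using q[OF that] norm_triangle_ineq2[of 1 "q z"] by simp
    have den: "\<delta> * (c / (1 + c)) \<le> 1 - \<rho>"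
    proof -
      have "\<rho> = 1 / exp (\<delta> * c)" by (simp add: \<rho>_def exp_minus inverse_eq_divide)
      also have "\<dots> \<le> 1 / (1 + \<delta> * c)" using \<delta> c exp_ge_add_one_self[of "\<delta> * c"] by (intro divide_left_mono) (auto intro!: mult_pos_pos add_pos_pos)
      finally have "1 - 1 / (1 + \<delta> * c) \<le> 1 - \<rho>" by simp
      moreover have "1 - 1 / (1 + \<delta> * c) = \<delta> * c / (1 + \<delta> * c)" proof -
        have "1 + \<delta> * c > 0" using \<delta> c by (intro add_pos_pos mult_pos_pos) auto
        then show ?thesis by (simp add: field_simps)
      qed
      moreover have "\<delta> * c / (1 + c) \<le> \<delta> * c / (1 + \<delta> * c)"
        using \<delta> c by (intro divide_left_mono mult_pos_pos add_pos_pos) (auto simp: mult_left_le_one_le)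
      ultimately show ?thesis by simp
    qed
    have q1: "1 - q z \<noteq> 0" if "z \<in> unit_disc" for z using one[OF that] \<rho> by auto
    define g where "g = (\<lambda>z. \<i> * of_real (\<sigma> * \<delta>) / (1 - q z))"
    have ns: "cmod (\<i> * of_real (\<sigma> * \<delta>)) = \<delta>" using \<sigma> \<delta> by (auto simp: norm_mult)
    have qhol: "q holomorphic_on unit_disc" unfolding q_def s_def by (intro holomorphic_intros hol_h)
    have ghol: "g holomorphic_on unit_disc"
      unfolding g_def by (intro holomorphic_intros qhol) (use q1 in auto)
    have gb: "cmod (g z) \<le> (1 + c) / c" if "z \<in> unit_disc" for z
    proof -
      have "cmod (g z) = \<delta> / cmod (1 - q z)" unfolding g_def norm_divide ns ..
      also have "\<dots> \<le> \<delta> / (\<delta> * (c / (1 + c)))"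
        using one[OF that] den \<delta> c \<rho> q1[OF that] by (intro divide_left_mono mult_pos_pos) auto
      also have "\<dots> = (1 + c) / c" using \<delta> c by simp
      finally show ?thesis .
    qed
    have gbh: "bounded_holomorphic g" by (rule bounded_holomorphicI[OF ghol gb])
    have "\<Lambda> g = 0"
    proof (rule \<Lambda>_eq_0_approx_sup[OF gbh])
      fix \<eta> :: real assume \<eta>: "\<eta> > 0"
      have "(\<lambda>N. \<delta> * \<rho> ^ N / (1 - \<rho>)) \<longlonglongrightarrow> \<delta> * 0 / (1 - \<rho>)"
        using \<rho> by (intro tendsto_intros LIMSEQ_power_zero) auto
      then have "\<forall>\<^sub>F N in sequentially. \<delta> * \<rho> ^ N / (1 - \<rho>) < \<eta>" using \<eta> by (simp add: order_tendsto_iff)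
      then obtain N where N: "\<delta> * \<rho> ^ N / (1 - \<rho>) < \<eta>" by (auto simp: eventually_sequentially)
      define gN where "gN = (\<lambda>z. \<Sum>k<N. \<i> * of_real (\<sigma> * \<delta>) * q z ^ k)"
      define e where "e = (\<lambda>k::nat. \<i> * of_real (\<sigma> * \<delta>) * exp (of_nat k * (\<i> * of_real (\<sigma> * \<delta>) * a)))"
      have qk: "\<i> * of_real (\<sigma> * \<delta>) * q z ^ k = e k * exp (\<i> * of_real (- (real k * \<sigma> * \<delta>)) * h z)" for z k
      proof -
        have "q z ^ k = exp (of_nat k * (- s (h z)))" unfolding q_def by (rule exp_of_nat_mult[symmetric])
        also have "of_nat k * (- s (h z)) = of_nat k * (\<i> * of_real (\<sigma> * \<delta>) * a) + \<i> * of_real (- (real k * \<sigma> * \<delta>)) * h z"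
          by (simp add: s_def algebra_simps)
        also have "exp (of_nat k * (\<i> * of_real (\<sigma> * \<delta>) * a) + \<i> * of_real (- (real k * \<sigma> * \<delta>)) * h z)
          = exp (of_nat k * (\<i> * of_real (\<sigma> * \<delta>) * a)) * exp (\<i> * of_real (- (real k * \<sigma> * \<delta>)) * h z)"
          by (rule exp_add)
        finally show ?thesis by (simp only: e_def mult.assoc)
      qed
      have "bounded_holomorphic gN"
        unfolding gN_def qk by (intro bounded_holomorphic_sum bounded_holomorphic_cmult bounded_holomorphic_exp)
      moreover have "\<Lambda> gN = 0"
      proof -
        have "\<Lambda> gN = (\<Sum>k<N. \<Lambda> (\<lambda>z. e k * exp (\<i> * of_real (- (real k * \<sigma> * \<delta>)) * h z)))"
          unfolding gN_def qk by (intro \<Lambda>_sum bounded_holomorphic_cmult bounded_holomorphic_exp) auto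
        also have "\<dots> = 0"
          by (intro sum.neutral ballI) (simp only: \<Lambda>_cmult[OF bounded_holomorphic_exp] exp_zero mult_zero_right)
        finally show ?thesis .
      qed
      moreover have "cmod (g z - gN z) \<le> \<eta>" if z: "z \<in> unit_disc" for z
      proof -
        have "gN z = \<i> * of_real (\<sigma> * \<delta>) * ((1 - q z ^ N) / (1 - q z))"
          unfolding gN_def sum_distrib_left[symmetric] using q1[OF z] by (simp add: sum_gp_strict)
        then have "g z - gN z = \<i> * of_real (\<sigma> * \<delta>) * q z ^ N / (1 - q z)"
          using q1[OF z] by (simp add: g_def field_simps)
        then have "cmod (g z - gN z) = \<delta> * cmod (q z) ^ N / cmod (1 - q z)"
          using ns by (simp add: norm_divide norm_mult norm_power)
        also have "\<dots> \<le> \<delta> * \<rho> ^ N / (1 - \<rho>)"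
          using q[OF z] one[OF z] \<delta> \<rho> by (intro frac_le mult_left_mono power_mono) auto
        finally show ?thesis using N by simp
      qed
      ultimately show "\<exists>ga. bounded_holomorphic ga \<and> \<Lambda> ga = 0 \<and> (\<forall>z\<in>unit_disc. cmod (g z - ga z) \<le> \<eta>)"
        by (intro exI[of _ gN]) auto
    qed
    moreover have "cmod (1 / (h z - a) - g z) \<le> 1 / c + (1 + c) / c" if z: "z \<in> unit_disc" for z
    proof -
      have "cmod (1 / (h z - a)) \<le> 1 / c" using dist[OF h_in[OF z]] c by (simp add: norm_divide frac_le)
      then show ?thesis using gb[OF z] norm_triangle_ineq4[of "1 / (h z - a)" "g z"] by linarith
    qed
    moreover have "hardy_mean 2 (\<lambda>z. 1 / (h z - a) - g z) r \<le> (\<delta> * ((1 + c) / c))\<^sup>2 * M" if r: "0 < r" "r < 1" for r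
    proof -
      have "hardy_mean 2 (\<lambda>z. 1 / (h z - a) - g z) r \<le> (\<delta> * ((1 + c) / c))\<^sup>2 * hardy_mean 2 (\<lambda>z. h z - a) r"
      proof (rule hardy_mean_two_dominated[OF _ _ _ _ r])
        show "(\<lambda>z. 1 / (h z - a) - g z) holomorphic_on unit_disc"
          by (intro holomorphic_on_diff ghol bounded_holomorphic_imp_holomorphic[OF bhf])
        show "(\<lambda>z. h z - a) holomorphic_on unit_disc" by (intro holomorphic_intros hol_h)
        fix z assume z: "z \<in> unit_disc"
        let ?u = "h z - a" and ?s = "s (h z)"
        have u0: "?u \<noteq> 0" using dist[OF h_in[OF z]] c by auto
        have k: "\<i> * of_real (\<sigma> * \<delta>) = ?s / ?u" using u0 by (simp add: s_def)
        have "1 / ?u - g z = (exp (- ?s) - 1 + ?s) / (?u * (q z - 1))"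
          unfolding g_def k using u0 q1[OF z] by (simp add: q_def divide_simps) (simp add: algebra_simps)
        then have "cmod (1 / ?u - g z) = cmod (exp (- ?s) - 1 + ?s) / (cmod ?u * cmod (1 - q z))"
          by (simp add: norm_divide norm_mult norm_minus_commute)
        also have "\<dots> \<le> (cmod ?s)\<^sup>2 / (cmod ?u * (\<delta> * (c / (1 + c))))"
        proof (intro frac_le mult_left_mono exp_quadratic_bound)
          show "0 \<le> Re ?s" using Res[OF h_in[OF z]] mult_pos_pos[OF \<delta>(1) c] by linarith
          show "\<delta> * (c / (1 + c)) \<le> cmod (1 - q z)" using one[OF z] den by linarith
          show "0 < cmod ?u * (\<delta> * (c / (1 + c)))" using u0 \<delta> c by (intro mult_pos_pos) auto
        qed auto
        also have "cmod ?s = \<delta> * cmod ?u" unfolding s_def using ns by (simp only: norm_mult)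
        also have "(\<delta> * cmod ?u)\<^sup>2 / (cmod ?u * (\<delta> * (c / (1 + c)))) = \<delta> * ((1 + c) / c) * cmod ?u"
          using u0 \<delta> c by (simp add: power2_eq_square divide_simps)
        finally show "cmod (1 / ?u - g z) \<le> \<delta> * ((1 + c) / c) * cmod ?u" .
      qed (use \<delta> c in auto)
      also have "\<dots> \<le> (\<delta> * ((1 + c) / c))\<^sup>2 * M" using M(2)[OF r] by (intro mult_left_mono) auto
      finally show ?thesis .
    qed
    ultimately show ?thesis using gbh by blast
  qed
  show ?thesis
  proof (rule \<Lambda>_eq_0_approx_mean_square[OF bhf])
    fix \<eta> :: real assume \<eta>: "\<eta> > 0"
    define K where "K = ((1 + c) / c)\<^sup>2 * M"
    have K: "K > 0" using c M by (simp add: K_def)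
    define \<delta> where "\<delta> = min 1 (\<eta> / K)"
    have \<delta>: "0 < \<delta>" "\<delta> \<le> 1" using \<eta> K by (auto simp: \<delta>_def)
    have "(\<delta> * ((1 + c) / c))\<^sup>2 * M = \<delta> * \<delta> * K" by (simp add: K_def power_mult_distrib power2_eq_square)
    also have "\<dots> \<le> 1 * \<delta> * K" using \<delta> K by (intro mult_right_mono) auto
    also have "\<dots> \<le> \<eta>" using K by (simp add: \<delta>_def min_def field_simps)
    finally show "\<exists>g. bounded_holomorphic g \<and> \<Lambda> g = 0 \<and> (\<forall>z\<in>unit_disc. cmod (1 / (h z - a) - g z) \<le> 1 / c + (1 + c) / c) \<and>
       (\<forall>r. 0 < r \<and> r < 1 \<longrightarrow> hardy_mean 2 (\<lambda>z. 1 / (h z - a) - g z) r \<le> \<eta>)"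
      using main[OF \<delta>] by (meson order_trans)
  qed
qed

text \<open>The function \<open>E a = \<Lambda> (1 / (h - a))\<close> is holomorphic off the closure of \<open>\<Omega>\<close>, vanishes on the two half
  planes outside the strip, and each component contains one of them.\<close>
lemma resolvent_zero:
  assumes a: "a \<notin> closure \<Omega>"
  shows "\<Lambda> (\<lambda>z. 1 / (h z - a)) = 0"
proof -
  define E where "E = (\<lambda>a. \<Lambda> (\<lambda>z. 1 / (h z - a)))"
  define K where "K = \<bar>C\<bar> * (2 * pi) powr (1 / p)"
  have opS: "open (- closure \<Omega>)" using closed_closure by (rule open_Compl)
  \<comment> \<open>Differentiation under \<open>\<Lambda>\<close>, with a remainder that is uniform on \<open>\<Omega>\<close>\<close>
  have der: "(E has_field_derivative \<Lambda> (\<lambda>z. 1 / (h z - x) * (1 / (h z - x)))) (at x)" if x: "x \<in> - closure \<Omega>" for x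
  proof -
    obtain d where d: "d > 0" "ball x d \<subseteq> - closure \<Omega>" using opS x open_contains_ball by blast
    have far: "d \<le> cmod (w - x)" if "w \<in> \<Omega>" for w
    proof (rule ccontr)
      assume "\<not> ?thesis"
      then have "w \<in> ball x d" by (simp add: dist_norm norm_minus_commute)
      then show False using d that closure_subset by blast
    qed
    have bx: "bounded_holomorphic (\<lambda>z. 1 / (h z - x))" by (rule bounded_holomorphic_resolvent[OF d(1) far])
    have bx2: "bounded_holomorphic (\<lambda>z. 1 / (h z - x) * (1 / (h z - x)))" by (rule bounded_holomorphic_mult[OF bx bx])
    have est: "cmod ((E y - E x) - (y - x) * \<Lambda> (\<lambda>z. 1 / (h z - x) * (1 / (h z - x)))) \<le> (K * (2 / d ^ 3)) * (cmod (y - x))\<^sup>2"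
      if y: "cmod (y - x) < d / 2" for y
    proof -
      have far': "d / 2 \<le> cmod (w - y)" if "w \<in> \<Omega>" for w
        using far[OF that] y norm_triangle_ineq4[of "w - y" "x - y"] by (simp add: norm_minus_commute)
      have bhy: "bounded_holomorphic (\<lambda>z. 1 / (h z - y))"
        by (rule bounded_holomorphic_resolvent[of "d / 2"]) (use d far' in auto)
      let ?f = "\<lambda>z. (1 / (h z - y) - 1 / (h z - x)) - (y - x) * (1 / (h z - x) * (1 / (h z - x)))"
      have "\<Lambda> ?f = (E y - E x) - (y - x) * \<Lambda> (\<lambda>z. 1 / (h z - x) * (1 / (h z - x)))"
        unfolding E_def
        by (subst \<Lambda>_diff[OF bounded_holomorphic_diff[OF bhy bx] bounded_holomorphic_cmult[OF bx2]],
            subst \<Lambda>_diff[OF bhy bx], subst \<Lambda>_cmult[OF bx2]) (rule refl)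
      moreover have "cmod (\<Lambda> ?f) \<le> K * ((cmod (y - x))\<^sup>2 * (2 / d ^ 3))"
        unfolding K_def
      proof (rule \<Lambda>_sup_bound)
        show "?f holomorphic_on unit_disc"
          by (intro bounded_holomorphic_imp_holomorphic bounded_holomorphic_diff bounded_holomorphic_cmult bhy bx bx2)
        fix z assume z: "z \<in> unit_disc"
        note f1 = far[OF h_in[OF z]] and f2 = far'[OF h_in[OF z]]
        have nz: "h z - x \<noteq> 0" "h z - y \<noteq> 0" using f1 f2 d by auto
        have "?f z = (y - x)\<^sup>2 / ((h z - y) * (h z - x)\<^sup>2)"
          using nz by (simp add: divide_simps) (simp add: power2_eq_square algebra_simps)
        then have "cmod (?f z) = (cmod (y - x))\<^sup>2 / (cmod (h z - y) * (cmod (h z - x))\<^sup>2)"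
          by (simp add: norm_divide norm_mult norm_power)
        also have "\<dots> \<le> (cmod (y - x))\<^sup>2 / (d / 2 * d\<^sup>2)"
          using f1 f2 d by (intro divide_left_mono mult_mono power_mono mult_pos_pos) (use nz in auto)
        also have "\<dots> = (cmod (y - x))\<^sup>2 * (2 / d ^ 3)" using d by (simp add: power2_eq_square power3_eq_cube)
        finally show "cmod (?f z) \<le> (cmod (y - x))\<^sup>2 * (2 / d ^ 3)" .
      qed
      ultimately show ?thesis by (simp add: mult_ac)
    qed
    show ?thesis
      unfolding has_field_derivative_iff
    proof (rule LIM_I)
      fix \<epsilon> :: real assume \<epsilon>: "\<epsilon> > 0"
      define M where "M = K * (2 / d ^ 3) + 1"
      have M: "M > 0" using d by (simp add: M_def K_def add_nonneg_pos)
      show "\<exists>s>0. \<forall>y. y \<noteq> x \<and> cmod (y - x) < s \<longrightarrow>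
          cmod ((E y - E x) / (y - x) - \<Lambda> (\<lambda>z. 1 / (h z - x) * (1 / (h z - x)))) < \<epsilon>"
      proof (intro exI[of _ "min (d / 2) (\<epsilon> / M)"] conjI allI impI)
        show "0 < min (d / 2) (\<epsilon> / M)" using d \<epsilon> M by simp
        fix y assume y: "y \<noteq> x \<and> cmod (y - x) < min (d / 2) (\<epsilon> / M)"
        let ?D = "\<Lambda> (\<lambda>z. 1 / (h z - x) * (1 / (h z - x)))"
        have "(E y - E x) / (y - x) - ?D = ((E y - E x) - (y - x) * ?D) / (y - x)" using y by (simp add: field_simps)
        then have "cmod ((E y - E x) / (y - x) - ?D) = cmod ((E y - E x) - (y - x) * ?D) / cmod (y - x)"
          by (simp add: norm_divide)
        also have "\<dots> \<le> (K * (2 / d ^ 3)) * (cmod (y - x))\<^sup>2 / cmod (y - x)"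
          using est[of y] y by (intro divide_right_mono) auto
        also have "\<dots> = (K * (2 / d ^ 3)) * cmod (y - x)" using y by (simp add: power2_eq_square)
        also have "\<dots> \<le> M * cmod (y - x)" by (intro mult_right_mono) (auto simp: M_def)
        also have "\<dots> < \<epsilon>" using y M by (simp add: field_simps)
        finally show "cmod ((E y - E x) / (y - x) - ?D) < \<epsilon>" .
      qed
    qed
  qed
  have Ehol: "E holomorphic_on - closure \<Omega>"
    unfolding holomorphic_on_open[OF opS] using der by blast
  define T where "T = connected_component_set (- closure \<Omega>) a"
  have T: "T \<in> components (- closure \<Omega>)" "a \<in> T" using a by (auto simp: T_def componentsI)
  have opT: "open T" by (rule open_components[OF opS T(1)])
  have conT: "connected T" by (rule in_components_connected[OF T(1)])
  have Esub: "E holomorphic_on T" by (rule holomorphic_on_subset[OF Ehol in_components_subset[OF T(1)]])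
  have up: "E x = 0" if "Im x > b" for x
    unfolding E_def
  proof (rule resolvent_far[of "Im x - b" 1])
    show "Im x - b \<le> 1 * (Im x - Im w)" if "w \<in> \<Omega>" for w using strip[OF that] by simp
  qed (use that in auto)
  have lo: "E x = 0" if "Im x < - b" for x
    unfolding E_def
  proof (rule resolvent_far[of "- b - Im x" "-1"])
    show "- b - Im x \<le> -1 * (Im x - Im w)" if "w \<in> \<Omega>" for w using strip[OF that] by simp
  qed (use that in auto)
  have ne: "{w. Im w > b} \<noteq> {}" "{w. Im w < - b} \<noteq> {}"
    by (auto intro: exI[of _ "Complex 0 (b + 1)"] exI[of _ "Complex 0 (- b - 1)"])
  have "E a = 0"
    using complement_component_contains_half_plane[OF finite_complement two_complement T(1)]
  proof
    assume sub: "{w. Im w > b} \<subseteq> T"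
    show ?thesis
      by (rule analytic_continuation_open[OF open_halfspace_Im_gt opT ne(1) conT sub Esub holomorphic_on_const _ T(2)])
         (use up in auto)
  next
    assume sub: "{w. Im w < - b} \<subseteq> T"
    show ?thesis
      by (rule analytic_continuation_open[OF open_halfspace_Im_lt opT ne(2) conT sub Esub holomorphic_on_const _ T(2)])
         (use lo in auto)
  qed
  then show ?thesis by (simp add: E_def)
qed

end

section \<open>Rational approximation on the Koenigs domain\<close>

lemma square_Cauchy:
  fixes G :: "complex \<Rightarrow> complex" and x y \<delta> :: real
  defines "a \<equiv> Complex x y" and "a2 \<equiv> Complex (x + \<delta>) y" and "a3 \<equiv> Complex (x + \<delta>) (y + \<delta>)" and "a4 \<equiv> Complex x (y + \<delta>)"
  assumes \<delta>: "\<delta> > 0" and G: "G holomorphic_on ball (Complex (x + \<delta> / 2) (y + \<delta> / 2)) \<delta>" (is "G holomorphic_on ?B")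
    and w: "Re w \<noteq> x" "Re w \<noteq> x + \<delta>" "Im w \<noteq> y" "Im w \<noteq> y + \<delta>"
  shows "contour_integral (linepath a a2) (\<lambda>\<zeta>. G \<zeta> / (\<zeta> - w)) + contour_integral (linepath a2 a3) (\<lambda>\<zeta>. G \<zeta> / (\<zeta> - w))
      - contour_integral (linepath a4 a3) (\<lambda>\<zeta>. G \<zeta> / (\<zeta> - w)) - contour_integral (linepath a a4) (\<lambda>\<zeta>. G \<zeta> / (\<zeta> - w))
    = (if x < Re w \<and> Re w < x + \<delta> \<and> y < Im w \<and> Im w < y + \<delta> then 2 * pi * \<i> * G w else 0)"
proof -
  let ?f = "\<lambda>\<zeta>. G \<zeta> / (\<zeta> - w)"
  have cell: "cbox a a3 \<subseteq> ?B"
  proof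
    fix \<zeta> assume "\<zeta> \<in> cbox a a3"
    then have "\<bar>Re \<zeta> - (x + \<delta> / 2)\<bar> \<le> \<delta> / 2" "\<bar>Im \<zeta> - (y + \<delta> / 2)\<bar> \<le> \<delta> / 2"
      unfolding in_cbox_complex_iff a_def a3_def complex.sel abs_le_iff by (simp_all add: field_simps)
    then have "(Re \<zeta> - (x + \<delta> / 2))\<^sup>2 \<le> (\<delta> / 2)\<^sup>2" "(Im \<zeta> - (y + \<delta> / 2))\<^sup>2 \<le> (\<delta> / 2)\<^sup>2"
      by (metis abs_ge_zero power2_abs power_mono)+
    then have "(cmod (\<zeta> - Complex (x + \<delta> / 2) (y + \<delta> / 2)))\<^sup>2 \<le> \<delta>\<^sup>2 / 2"
      unfolding cmod_power2 by (simp add: power_divide)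
    also have "\<dots> < \<delta>\<^sup>2" using \<delta> by simp
    finally have "cmod (\<zeta> - Complex (x + \<delta> / 2) (y + \<delta> / 2)) < \<delta>" using \<delta> by (simp add: power_less_imp_less_base)
    then show "\<zeta> \<in> ?B" by (simp add: dist_norm norm_minus_commute)
  qed
  have seg: "closed_segment a a2 \<subseteq> cbox a a3 - {w}" "closed_segment a2 a3 \<subseteq> cbox a a3 - {w}"
    "closed_segment a3 a4 \<subseteq> cbox a a3 - {w}" "closed_segment a4 a \<subseteq> cbox a a3 - {w}"
    using \<delta> w
    by (auto simp: a_def a2_def a3_def a4_def closed_segment_same_Re closed_segment_same_Im in_cbox_complex_iff closed_segment_eq_real_ivl)
  have cont: "continuous_on (cbox a a3 - {w}) ?f"
    by (intro continuous_intros continuous_on_subset[OF holomorphic_on_imp_continuous_on[OF G]]) (use cell in auto)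
  have c: "continuous_on (closed_segment a a2) ?f" "continuous_on (closed_segment a2 a3) ?f"
    "continuous_on (closed_segment a3 a4) ?f" "continuous_on (closed_segment a4 a) ?f"
    using seg continuous_on_subset[OF cont] by blast+
  note ci = contour_integrable_continuous_linepath[OF c(1)] contour_integrable_continuous_linepath[OF c(2)]
    contour_integrable_continuous_linepath[OF c(3)] contour_integrable_continuous_linepath[OF c(4)]
  have rp: "rectpath a a3 = linepath a a2 +++ linepath a2 a3 +++ linepath a3 a4 +++ linepath a4 a"
    by (simp add: rectpath_def Let_def a_def a2_def a3_def a4_def)
  have "contour_integral (rectpath a a3) ?f = contour_integral (linepath a a2) ?f + (contour_integral (linepath a2 a3) ?f
      + (contour_integral (linepath a3 a4) ?f + contour_integral (linepath a4 a) ?f))"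
    unfolding rp using ci by simp
  also have "contour_integral (linepath a3 a4) ?f = - contour_integral (linepath a4 a3) ?f"
    by (rule contour_integral_reverse_linepath[OF c(3)])
  also have "contour_integral (linepath a4 a) ?f = - contour_integral (linepath a a4) ?f"
    by (rule contour_integral_reverse_linepath[OF c(4)])
  finally have eq: "contour_integral (rectpath a a3) ?f = contour_integral (linepath a a2) ?f + contour_integral (linepath a2 a3) ?f
      - contour_integral (linepath a4 a3) ?f - contour_integral (linepath a a4) ?f" by simp
  have "path_image (rectpath a a3) \<subseteq> cbox a a3 - {w}"
    unfolding rp using seg by (auto simp: path_image_join)
  then have pi: "path_image (rectpath a a3) \<subseteq> ?B - {w}" using cell by blast
  have box: "w \<in> box a a3 \<longleftrightarrow> x < Re w \<and> Re w < x + \<delta> \<and> y < Im w \<and> Im w < y + \<delta>"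
    by (auto simp: in_box_complex_iff a_def a3_def)
  have cbox: "w \<in> box a a3" if "w \<in> cbox a a3" using that w by (auto simp: in_box_complex_iff in_cbox_complex_iff a_def a3_def)
  have wind: "winding_number (rectpath a a3) w = (if w \<in> box a a3 then 1 else 0)"
    using winding_number_rectpath[of w a a3] winding_number_rectpath_outside[of a a3 w] cbox \<delta>
    by (auto simp: a_def a3_def)
  have "contour_integral (rectpath a a3) ?f = (if w \<in> box a a3 then 2 * pi * \<i> * G w else 0)"
  proof (cases "w \<in> ?B")
    case True
    have "(?f has_contour_integral (2 * pi * \<i> * winding_number (rectpath a a3) w * G w)) (rectpath a a3)"
      using Cauchy_integral_formula_convex_simple[OF convex_ball G, of w "rectpath a a3"] True pi by (simp add: interior_open)
    then show ?thesis using wind by (simp add: contour_integral_unique)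
  next
    case False
    then have "w \<notin> box a a3" using cell box_subset_cbox[of a a3] by blast
    moreover have "(?f has_contour_integral 0) (rectpath a a3)"
    proof (rule Cauchy_theorem_convex_simple[of _ ?B])
      show "?f holomorphic_on ?B" by (intro holomorphic_intros G) (use False in auto)
    qed (use pi in auto)
    ultimately show ?thesis by (simp add: contour_integral_unique)
  qed
  then show ?thesis unfolding eq box .
qed

lemma Abel_summation:
  fixes s v :: "nat \<Rightarrow> 'a::comm_ring"
  shows "(\<Sum>k<n. s k * (v k - v (Suc k))) = (\<Sum>k<n. (s (Suc k) - s k) * v (Suc k)) + s 0 * v 0 - s n * v n"
  by (induction n) (simp_all add: algebra_simps)

lemma off_lattice_right:
  assumes "\<delta> > 0"
  shows "\<forall>\<^sub>F \<eta> in at_right (0::real). \<forall>i::int. x + \<eta> \<noteq> of_int i * \<delta>"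
proof -
  define n where "n = \<lfloor>x / \<delta>\<rfloor>"
  have n: "of_int n * \<delta> \<le> x" "x < (of_int n + 1) * \<delta>"
    using assms floor_correct[of "x / \<delta>"] unfolding n_def
    by (simp_all add: pos_le_divide_eq[symmetric] pos_divide_less_eq[symmetric])
  show ?thesis
  proof (rule eventually_at_rightI[of 0 "(of_int n + 1) * \<delta> - x"])
    fix \<eta> assume \<eta>: "\<eta> \<in> {0<..<(of_int n + 1) * \<delta> - x}"
    show "\<forall>i::int. x + \<eta> \<noteq> of_int i * \<delta>"
    proof (intro allI notI)
      fix i :: int assume i: "x + \<eta> = of_int i * \<delta>"
      have "of_int n * \<delta> < of_int i * \<delta>" "of_int i * \<delta> < (of_int n + 1) * \<delta>" using i n \<eta> by auto
      then have "of_int n < (of_int i :: real)" "of_int i < (of_int (n + 1) :: real)" using assms by simp_all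
      then have "n < i" "i < n + 1" by (simp_all only: of_int_less_iff)
      then show False by simp
    qed
  qed (use n in auto)
qed

context koenigs_functional
begin

lemma Cauchy_segment_bound:
  assumes G: "continuous_on (closed_segment P Q) G" and d: "d > 0"
    and far: "\<And>\<zeta>. \<zeta> \<in> closed_segment P Q \<Longrightarrow> d \<le> cmod (\<zeta> - w)"
    and B: "\<And>\<zeta>. \<zeta> \<in> closed_segment P Q \<Longrightarrow> cmod (G \<zeta>) \<le> B"
  shows "cmod (contour_integral (linepath P Q) (\<lambda>\<zeta>. G \<zeta> / (\<zeta> - w))) \<le> B / d * cmod (Q - P)"
proof (rule contour_integral_bound_linepath)
  have "B \<ge> 0" using B[of P] by (auto intro: order_trans[OF norm_ge_zero])
  then show "0 \<le> B / d" using d by simp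
  show "(\<lambda>\<zeta>. G \<zeta> / (\<zeta> - w)) contour_integrable_on linepath P Q"
    by (intro contour_integrable_continuous_linepath continuous_intros G) (use far d in fastforce)
  show "cmod (G \<zeta> / (\<zeta> - w)) \<le> B / d" if "\<zeta> \<in> closed_segment P Q" for \<zeta>
    unfolding norm_divide using far[OF that] B[OF that] d order_trans[OF norm_ge_zero B[OF that]] by (intro frac_le) auto
qed

text \<open>A Cauchy integral over a segment is an average of functions \<open>1 / (h - a)\<close> with \<open>a\<close> on the segment.\<close>
lemma Cauchy_segment_zero:
  assumes G: "continuous_on (closed_segment P Q) G" and d: "d > 0"
    and far: "\<And>\<zeta> w. \<zeta> \<in> closed_segment P Q \<Longrightarrow> w \<in> \<Omega> \<Longrightarrow> d \<le> cmod (\<zeta> - w)"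
  shows "bounded_holomorphic (\<lambda>z. contour_integral (linepath P Q) (\<lambda>\<zeta>. G \<zeta> / (\<zeta> - h z)))"
    and "\<Lambda> (\<lambda>z. contour_integral (linepath P Q) (\<lambda>\<zeta>. G \<zeta> / (\<zeta> - h z))) = 0"
proof -
  define l where "l = linepath P Q"
  define \<gamma> where "\<gamma> = (\<lambda>s. G (l s))"
  define k where "k = (\<lambda>s z. \<gamma> s / (l s - h z) * (Q - P))"
  have eq: "contour_integral (linepath P Q) (\<lambda>\<zeta>. G \<zeta> / (\<zeta> - h z)) = integral {0..1} (\<lambda>s. k s z)" for z
    unfolding contour_integral_integral k_def \<gamma>_def l_def by (simp add: vector_derivative_linepath_at)
  have l: "l s \<in> closed_segment P Q" if "s \<in> {0..1}" for s
    using that unfolding l_def by (metis imageI linepath_image_01)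
  have res: "bounded_holomorphic (\<lambda>z. 1 / (h z - l s))" "\<Lambda> (\<lambda>z. 1 / (h z - l s)) = 0" if s: "s \<in> {0..1}" for s
  proof -
    show "bounded_holomorphic (\<lambda>z. 1 / (h z - l s))"
      by (rule bounded_holomorphic_resolvent[OF d]) (use far[OF l[OF s]] in \<open>simp add: norm_minus_commute\<close>)
    have "l s \<notin> closure \<Omega>"
    proof
      assume "l s \<in> closure \<Omega>"
      then obtain w where "w \<in> \<Omega>" "dist w (l s) < d" using d unfolding closure_approachable by blast
      then show False using far[OF l[OF s], of w] by (simp add: dist_norm norm_minus_commute)
    qed
    then show "\<Lambda> (\<lambda>z. 1 / (h z - l s)) = 0" by (rule resolvent_zero)
  qed
  have k_eq: "k s = (\<lambda>z. - (\<gamma> s * (Q - P)) * (1 / (h z - l s)))" for s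
  proof
    fix z
    have "l s - h z = - (h z - l s)" by simp
    then show "k s z = - (\<gamma> s * (Q - P)) * (1 / (h z - l s))" unfolding k_def by (simp only: divide_minus_right) simp
  qed
  have contG: "continuous_on {0..1} \<gamma>"
    unfolding \<gamma>_def by (rule continuous_on_compose2[OF G]) (use l in \<open>auto simp: l_def intro!: continuous_intros\<close>)
  then have uG: "uniformly_continuous_on {0..1} \<gamma>" by (simp add: compact_uniformly_continuous)
  have "bounded (\<gamma> ` {0..1})" by (intro compact_imp_bounded compact_continuous_image contG) auto
  then obtain B where B: "B > 0" "\<And>s. s \<in> {0..1} \<Longrightarrow> cmod (\<gamma> s) \<le> B" unfolding bounded_pos by auto
  have uc: "\<exists>\<delta>>0. \<forall>s\<in>{0..1}. \<forall>t\<in>{0..1}. \<bar>s - t\<bar> < \<delta> \<longrightarrow> (\<forall>z\<in>unit_disc. cmod (k s z - k t z) \<le> \<epsilon>)"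
    if \<epsilon>: "\<epsilon> > 0" for \<epsilon>
  proof -
    define q where "q = cmod (Q - P) + 1"
    have q: "q > 0" "cmod (Q - P) \<le> q" by (auto simp: q_def add_nonneg_pos)
    obtain \<delta>1 where \<delta>1: "\<delta>1 > 0" "\<And>s t. s \<in> {0..1} \<Longrightarrow> t \<in> {0..1} \<Longrightarrow> \<bar>s - t\<bar> < \<delta>1 \<Longrightarrow> cmod (\<gamma> s - \<gamma> t) < \<epsilon> * d / (2 * q)"
    proof -
      have "\<epsilon> * d / (2 * q) > 0" using \<epsilon> d q by simp
      then show ?thesis using uG that unfolding uniformly_continuous_on_def dist_norm
        by (metis norm_minus_commute real_norm_def)
    qed
    define \<delta> where "\<delta> = min \<delta>1 (\<epsilon> * d\<^sup>2 / (2 * B * q\<^sup>2))"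
    have "\<delta> > 0" using \<delta>1 \<epsilon> d q B by (simp add: \<delta>_def)
    moreover have "cmod (k s z - k t z) \<le> \<epsilon>" if st: "s \<in> {0..1}" "t \<in> {0..1}" "\<bar>s - t\<bar> < \<delta>" and z: "z \<in> unit_disc" for s t z
    proof -
      have f1: "d \<le> cmod (l s - h z)" and f2: "d \<le> cmod (l t - h z)" using far l st h_in[OF z] by auto
      then have nz: "l s - h z \<noteq> 0" "l t - h z \<noteq> 0" using d by auto
      have "k s z - k t z = (Q - P) * ((\<gamma> s - \<gamma> t) / (l s - h z) + \<gamma> t * (l t - l s) / ((l s - h z) * (l t - h z)))"
        unfolding k_def using nz by (simp add: divide_simps) (simp add: algebra_simps)
      then have "cmod (k s z - k t z) \<le> cmod (Q - P) * (cmod (\<gamma> s - \<gamma> t) / cmod (l s - h z) + cmod (\<gamma> t) * cmod (l t - l s) / (cmod (l s - h z) * cmod (l t - h z)))"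
        by (simp only: norm_mult, intro mult_left_mono)
           (rule order_trans[OF norm_triangle_ineq], simp_all add: norm_mult norm_divide)
      also have "\<dots> \<le> q * ((\<epsilon> * d / (2 * q)) / d + B * (\<delta> * q) / (d * d))"
      proof (intro mult_mono add_mono frac_le)
        show "cmod (\<gamma> s - \<gamma> t) \<le> \<epsilon> * d / (2 * q)" using \<delta>1(2)[of s t] st by (simp add: \<delta>_def)
        show "cmod (\<gamma> t) \<le> B" using B st by auto
        have "l t - l s = of_real (t - s) * (Q - P)"
          by (simp add: l_def linepath_def scaleR_conv_of_real algebra_simps)
        then have "cmod (l t - l s) = \<bar>t - s\<bar> * cmod (Q - P)" by (simp only: norm_mult norm_of_real)
        also have "\<dots> \<le> \<delta> * q" using st q by (intro mult_mono) auto
        finally show "cmod (l t - l s) \<le> \<delta> * q" .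
      qed (use q f1 f2 d B \<epsilon> \<open>\<delta> > 0\<close> in \<open>auto intro!: add_nonneg_nonneg\<close>)
      also have "\<dots> = \<epsilon> / 2 + \<delta> * (B * q\<^sup>2 / d\<^sup>2)" using q d by (simp add: field_simps power2_eq_square)
      also have "\<delta> * (B * q\<^sup>2 / d\<^sup>2) \<le> (\<epsilon> * d\<^sup>2 / (2 * B * q\<^sup>2)) * (B * q\<^sup>2 / d\<^sup>2)"
        using B by (intro mult_right_mono) (auto simp: \<delta>_def)
      also have "\<dots> = \<epsilon> / 2" using B q d by (simp add: field_simps)
      finally show ?thesis by simp
    qed
    ultimately show ?thesis by blast
  qed
  have kbh: "bounded_holomorphic (k s)" if "s \<in> {0..1}" for s
    unfolding k_eq by (rule bounded_holomorphic_cmult[OF res(1)[OF that]])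
  have k0: "\<Lambda> (k s) = 0" if "s \<in> {0..1}" for s
    unfolding k_eq by (simp only: \<Lambda>_cmult[OF res(1)[OF that]] res(2)[OF that] mult_zero_right)
  show "bounded_holomorphic (\<lambda>z. contour_integral (linepath P Q) (\<lambda>\<zeta>. G \<zeta> / (\<zeta> - h z)))"
    "\<Lambda> (\<lambda>z. contour_integral (linepath P Q) (\<lambda>\<zeta>. G \<zeta> / (\<zeta> - h z))) = 0"
    unfolding eq using \<Lambda>_integral_eq_0[of k, OF kbh k0 uc] by simp_all
qed

text \<open>The square of \<open>h - \<i> R\<close> in the denominator makes the Cauchy integrals below converge at infinity. The
  plane is cut into squares of side \<open>\<delta>\<close>; those whose centre is near \<open>\<Omega>\<close> lie in the neighbourhood where \<open>G\<close> is
  holomorphic, the others stay at distance at least \<open>\<delta>\<close> from \<open>\<Omega>\<close>. Summing Cauchy's formula over the near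
  squares reproduces \<open>2 \<pi> \<i> G\<close>, and every edge between two near squares cancels. The remaining edges
  separate a near square from another one, so they avoid \<open>\<Omega>\<close> and \<open>G\<close> is holomorphic on them: their Cauchy integrals
  are annihilated. Only vertical edges at the two ends of a finite sum can meet \<open>\<Omega>\<close>; their contribution at
  a fixed point tends to 0, while the sums over the other edges converge uniformly.\<close>
lemma Runge_weighted:
  assumes \<epsilon>: "\<epsilon> > 0" and F: "F holomorphic_on thickening \<epsilon> \<Omega>"
    and FB: "\<And>w. w \<in> thickening \<epsilon> \<Omega> \<Longrightarrow> cmod (F w) \<le> B" and R: "R > b + \<epsilon>"
  shows "\<Lambda> (\<lambda>z. F (h z) / (h z - \<i> * of_real R)\<^sup>2) = 0"
proof -
  define \<delta> where "\<delta> = \<epsilon> / 3"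
  have \<delta>: "\<delta> > 0" "\<epsilon> = 3 * \<delta>" using \<epsilon> by (auto simp: \<delta>_def)
  define N where "N = thickening \<epsilon> \<Omega>"
  define G where "G = (\<lambda>\<zeta>. F \<zeta> / (\<zeta> - \<i> * of_real R)\<^sup>2)"
  define \<eta> where "\<eta> = R - (b + \<epsilon>)"
  have \<eta>: "\<eta> > 0" using R by (simp add: \<eta>_def)
  have B0: "B \<ge> 0" using FB[of "h 0"] subset_thickening[OF \<epsilon>, of \<Omega>] h_in[of 0]
    by (metis centre_in_ball norm_ge_zero order_trans subsetD zero_less_one)
  have dR: "\<eta> \<le> cmod (\<zeta> - \<i> * of_real R)" if "\<zeta> \<in> N" for \<zeta>
    using thickening_strip[of \<zeta> \<epsilon>] that abs_Im_le_cmod[of "\<zeta> - \<i> * of_real R"] by (simp add: N_def \<eta>_def)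
  have dRe: "\<bar>Re \<zeta>\<bar> \<le> cmod (\<zeta> - \<i> * of_real R)" for \<zeta>
    using abs_Re_le_cmod[of "\<zeta> - \<i> * of_real R"] by simp
  have Ghol: "G holomorphic_on N"
    unfolding G_def using F dR \<eta> by (intro holomorphic_intros) (force simp: N_def)+
  define BG where "BG = B / \<eta>\<^sup>2"
  have GB: "cmod (G \<zeta>) \<le> BG" if "\<zeta> \<in> N" for \<zeta>
    unfolding G_def BG_def norm_divide norm_power
    using FB[of \<zeta>] that dR[OF that] \<eta> B0 by (intro frac_le power_mono) (auto simp: N_def)
  \<comment> \<open>On the column between the abscissae \<open>k \<delta>\<close> and \<open>(k + 1) \<delta>\<close>, or its mirror image, \<open>|\<zeta> - \<i> R| \<ge> \<mu> (k + 1)\<close>; so \<open>G\<close> decays quadratically\<close>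
  define \<mu> where "\<mu> = min \<delta> \<eta> / 2"
  have \<mu>: "\<mu> > 0" using \<delta> \<eta> by (simp add: \<mu>_def)
  have GB2: "cmod (G \<zeta>) \<le> B / (\<mu> * (real k + 1))\<^sup>2" if \<zeta>: "\<zeta> \<in> N" "real k * \<delta> \<le> \<bar>Re \<zeta>\<bar>" for \<zeta> k
  proof -
    have "2 * \<mu> * real k \<le> \<delta> * real k" by (intro mult_right_mono) (auto simp: \<mu>_def)
    moreover have "2 * \<mu> \<le> \<eta>" by (auto simp: \<mu>_def)
    ultimately have "2 * (\<mu> * (real k + 1)) \<le> real k * \<delta> + \<eta>" by (simp add: algebra_simps)
    also have "\<dots> \<le> 2 * cmod (\<zeta> - \<i> * of_real R)" using dRe[of \<zeta>] dR[OF \<zeta>(1)] \<zeta>(2) by linarith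
    finally have "\<mu> * (real k + 1) \<le> cmod (\<zeta> - \<i> * of_real R)" by simp
    then show ?thesis unfolding G_def norm_divide norm_power
      using FB[of \<zeta>] \<zeta> \<mu> B0 by (intro frac_le power_mono) (auto simp: N_def)
  qed
  \<comment> \<open>\<open>P i j\<close> is the lower left corner of a square, \<open>c i j\<close> its centre, and \<open>s\<close> the indicator of the near squares\<close>
  define P where "P = (\<lambda>i j. Complex (of_int i * \<delta>) (of_int j * \<delta>))"
  define c where "c = (\<lambda>i j. Complex (of_int i * \<delta> + \<delta> / 2) (of_int j * \<delta> + \<delta> / 2))"
  define near where "near = (\<lambda>i j. \<exists>w\<in>\<Omega>. dist w (c i j) < 2 * \<delta>)"
  define s where "s = (\<lambda>i j. if near i j then 1 else 0 :: complex)"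
  have P1: "P (i + 1) j = Complex (of_int i * \<delta> + \<delta>) (of_int j * \<delta>)"
    "P i (j + 1) = Complex (of_int i * \<delta>) (of_int j * \<delta> + \<delta>)"
    "P (i + 1) (j + 1) = Complex (of_int i * \<delta> + \<delta>) (of_int j * \<delta> + \<delta>)" for i j
    by (simp_all add: P_def algebra_simps)
  have cell_c: "dist (c i j) \<zeta> < \<delta>" if "\<zeta> \<in> cbox (P i j) (P (i + 1) (j + 1))" for i j \<zeta>
  proof -
    have r: "\<bar>Re \<zeta> - Re (c i j)\<bar> \<le> \<delta> / 2" "\<bar>Im \<zeta> - Im (c i j)\<bar> \<le> \<delta> / 2"
      using that unfolding P1 in_cbox_complex_iff P_def c_def complex.sel abs_le_iff by (simp_all add: field_simps)
    have "(Re \<zeta> - Re (c i j))\<^sup>2 \<le> (\<delta> / 2)\<^sup>2" "(Im \<zeta> - Im (c i j))\<^sup>2 \<le> (\<delta> / 2)\<^sup>2"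
      using r by (metis abs_ge_zero power2_abs power_mono)+
    then have "(cmod (\<zeta> - c i j))\<^sup>2 \<le> \<delta>\<^sup>2 / 2" unfolding cmod_power2 by (simp add: power_divide)
    also have "\<dots> < \<delta>\<^sup>2" using \<delta> by simp
    finally show ?thesis using \<delta> by (simp add: power_less_imp_less_base dist_norm norm_minus_commute)
  qed
  have near_N: "ball (c i j) \<delta> \<subseteq> N" if nr: "near i j" for i j
  proof
    fix \<zeta> assume "\<zeta> \<in> ball (c i j) \<delta>"
    moreover obtain w where w: "w \<in> \<Omega>" "dist w (c i j) < 2 * \<delta>" using nr by (auto simp: near_def)
    ultimately have "dist w \<zeta> < \<epsilon>" using dist_triangle[of w \<zeta> "c i j"] \<delta>(2) by (simp add: dist_commute)
    then show "\<zeta> \<in> N" using w by (auto simp: N_def thickening_def)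
  qed
  have cell_N: "\<zeta> \<in> N" if "near i j" "\<zeta> \<in> cbox (P i j) (P (i + 1) (j + 1))" for i j \<zeta>
    using near_N[OF that(1)] cell_c[OF that(2)] by auto
  have cell_far: "\<delta> \<le> cmod (\<zeta> - w)" if "\<not> near i j" "\<zeta> \<in> cbox (P i j) (P (i + 1) (j + 1))" "w \<in> \<Omega>" for i j \<zeta> w
  proof -
    have "2 * \<delta> \<le> dist w (c i j)" using that by (force simp: near_def not_less)
    then show ?thesis using cell_c[OF that(2)] dist_triangle[of w "c i j" \<zeta>] by (simp add: dist_commute dist_norm)
  qed
  \<comment> \<open>\<open>H i j\<close> and \<open>V i j\<close> are the Cauchy integrals over the lower and the left edge of a square\<close>
  define I where "I = (\<lambda>P Q w. contour_integral (linepath P Q) (\<lambda>\<zeta>. G \<zeta> / (\<zeta> - w)))"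
  define H where "H = (\<lambda>i j. I (P i j) (P (i + 1) j))"
  define V where "V = (\<lambda>i j. I (P i j) (P i (j + 1)))"
  have seg_H: "closed_segment (P i j) (P (i + 1) j) \<subseteq> cbox (P i j) (P (i + 1) (j + 1))"
    "closed_segment (P i (j + 1)) (P (i + 1) (j + 1)) \<subseteq> cbox (P i j) (P (i + 1) (j + 1))"
    "closed_segment (P i j) (P i (j + 1)) \<subseteq> cbox (P i j) (P (i + 1) (j + 1))"
    "closed_segment (P (i + 1) j) (P (i + 1) (j + 1)) \<subseteq> cbox (P i j) (P (i + 1) (j + 1))" for i j
  proof -
    have "P i j \<in> cbox (P i j) (P (i + 1) (j + 1))" "P (i + 1) j \<in> cbox (P i j) (P (i + 1) (j + 1))"
      "P i (j + 1) \<in> cbox (P i j) (P (i + 1) (j + 1))" "P (i + 1) (j + 1) \<in> cbox (P i j) (P (i + 1) (j + 1))"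
      using \<delta>(1) by (simp_all add: P_def in_cbox_complex_iff ring_distribs)
    then show "closed_segment (P i j) (P (i + 1) j) \<subseteq> cbox (P i j) (P (i + 1) (j + 1))"
      "closed_segment (P i (j + 1)) (P (i + 1) (j + 1)) \<subseteq> cbox (P i j) (P (i + 1) (j + 1))"
      "closed_segment (P i j) (P i (j + 1)) \<subseteq> cbox (P i j) (P (i + 1) (j + 1))"
      "closed_segment (P (i + 1) j) (P (i + 1) (j + 1)) \<subseteq> cbox (P i j) (P (i + 1) (j + 1))"
      by (simp_all add: closed_segment_subset convex_box)
  qed
  have len: "cmod (P (i + 1) j - P i j) = \<delta>" "cmod (P i (j + 1) - P i j) = \<delta>" for i j
    using \<delta>(1) by (simp_all add: P_def cmod_def ring_distribs)
  have Re_cell: "of_int i * \<delta> \<le> Re \<zeta> \<and> Re \<zeta> \<le> (of_int i + 1) * \<delta>" if "\<zeta> \<in> cbox (P i j) (P (i + 1) (j + 1))" for i j \<zeta>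
    using that unfolding P1 in_cbox_complex_iff P_def by (simp add: algebra_simps)
  \<comment> \<open>All near squares lie in the rows \<open>-J, \<dots>, J - 1\<close>\<close>
  obtain J :: nat where J: "real J * \<delta> > b + 3 * \<delta>"
    using reals_Archimedean3[OF \<delta>(1)] by blast
  have near_Im: "\<bar>of_int j * \<delta> + \<delta> / 2\<bar> < b + 2 * \<delta>" if nr: "near i j" for i j
  proof -
    obtain w where w: "w \<in> \<Omega>" "dist w (c i j) < 2 * \<delta>" using nr by (auto simp: near_def)
    have "\<bar>Im w - Im (c i j)\<bar> < 2 * \<delta>" using abs_Im_le_cmod[of "w - c i j"] w by (simp add: dist_norm)
    then show ?thesis using strip[OF w(1)] by (simp add: c_def)
  qed
  have far_top: "\<not> near i (int J)" for i
    using near_Im[of i "int J"] J \<delta> by auto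
  have far_bot: "\<not> near i (- int J)" for i
    using near_Im[of i "- int J"] J \<delta> by auto
  \<comment> \<open>Edges on which \<open>s\<close> jumps separate a near square from another one\<close>
  define good where "good = (\<lambda>P Q. closed_segment P Q \<subseteq> N \<and> (\<forall>\<zeta>\<in>closed_segment P Q. \<forall>w\<in>\<Omega>. \<delta> \<le> cmod (\<zeta> - w)))"
  have good_H: "good (P i (j + 1)) (P (i + 1) (j + 1))" if "s i (j + 1) \<noteq> s i j" for i j
  proof -
    have "near i (j + 1) \<noteq> near i j" using that by (auto simp: s_def split: if_splits)
    then show ?thesis unfolding good_def
      using seg_H(1)[of i "j + 1"] seg_H(2)[of i j] cell_N[of i j] cell_N[of i "j + 1"] cell_far[of i j] cell_far[of i "j + 1"] by blast
  qed
  have good_V: "good (P (i + 1) j) (P (i + 1) (j + 1))" if "s (i + 1) j \<noteq> s i j" for i j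
  proof -
    have "near (i + 1) j \<noteq> near i j" using that by (auto simp: s_def split: if_splits)
    then show ?thesis unfolding good_def
      using seg_H(3)[of "i + 1" j] seg_H(4)[of i j] cell_N[of i j] cell_N[of "i + 1" j] cell_far[of i j] cell_far[of "i + 1" j] by blast
  qed
  have contG: "continuous_on N G" by (rule holomorphic_on_imp_continuous_on[OF Ghol])
  have good_zero: "bounded_holomorphic (\<lambda>z. I P Q (h z))" "\<Lambda> (\<lambda>z. I P Q (h z)) = 0" if "good P Q" for P Q
    unfolding I_def using that \<delta>(1) unfolding good_def
    by (auto intro!: Cauchy_segment_zero[of P Q G \<delta>] continuous_on_subset[OF contG])
  have good_bound: "cmod (I P Q w) \<le> K / \<delta> * cmod (Q - P)"
    if "good P Q" "w \<in> \<Omega>" "\<And>\<zeta>. \<zeta> \<in> closed_segment P Q \<Longrightarrow> cmod (G \<zeta>) \<le> K" for P Q w K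
    unfolding I_def using that \<delta>(1) unfolding good_def
    by (intro Cauchy_segment_bound continuous_on_subset[OF contG]) auto
  define jj where "jj = (\<lambda>k::nat. int k - int J)"
  have jj_Suc: "jj (Suc k) = jj k + 1" for k by (simp add: jj_def)
  \<comment> \<open>For column \<open>i\<close>: \<open>q\<close> sums Cauchy integrals over the boundaries of near squares, \<open>col\<close> collects the edges on which
    \<open>s\<close> jumps, and \<open>D\<close> the left edges of near squares. Summation by parts gives \<open>q_eq\<close>, and \<open>D\<close> telescopes over the columns\<close>
  define q where "q = (\<lambda>i w. \<Sum>k<2*J. s i (jj k) * (H i (jj k) w + V (i + 1) (jj k) w - H i (jj k + 1) w - V i (jj k) w))"
  define col where "col = (\<lambda>i w. \<Sum>k<2*J. (s i (jj k + 1) - s i (jj k)) * H i (jj k + 1) w - (s (i + 1) (jj k) - s i (jj k)) * V (i + 1) (jj k) w)"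
  define D where "D = (\<lambda>i w. \<Sum>k<2*J. s i (jj k) * V i (jj k) w)"
  have q_eq: "q i w = D (i + 1) w - D i w + col i w" for i w
  proof -
    have "(\<Sum>k<2*J. s i (jj k) * (H i (jj k) w - H i (jj (Suc k)) w))
        = (\<Sum>k<2*J. (s i (jj (Suc k)) - s i (jj k)) * H i (jj (Suc k)) w) + s i (jj 0) * H i (jj 0) w - s i (jj (2*J)) * H i (jj (2*J)) w"
      by (rule Abel_summation[of "\<lambda>k. s i (jj k)" "\<lambda>k. H i (jj k) w"])
    moreover have "s i (jj 0) = 0" "s i (jj (2*J)) = 0" using far_top far_bot by (simp_all add: s_def jj_def)
    ultimately have A: "(\<Sum>k<2*J. s i (jj k) * (H i (jj k) w - H i (jj k + 1) w))
        = (\<Sum>k<2*J. (s i (jj k + 1) - s i (jj k)) * H i (jj k + 1) w)" by (simp add: jj_Suc)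
    have "q i w = (\<Sum>k<2*J. s i (jj k) * (H i (jj k) w - H i (jj k + 1) w)) + (\<Sum>k<2*J. s i (jj k) * (V (i + 1) (jj k) w - V i (jj k) w))"
      unfolding q_def sum.distrib[symmetric] by (intro sum.cong) (auto simp: algebra_simps)
    also have "\<dots> = D (i + 1) w - D i w + col i w"
      unfolding A D_def col_def sum.distrib[symmetric] sum_subtractf[symmetric] by (intro sum.cong) (auto simp: algebra_simps)
    finally show ?thesis .
  qed
  define T where "T = (\<lambda>n w. \<Sum>k<n. col (int k) w + col (- int k - 1) w)"
  have tele: "(\<Sum>k<n. q (int k) w + q (- int k - 1) w) = D (int n) w - D (- int n) w + T n w" for n w
  proof (induction n)
    case (Suc n)
    have e: "int (Suc n) = int n + 1" "- int (Suc n) = - int n - 1" by simp_all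
    have e': "- int n - 1 + 1 = - int n" by simp
    have "(\<Sum>k<Suc n. q (int k) w + q (- int k - 1) w) = (D (int n) w - D (- int n) w + T n w) + (q (int n) w + q (- int n - 1) w)"
      using Suc by simp
    also have "\<dots> = D (int n + 1) w - D (- int n - 1) w + (T n w + (col (int n) w + col (- int n - 1) w))"
      unfolding q_eq e' by (simp only: algebra_simps)
    also have "T n w + (col (int n) w + col (- int n - 1) w) = T (Suc n) w" by (simp add: T_def)
    finally show ?case unfolding e(2) unfolding e(1) .
  qed (simp add: T_def)
  have T_zero: "bounded_holomorphic (\<lambda>z. T n (h z)) \<and> \<Lambda> (\<lambda>z. T n (h z)) = 0" for n
  proof -
    let ?Z = "\<lambda>f. bounded_holomorphic f \<and> \<Lambda> f = 0"
    have Zadd: "?Z (\<lambda>z. f z + g z)" if "?Z f" "?Z g" for f g using that by (simp add: \<Lambda>_add bounded_holomorphic_add)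
    have Zdiff: "?Z (\<lambda>z. f z - g z)" if "?Z f" "?Z g" for f g using that by (simp add: \<Lambda>_diff bounded_holomorphic_diff)
    have Zsum: "?Z (\<lambda>z. \<Sum>i\<in>A. f i z)" if "\<And>i. ?Z (f i)" "finite A" for f and A :: "nat set"
      using that by (simp add: \<Lambda>_sum bounded_holomorphic_sum)
    have Zc: "?Z (\<lambda>z. a * I P Q (h z))" if "a \<noteq> 0 \<Longrightarrow> good P Q" for a P Q
    proof (cases "a = 0")
      case True
      have "\<Lambda> (\<lambda>z. 0) = 0" using \<Lambda>_cmult[OF bounded_holomorphic_const, of 0 0] by simp
      then show ?thesis using True bounded_holomorphic_const[of 0] by simp
    next
      case False
      note g = good_zero[OF that[OF False]]
      show ?thesis using bounded_holomorphic_cmult[OF g(1), of a] \<Lambda>_cmult[OF g(1), of a] g(2) by simp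
    qed
    have Zcol: "?Z (\<lambda>z. col i (h z))" for i
      unfolding col_def H_def V_def
      by (intro Zsum Zdiff Zc) (use good_H good_V in auto)
    show ?thesis unfolding T_def by (intro Zsum Zadd Zcol) auto
  qed
  define M where "M = (\<lambda>k::nat. 2 * (real (2*J) * (2 * (B / (\<mu> * (real k + 1))\<^sup>2))))"
  have s_diff: "cmod (s i j - s i' j') \<le> 1" for i j i' j' by (simp add: s_def)
  have edge_bound: "cmod (a * I P Q w) \<le> K" if a: "cmod a \<le> 1" "a \<noteq> 0 \<Longrightarrow> good P Q" and w: "w \<in> \<Omega>" and len: "cmod (Q - P) = \<delta>"
     and GK: "\<And>\<zeta>. \<zeta> \<in> closed_segment P Q \<Longrightarrow> \<zeta> \<in> N \<Longrightarrow> cmod (G \<zeta>) \<le> K" and K: "K \<ge> 0" for a P Q w K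
  proof (cases "a = 0")
    case False
    then have g: "good P Q" by (rule a(2))
    have "cmod (I P Q w) \<le> K / \<delta> * cmod (Q - P)"
      by (rule good_bound[OF g w]) (use g GK in \<open>auto simp: good_def\<close>)
    then have "cmod (I P Q w) \<le> K" using len \<delta> by simp
    then have "cmod a * cmod (I P Q w) \<le> 1 * K" using a by (intro mult_mono) auto
    then show ?thesis by (simp add: norm_mult)
  qed (use K in simp)
  have col_bound: "cmod (col i w) \<le> real (2*J) * (2 * (B / (\<mu> * (real k + 1))\<^sup>2))"
    if w: "w \<in> \<Omega>" and i: "i = int k \<or> i = - int k - 1" for i k w
  proof -
    let ?K = "B / (\<mu> * (real k + 1))\<^sup>2"
    have GK: "cmod (G \<zeta>) \<le> ?K" if "\<zeta> \<in> cbox (P i j) (P (i + 1) (j + 1))" "\<zeta> \<in> N" for \<zeta> j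
    proof (rule GB2[OF that(2)])
      from Re_cell[OF that(1)] i show "real k * \<delta> \<le> \<bar>Re \<zeta>\<bar>"
      proof (elim disjE)
        assume "i = - int k - 1" and r: "of_int i * \<delta> \<le> Re \<zeta> \<and> Re \<zeta> \<le> (of_int i + 1) * \<delta>"
        then have "Re \<zeta> \<le> - (real k * \<delta>)" by simp
        then show ?thesis by linarith
      qed auto
    qed
    have K0: "?K \<ge> 0" using B0 by simp
    have "cmod (col i w) \<le> (\<Sum>k'<2*J. 2 * ?K)"
      unfolding col_def
    proof (intro sum_norm_le)
      fix k' assume "k' \<in> {..<2*J}"
      have "cmod ((s i (jj k' + 1) - s i (jj k')) * H i (jj k' + 1) w) \<le> ?K"
        unfolding H_def
        by (rule edge_bound[OF s_diff _ w len(1) _ K0]) (use good_H GK seg_H(2)[of i "jj k'"] in auto)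
      moreover have "cmod ((s (i + 1) (jj k') - s i (jj k')) * V (i + 1) (jj k') w) \<le> ?K"
        unfolding V_def
        by (rule edge_bound[OF s_diff _ w len(2) _ K0]) (use good_V GK seg_H(4)[of i "jj k'"] in auto)
      ultimately show "cmod ((s i (jj k' + 1) - s i (jj k')) * H i (jj k' + 1) w - (s (i + 1) (jj k') - s i (jj k')) * V (i + 1) (jj k') w) \<le> 2 * ?K"
        using norm_triangle_ineq4[of "(s i (jj k' + 1) - s i (jj k')) * H i (jj k' + 1) w" "(s (i + 1) (jj k') - s i (jj k')) * V (i + 1) (jj k') w"] by linarith
    qed
    then show ?thesis by simp
  qed
  have "summable (\<lambda>k. inverse ((real (Suc k))\<^sup>2))"
    using inverse_power_summable[of 2] by (subst summable_Suc_iff) simp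
  then have "summable (\<lambda>k. 2 * (real (2*J) * (2 * (B / \<mu>\<^sup>2))) * inverse ((real (Suc k))\<^sup>2))" by (rule summable_mult)
  moreover have "2 * (real (2*J) * (2 * (B / \<mu>\<^sup>2))) * inverse ((real (Suc k))\<^sup>2) = M k" for k
    by (simp add: M_def power_mult_distrib divide_inverse add.commute)
  ultimately have Msum: "summable M" by (simp only:)
  have ul: "uniform_limit \<Omega> T (\<lambda>w. \<Sum>k. col (int k) w + col (- int k - 1) w) sequentially"
    unfolding T_def
  proof (rule Weierstrass_m_test[OF _ Msum])
    show "cmod (col (int k) w + col (- int k - 1) w) \<le> M k" if "w \<in> \<Omega>" for k w
    proof -
      have "cmod (col (int k) w + col (- int k - 1) w) \<le> cmod (col (int k) w) + cmod (col (- int k - 1) w)"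
        by (rule norm_triangle_ineq)
      also have "\<dots> \<le> real (2*J) * (2 * (B / (\<mu> * (real k + 1))\<^sup>2)) + real (2*J) * (2 * (B / (\<mu> * (real k + 1))\<^sup>2))"
        by (intro add_mono col_bound[OF that]) auto
      finally show ?thesis unfolding M_def mult_2 .
    qed
  qed
  \<comment> \<open>Cauchy's formula needs \<open>w\<close> off the lattice lines; other points follow by continuity\<close>
  define off where "off = (\<lambda>w. (\<forall>i::int. Re w \<noteq> of_int i * \<delta>) \<and> (\<forall>j::int. Im w \<noteq> of_int j * \<delta>))"
  have lim_off: "(\<lambda>n. T n w) \<longlonglongrightarrow> 2 * pi * \<i> * G w" if w: "w \<in> \<Omega>" and off: "off w" for w
  proof -
    define i0 j0 where "i0 = \<lfloor>Re w / \<delta>\<rfloor>" and "j0 = \<lfloor>Im w / \<delta>\<rfloor>"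
    have cellw: "(of_int i * \<delta> < Re w \<and> Re w < of_int i * \<delta> + \<delta> \<and> of_int j * \<delta> < Im w \<and> Im w < of_int j * \<delta> + \<delta>) \<longleftrightarrow> i = i0 \<and> j = j0" for i j
    proof -
      have aux: "(of_int i * \<delta> < x \<and> x < of_int i * \<delta> + \<delta>) \<longleftrightarrow> i = \<lfloor>x / \<delta>\<rfloor>" if "\<forall>i::int. x \<noteq> of_int i * \<delta>" for x i
      proof -
        have "i = \<lfloor>x / \<delta>\<rfloor> \<longleftrightarrow> of_int i \<le> x / \<delta> \<and> x / \<delta> < of_int i + 1"
          unfolding eq_commute[of i] by (rule floor_eq_iff)
        also have "\<dots> \<longleftrightarrow> of_int i * \<delta> \<le> x \<and> x < of_int i * \<delta> + \<delta>"
          using \<delta>(1) by (simp add: pos_le_divide_eq pos_divide_less_eq ring_distribs)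
        also have "\<dots> \<longleftrightarrow> of_int i * \<delta> < x \<and> x < of_int i * \<delta> + \<delta>" using that[rule_format, of i] by auto
        finally show ?thesis by blast
      qed
      show ?thesis using aux[of "Re w" i] aux[of "Im w" j] off unfolding off_def i0_def j0_def by blast
    qed
    have w_cell: "w \<in> cbox (P i0 j0) (P (i0 + 1) (j0 + 1))"
      using cellw[of i0 j0] unfolding in_cbox_complex_iff P_def by (simp add: ring_distribs)
    have near0: "near i0 j0"
      unfolding near_def using w cell_c[OF w_cell] \<delta> by (intro bexI[of _ w]) (auto simp: dist_commute)
    have sq: "s i j * (H i j w + V (i + 1) j w - H i (j + 1) w - V i j w) = (if i = i0 \<and> j = j0 then 2 * pi * \<i> * G w else 0)" for i j
    proof (cases "near i j")
      case True
      have Gb: "G holomorphic_on ball (Complex (of_int i * \<delta> + \<delta> / 2) (of_int j * \<delta> + \<delta> / 2)) \<delta>"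
        using holomorphic_on_subset[OF Ghol near_N[OF True]] by (simp add: c_def)
      have "Re w \<noteq> of_int (i + 1) * \<delta>" "Im w \<noteq> of_int (j + 1) * \<delta>" using off unfolding off_def by blast+
      then have o: "Re w \<noteq> of_int i * \<delta>" "Re w \<noteq> of_int i * \<delta> + \<delta>" "Im w \<noteq> of_int j * \<delta>" "Im w \<noteq> of_int j * \<delta> + \<delta>"
        using off unfolding off_def by (auto simp: ring_distribs)
      have "H i j w + V (i + 1) j w - H i (j + 1) w - V i j w = (if i = i0 \<and> j = j0 then 2 * pi * \<i> * G w else 0)"
        unfolding H_def V_def I_def cellw[symmetric] P1(1)[of i j] P1(2)[of i j] P1(3)[of i j]
        unfolding P_def by (rule square_Cauchy[OF \<delta>(1) Gb o])
      then show ?thesis using True by (simp add: s_def)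
    next
      case False
      then show ?thesis using near0 by (auto simp: s_def)
    qed
    have j0: "j0 \<ge> - int J" "j0 < int J"
    proof -
      have "\<bar>of_int j0 * \<delta> + \<delta> / 2\<bar> < real J * \<delta> - \<delta>" using near_Im[OF near0] J by linarith
      then have "of_int j0 * \<delta> < real J * \<delta>" "- (real J * \<delta>) < of_int j0 * \<delta>"
        using \<delta>(1) unfolding abs_less_iff by linarith+
      then have "of_int j0 * \<delta> < of_int (int J) * \<delta>" "of_int (- int J) * \<delta> < of_int j0 * \<delta>"
        by (simp_all only: of_int_of_nat_eq of_int_minus mult_minus_left)
      then have "j0 < int J" "- int J < j0" by (simp_all only: mult_less_cancel_right_pos[OF \<delta>(1)] of_int_less_iff)
      then show "j0 \<ge> - int J" "j0 < int J" by linarith+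
    qed
    have q_val: "q i w = (if i = i0 then 2 * pi * \<i> * G w else 0)" for i
    proof -
      have "q i w = (\<Sum>k<2*J. if k = nat (j0 + int J) then (if i = i0 then 2 * pi * \<i> * G w else 0) else 0)"
        unfolding q_def sq using j0 by (intro sum.cong) (auto simp: jj_def)
      also have "\<dots> = (if i = i0 then 2 * pi * \<i> * G w else 0)"
        using j0 by (subst sum.delta) auto
      finally show ?thesis .
    qed
    have tele_val: "D (int n) w - D (- int n) w + T n w = 2 * pi * \<i> * G w" if n: "n > nat \<bar>i0\<bar>" for n
    proof -
      define m where "m = (if i0 \<ge> 0 then nat i0 else nat (- i0 - 1))"
      have m: "m < n" using n by (auto simp: m_def)
      have "(\<Sum>k<n. q (int k) w + q (- int k - 1) w) = (\<Sum>k<n. if k = m then 2 * pi * \<i> * G w else 0)"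
        unfolding q_val by (intro sum.cong) (auto simp: m_def)
      also have "\<dots> = 2 * pi * \<i> * G w" using m by simp
      finally show ?thesis using tele by simp
    qed
    have D_bound: "cmod (D i w) \<le> real (2*J) * (BG / \<bar>of_int i * \<delta> - Re w\<bar> * \<delta>)" for i
    proof -
      have pos: "\<bar>of_int i * \<delta> - Re w\<bar> > 0" using off[unfolded off_def] by (metis eq_iff_diff_eq_0 zero_less_abs_iff)
      have BG0: "BG \<ge> 0" using B0 by (simp add: BG_def)
      have "cmod (D i w) \<le> (\<Sum>k<2*J. BG / \<bar>of_int i * \<delta> - Re w\<bar> * \<delta>)"
        unfolding D_def
      proof (intro sum_norm_le)
        fix k assume "k \<in> {..<2*J}"
        let ?j = "jj k"
        show "cmod (s i ?j * V i ?j w) \<le> BG / \<bar>of_int i * \<delta> - Re w\<bar> * \<delta>"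
        proof (cases "near i ?j")
          case True
          have segN: "closed_segment (P i ?j) (P i (?j + 1)) \<subseteq> N" using seg_H(3)[of i ?j] cell_N[OF True] by blast
          have "cmod (V i ?j w) \<le> BG / \<bar>of_int i * \<delta> - Re w\<bar> * cmod (P i (?j + 1) - P i ?j)"
            unfolding V_def I_def
          proof (rule Cauchy_segment_bound[OF continuous_on_subset[OF contG segN] pos])
            fix \<zeta> assume \<zeta>: "\<zeta> \<in> closed_segment (P i ?j) (P i (?j + 1))"
            then have "Re \<zeta> = of_int i * \<delta>" by (auto simp: closed_segment_same_Re P_def)
            then show "\<bar>of_int i * \<delta> - Re w\<bar> \<le> cmod (\<zeta> - w)" using abs_Re_le_cmod[of "\<zeta> - w"] by simp
            show "cmod (G \<zeta>) \<le> BG" using GB segN \<zeta> by blast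
          qed
          then show ?thesis using True len by (simp add: s_def)
        qed (use BG0 \<delta> in \<open>simp add: s_def\<close>)
      qed
      then show ?thesis by simp
    qed
    have lim0: "(\<lambda>n. real (2*J) * (BG / \<bar>a * (real n * \<delta>) - Re w\<bar> * \<delta>)) \<longlonglongrightarrow> 0" if a: "a = 1 \<or> a = -1" for a
    proof -
      have "filterlim (\<lambda>n. real n * \<delta> - \<bar>Re w\<bar>) at_top sequentially"
        using filterlim_tendsto_add_at_top[OF tendsto_const[of "- \<bar>Re w\<bar>"] filterlim_at_top_mult_tendsto_pos[OF tendsto_const \<delta>(1) filterlim_real_sequentially]]
        by simp
      then have "filterlim (\<lambda>n. \<bar>a * (real n * \<delta>) - Re w\<bar>) at_top sequentially"
        by (rule filterlim_at_top_mono) (use a in \<open>auto intro!: always_eventually\<close>)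
      then have "(\<lambda>n. BG / \<bar>a * (real n * \<delta>) - Re w\<bar>) \<longlonglongrightarrow> 0"
        by (intro real_tendsto_divide_at_top[OF tendsto_const])
      then have "(\<lambda>n. real (2*J) * (BG / \<bar>a * (real n * \<delta>) - Re w\<bar> * \<delta>)) \<longlonglongrightarrow> real (2*J) * (0 * \<delta>)"
        by (intro tendsto_intros)
      then show ?thesis by simp
    qed
    have D1: "(\<lambda>n. D (int n) w) \<longlonglongrightarrow> 0"
      by (rule Lim_null_comparison[OF _ lim0[of 1]]) (use D_bound[of "int _"] in \<open>auto intro!: always_eventually\<close>)
    have D2: "(\<lambda>n. D (- int n) w) \<longlonglongrightarrow> 0"
      by (rule Lim_null_comparison[OF _ lim0[of "-1"]]) (use D_bound[of "- int _"] in \<open>auto intro!: always_eventually\<close>)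
    have "(\<lambda>n. 2 * pi * \<i> * G w - (D (int n) w - D (- int n) w)) \<longlonglongrightarrow> 2 * pi * \<i> * G w - (0 - 0)"
      by (intro tendsto_intros D1 D2)
    then have "(\<lambda>n. 2 * pi * \<i> * G w - (D (int n) w - D (- int n) w)) \<longlonglongrightarrow> 2 * pi * \<i> * G w" by simp
    then show ?thesis
    proof (rule Lim_transform_eventually)
      show "\<forall>\<^sub>F n in sequentially. 2 * pi * \<i> * G w - (D (int n) w - D (- int n) w) = T n w"
        unfolding eventually_sequentially
        by (intro exI[of _ "Suc (nat \<bar>i0\<bar>)"] allI impI) (use tele_val in \<open>simp add: algebra_simps\<close>)
    qed
  qed
  have Gh: "bounded_holomorphic (\<lambda>z. G (h z))"
  proof (rule bounded_holomorphic_comp_h)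
    show "G holomorphic_on \<Omega>" using holomorphic_on_subset[OF Ghol] subset_thickening[OF \<epsilon>] by (simp add: N_def)
    show "cmod (G w) \<le> BG" if "w \<in> \<Omega>" for w using GB[of w] subset_thickening[OF \<epsilon>, of \<Omega>] that by (auto simp: N_def)
  qed
  obtain k where k: "k holomorphic_on \<Omega>" "\<And>z. z \<in> unit_disc \<Longrightarrow> k (h z) = z"
    "\<And>w. w \<in> \<Omega> \<Longrightarrow> k w \<in> unit_disc \<and> h (k w) = w" using inverse_holomorphic by blast
  have "\<Lambda> (\<lambda>z. 2 * pi * \<i> * G (h z)) = 0"
  proof (rule \<Lambda>_eq_0_approx_sup[OF bounded_holomorphic_cmult[OF Gh]])
    fix e :: real assume e: "e > 0"
    have "\<forall>\<^sub>F n in sequentially. \<forall>w\<in>\<Omega>. dist (T n w) (\<Sum>k. col (int k) w + col (- int k - 1) w) < e"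
      using uniform_limitD[OF ul e] .
    then obtain n where n: "\<And>w. w \<in> \<Omega> \<Longrightarrow> dist (T n w) (\<Sum>k. col (int k) w + col (- int k - 1) w) < e"
      by (auto simp: eventually_sequentially)
    have est_off: "cmod (2 * pi * \<i> * G w - T n w) \<le> e" if w: "w \<in> \<Omega>" "off w" for w
    proof -
      have "(\<lambda>n. T n w) \<longlonglongrightarrow> (\<Sum>k. col (int k) w + col (- int k - 1) w)"
        by (rule tendsto_uniform_limitI[OF ul w(1)])
      then have "(\<Sum>k. col (int k) w + col (- int k - 1) w) = 2 * pi * \<i> * G w"
        using lim_off[OF w] LIMSEQ_unique by blast
      then show ?thesis using n[OF w(1)] by (simp add: dist_norm norm_minus_commute)
    qed
    have "cmod (2 * pi * \<i> * G (h z) - T n (h z)) \<le> e" if z: "z \<in> unit_disc" for z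
    proof -
      let ?E = "\<lambda>z. 2 * pi * \<i> * G (h z) - T n (h z)"
      \<comment> \<open>A diagonal shift leaves all lattice lines\<close>
      let ?w = "\<lambda>\<eta>::real. h z + of_real \<eta> * (1 + \<i>)"
      have "continuous_on unit_disc ?E"
        using T_zero[of n] Gh
        by (intro continuous_intros holomorphic_on_imp_continuous_on) (auto simp: bounded_holomorphic_def)
      then have cE: "isCont ?E z" using z by (simp add: continuous_on_eq_continuous_at)
      have ck: "isCont k (h z)"
        using holomorphic_on_imp_continuous_on[OF k(1)] open_Omega h_in[OF z] by (simp add: continuous_on_eq_continuous_at)
      have "(?w \<longlongrightarrow> h z + of_real 0 * (1 + \<i>)) (at_right 0)" by (intro tendsto_intros)
      then have wl: "(?w \<longlongrightarrow> h z) (at_right 0)" by simp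
      have "((\<lambda>\<eta>. k (?w \<eta>)) \<longlongrightarrow> k (h z)) (at_right 0)" by (rule isCont_tendsto_compose[OF ck wl])
      then have "((\<lambda>\<eta>. ?E (k (?w \<eta>))) \<longlongrightarrow> ?E z) (at_right 0)"
        using isCont_tendsto_compose[OF cE] k(2)[OF z] by simp
      then have "((\<lambda>\<eta>. cmod (?E (k (?w \<eta>)))) \<longlongrightarrow> cmod (?E z)) (at_right 0)" by (rule tendsto_norm)
      moreover have "\<forall>\<^sub>F \<eta> in at_right 0. ?w \<eta> \<in> \<Omega>"
        using topological_tendstoD[OF wl open_Omega h_in[OF z]] .
      then have "\<forall>\<^sub>F \<eta> in at_right 0. cmod (?E (k (?w \<eta>))) \<le> e"
        using off_lattice_right[OF \<delta>(1), of "Re (h z)"] off_lattice_right[OF \<delta>(1), of "Im (h z)"]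
      proof eventually_elim
        case (elim \<eta>)
        then have "off (?w \<eta>)" by (simp add: off_def)
        then show ?case using est_off[OF elim(1)] k(3)[OF elim(1)] by simp
      qed
      ultimately show ?thesis by (rule tendsto_upperbound) simp
    qed
    then show "\<exists>g. bounded_holomorphic g \<and> \<Lambda> g = 0 \<and> (\<forall>z\<in>unit_disc. cmod (2 * pi * \<i> * G (h z) - g z) \<le> e)"
      using T_zero[of n] by (intro exI[of _ "\<lambda>z. T n (h z)"]) auto
  qed
  then have "\<Lambda> (\<lambda>z. G (h z)) = 0" using \<Lambda>_cmult[OF Gh, of "2 * pi * \<i>"] by simp
  then show ?thesis by (simp add: G_def)
qed

end

section \<open>Density of the exponentials\<close>

context koenigs_functional
begin

text \<open>The weight \<open>u R = - \<i> R / (h - \<i> R)\<close> has modulus at most \<open>R / (R - b)\<close>, and \<open>u R 0\<close> tends to 1 as \<open>R\<close> tends to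
  infinity. So it tends to 1 in mean square, and \<open>F u\<^sup>2\<close> is annihilated for every large \<open>R\<close>.\<close>
lemma annihilates_beyond_domain:
  assumes \<epsilon>: "\<epsilon> > 0" and F: "F holomorphic_on thickening \<epsilon> \<Omega>"
    and FB: "\<And>w. w \<in> thickening \<epsilon> \<Omega> \<Longrightarrow> cmod (F w) \<le> B"
  shows "\<Lambda> (\<lambda>z. F (h z)) = 0"
proof -
  have sub: "\<Omega> \<subseteq> thickening \<epsilon> \<Omega>" by (rule subset_thickening[OF \<epsilon>])
  have FO: "F holomorphic_on \<Omega>" using F sub by (rule holomorphic_on_subset)
  have bhF: "bounded_holomorphic (\<lambda>z. F (h z))"
    by (rule bounded_holomorphic_comp_h[OF FO, of B]) (use FB sub in auto)
  have B0: "B \<ge> 0" using FB[of "h 0"] sub h_in[of 0] by (auto intro: order_trans[OF norm_ge_zero])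
  define u where "u = (\<lambda>R z. - \<i> * of_real R / (h z - \<i> * of_real R))"
  have main: "\<exists>g. bounded_holomorphic g \<and> \<Lambda> g = 0 \<and> (\<forall>z\<in>unit_disc. cmod (F (h z) - g z) \<le> 5 * B) \<and>
      (\<forall>r. 0 < r \<and> r < 1 \<longrightarrow> hardy_mean 2 (\<lambda>z. F (h z) - g z) r \<le> (3 * B)\<^sup>2 * (2 * pi * ((R / (R - b))\<^sup>2 + 1 - 2 * Re (u R 0))))"
    if R: "R > b + \<epsilon>" "R \<ge> 2 * b" for R
  proof -
    have R0: "R > 0" "R - b > 0" using R b_pos \<epsilon> by linarith+
    have dist: "R - b \<le> cmod (h z - \<i> * of_real R)" if "z \<in> unit_disc" for z
      using strip[OF h_in[OF that]] abs_Im_le_cmod[of "h z - \<i> * of_real R"] by simp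
    have nz: "h z - \<i> * of_real R \<noteq> 0" if "z \<in> unit_disc" for z using dist[OF that] R0 by auto
    have uhol: "u R holomorphic_on unit_disc"
      unfolding u_def by (intro holomorphic_intros hol_h) (use nz in auto)
    have ub: "cmod (u R z) \<le> R / (R - b)" if "z \<in> unit_disc" for z
    proof -
      have "cmod (u R z) = R / cmod (h z - \<i> * of_real R)" using R0 by (simp add: u_def norm_divide norm_mult)
      also have "\<dots> \<le> R / (R - b)" using dist[OF that] R0 by (intro divide_left_mono) (auto intro!: mult_pos_pos nz[OF that])
      finally show ?thesis .
    qed
    have "R / (R - b) \<le> 2" using R0 R by (simp add: field_simps)
    then have u2: "cmod (u R z) \<le> 2" if "z \<in> unit_disc" for z using ub[OF that] by linarith
    define g where "g = (\<lambda>z. F (h z) * (u R z * u R z))"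
    have ubh: "bounded_holomorphic (u R)" by (rule bounded_holomorphicI[OF uhol u2])
    have gbh: "bounded_holomorphic g"
      unfolding g_def by (intro bounded_holomorphic_mult bhF ubh)
    have "\<Lambda> g = 0"
    proof -
      have wbh: "bounded_holomorphic (\<lambda>z. F (h z) / (h z - \<i> * of_real R)\<^sup>2)"
      proof -
        have "bounded_holomorphic (\<lambda>z. F (h z) * (1 / (h z - \<i> * of_real R) * (1 / (h z - \<i> * of_real R))))"
          by (intro bounded_holomorphic_mult bhF bounded_holomorphic_resolvent[OF R0(2)])
             (use dist Omega in auto)
        then show ?thesis by (simp add: power2_eq_square)
      qed
      have geq: "g = (\<lambda>z. (- \<i> * of_real R)\<^sup>2 * (F (h z) / (h z - \<i> * of_real R)\<^sup>2))"
        by (simp add: g_def u_def fun_eq_iff power2_eq_square)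
      show ?thesis unfolding geq using \<Lambda>_cmult[OF wbh] Runge_weighted[OF \<epsilon> F FB R(1)] by simp
    qed
    moreover have diff: "F (h z) - g z = F (h z) * ((1 + u R z) * (1 - u R z))" for z
      by (simp add: g_def algebra_simps)
    have Fb: "cmod (F (h z)) \<le> B" if "z \<in> unit_disc" for z using FB sub h_in[OF that] by auto
    have u3: "cmod (1 + u R z) \<le> 3" if "z \<in> unit_disc" for z
      using norm_triangle_ineq[of 1 "u R z"] u2[OF that] by simp
    have "cmod (F (h z) - g z) \<le> 5 * B" if z: "z \<in> unit_disc" for z
    proof -
      have "cmod (g z) \<le> B * (2 * 2)" unfolding g_def norm_mult
        using Fb[OF z] u2[OF z] B0 by (intro mult_mono) auto
      then show ?thesis using norm_triangle_ineq4[of "F (h z)" "g z"] Fb[OF z] by simp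
    qed
    moreover have "hardy_mean 2 (\<lambda>z. F (h z) - g z) r \<le> (3 * B)\<^sup>2 * (2 * pi * ((R / (R - b))\<^sup>2 + 1 - 2 * Re (u R 0)))"
      if r: "0 < r" "r < 1" for r
    proof -
      have "hardy_mean 2 (\<lambda>z. F (h z) - g z) r \<le> (3 * B)\<^sup>2 * hardy_mean 2 (\<lambda>z. 1 - u R z) r"
      proof (rule hardy_mean_two_dominated[OF _ _ _ _ r])
        show "(\<lambda>z. F (h z) - g z) holomorphic_on unit_disc"
          by (intro bounded_holomorphic_imp_holomorphic bounded_holomorphic_diff bhF gbh)
        show "(\<lambda>z. 1 - u R z) holomorphic_on unit_disc" by (intro holomorphic_intros uhol)
        show "cmod (F (h z) - g z) \<le> 3 * B * cmod (1 - u R z)" if z: "z \<in> unit_disc" for z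
        proof -
          have "cmod (F (h z) - g z) = (cmod (F (h z)) * cmod (1 + u R z)) * cmod (1 - u R z)"
            unfolding diff by (simp add: norm_mult)
          also have "\<dots> \<le> (B * 3) * cmod (1 - u R z)"
            using Fb[OF z] u3[OF z] B0 by (intro mult_right_mono mult_mono) auto
          finally show ?thesis by (simp add: mult_ac)
        qed
      qed (use B0 in auto)
      also have "\<dots> \<le> (3 * B)\<^sup>2 * (2 * pi * ((R / (R - b))\<^sup>2 + 1 - 2 * Re (u R 0)))"
        by (intro mult_left_mono hardy_mean_two_one_minus uhol ub r) auto
      finally show ?thesis .
    qed
    ultimately show ?thesis using gbh by blast
  qed
  define X where "X = (\<lambda>R. (3 * B)\<^sup>2 * (2 * pi * ((R / (R - b))\<^sup>2 + 1 - 2 * Re (u R 0))))"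
  have Xlim: "(\<lambda>n. X (real n)) \<longlonglongrightarrow> (3 * B)\<^sup>2 * (2 * pi * ((1 / (1 - 0))\<^sup>2 + 1 - 2 * Re (- \<i> / (0 - \<i>))))"
  proof -
    have bl: "(\<lambda>n. b / real n) \<longlonglongrightarrow> 0" by (rule lim_const_over_n)
    have hl: "(\<lambda>n. h 0 / of_nat n) \<longlonglongrightarrow> 0" by (rule lim_const_over_n)
    have "(\<lambda>n. (3 * B)\<^sup>2 * (2 * pi * ((1 / (1 - b / real n))\<^sup>2 + 1 - 2 * Re (- \<i> / (h 0 / of_nat n - \<i>)))))
        \<longlonglongrightarrow> (3 * B)\<^sup>2 * (2 * pi * ((1 / (1 - 0))\<^sup>2 + 1 - 2 * Re (- \<i> / (0 - \<i>))))"
      by (intro tendsto_intros bl hl) auto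
    moreover have "\<forall>\<^sub>F n in sequentially. (3 * B)\<^sup>2 * (2 * pi * ((1 / (1 - b / real n))\<^sup>2 + 1 - 2 * Re (- \<i> / (h 0 / of_nat n - \<i>)))) = X (real n)"
      using eventually_gt_at_top[of 0]
    proof eventually_elim
      case (elim n)
      have "1 / (1 - b / real n) = real n / (real n - b)" using elim by (simp add: field_simps)
      moreover have "- \<i> / (h 0 / of_nat n - \<i>) = u (real n) 0"
      proof -
        have "h 0 / of_nat n - \<i> = (h 0 - \<i> * of_nat n) / of_nat n" using elim by (simp add: field_simps)
        then show ?thesis by (simp add: u_def)
      qed
      ultimately show ?case by (simp add: X_def)
    qed
    ultimately show ?thesis by (rule Lim_transform_eventually)
  qed
  then have Xlim0: "(\<lambda>n. X (real n)) \<longlonglongrightarrow> 0" by simp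
  show ?thesis
  proof (rule \<Lambda>_eq_0_approx_mean_square[OF bhF])
    fix \<delta> :: real assume "\<delta> > 0"
    have "\<forall>\<^sub>F n in sequentially. X (real n) < \<delta>" using order_tendstoD(2)[OF Xlim0 \<open>\<delta> > 0\<close>] .
    moreover have "\<forall>\<^sub>F n in sequentially. max (b + \<epsilon>) (2 * b) < real n"
      using filterlim_real_sequentially unfolding filterlim_at_top_dense by blast
    ultimately have "\<forall>\<^sub>F n in sequentially. X (real n) < \<delta> \<and> max (b + \<epsilon>) (2 * b) < real n"
      by (rule eventually_conj)
    then obtain n where n: "X (real n) < \<delta>" "real n > b + \<epsilon>" "real n \<ge> 2 * b"
      by (auto simp: eventually_sequentially)
    from main[OF n(2,3)] obtain g where g: "bounded_holomorphic g" "\<Lambda> g = 0" "\<forall>z\<in>unit_disc. cmod (F (h z) - g z) \<le> 5 * B"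
      "\<forall>r. 0 < r \<and> r < 1 \<longrightarrow> hardy_mean 2 (\<lambda>z. F (h z) - g z) r \<le> X (real n)" unfolding X_def by blast
    then show "\<exists>g. bounded_holomorphic g \<and> \<Lambda> g = 0 \<and> (\<forall>z\<in>unit_disc. cmod (F (h z) - g z) \<le> 5 * B) \<and>
      (\<forall>r. 0 < r \<and> r < 1 \<longrightarrow> hardy_mean 2 (\<lambda>z. F (h z) - g z) r \<le> \<delta>)"
      using n(1) by (intro exI[of _ g]) force
  qed
qed

text \<open>Such \<open>f\<close> is Lipschitz on the disc, so \<open>f \<circ> \<psi>\<close> is close to \<open>f\<close> in mean square if the self-map \<open>\<psi> = v \<circ> h\<close> is close to
  the identity; and \<open>f \<circ> v\<close> is bounded and holomorphic on a neighbourhood of \<open>\<Omega>\<close>.\<close>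
lemma annihilates_beyond_disc:
  assumes f: "f holomorphic_on ball 0 S" and S: "S > 1"
  shows "\<Lambda> f = 0"
proof -
  have sub: "cball 0 1 \<subseteq> ball (0::complex) S" using S by auto
  have fd: "f holomorphic_on unit_disc" by (rule holomorphic_on_subset[OF f]) (use S in auto)
  have "bounded (f ` cball 0 1)"
    by (intro compact_imp_bounded compact_continuous_image holomorphic_on_imp_continuous_on holomorphic_on_subset[OF f] sub) auto
  then obtain B where B: "\<And>z. z \<in> cball 0 1 \<Longrightarrow> cmod (f z) \<le> B" unfolding bounded_iff by blast
  have "bounded (deriv f ` cball 0 1)"
    by (intro compact_imp_bounded compact_continuous_image holomorphic_on_imp_continuous_on holomorphic_on_subset[OF holomorphic_deriv[OF f]] sub) auto
  then obtain K where K: "K > 0" "\<And>z. z \<in> cball 0 1 \<Longrightarrow> cmod (deriv f z) \<le> K" unfolding bounded_pos by auto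
  have lip: "cmod (f x - f y) \<le> K * cmod (x - y)" if "x \<in> unit_disc" "y \<in> unit_disc" for x y
  proof (rule field_differentiable_bound[of "cball 0 1" f "deriv f"])
    show "(f has_field_derivative deriv f z) (at z within cball 0 1)" if "z \<in> cball 0 1" for z
      using holomorphic_derivI[OF f open_ball, of z] that sub by (blast intro: has_field_derivative_at_within)
  qed (use K that in auto)
  have bhf: "bounded_holomorphic f" by (rule bounded_holomorphicI[OF fd, of B]) (use B in auto)
  show ?thesis
  proof (rule \<Lambda>_eq_0_approx_mean_square[OF bhf])
    fix \<delta> :: real assume \<delta>: "\<delta> > 0"
    define e where "e = \<delta> / (4 * pi * K\<^sup>2)"
    have e: "e > 0" using \<delta> K by (simp add: e_def)
    obtain \<epsilon> v where v: "\<epsilon> > 0" "v holomorphic_on thickening \<epsilon> \<Omega>" "v ` thickening \<epsilon> \<Omega> \<subseteq> unit_disc"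
      "v (h 0) = 0" "Re (deriv (v \<circ> h) 0) > 1 - e" using kernel_approximation[OF int_closure e] by metis
    define \<psi> where "\<psi> = v \<circ> h"
    have hsub: "h ` unit_disc \<subseteq> thickening \<epsilon> \<Omega>" using subset_thickening[OF v(1), of \<Omega>] Omega by auto
    have \<psi>: "\<psi> holomorphic_on unit_disc" "\<psi> ` unit_disc \<subseteq> unit_disc" "\<psi> 0 = 0"
      unfolding \<psi>_def using holomorphic_on_compose_gen[OF hol_h v(2) hsub] v(3,4) hsub by (auto simp: image_subset_iff)
    have fv: "(\<lambda>w. f (v w)) holomorphic_on thickening \<epsilon> \<Omega>"
      by (rule holomorphic_on_compose_gen[OF v(2) fd v(3), unfolded o_def])
    have fvB: "cmod (f (v w)) \<le> B" if "w \<in> thickening \<epsilon> \<Omega>" for w using B[of "v w"] v(3) that by (force simp: image_subset_iff)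
    have Lz: "\<Lambda> (\<lambda>z. f (\<psi> z)) = 0" unfolding \<psi>_def o_def by (rule annihilates_beyond_domain[OF v(1) fv fvB])
    have f\<psi>: "(\<lambda>z. f (\<psi> z)) holomorphic_on unit_disc"
      by (rule holomorphic_on_compose_gen[OF \<psi>(1) fd \<psi>(2), unfolded o_def])
    have \<psi>d: "\<psi> z \<in> unit_disc" if "z \<in> unit_disc" for z using \<psi>(2) that by (auto simp: image_subset_iff)
    have gb: "bounded_holomorphic (\<lambda>z. f (\<psi> z))"
    proof (rule bounded_holomorphicI[OF f\<psi>])
      show "cmod (f (\<psi> z)) \<le> B" if "z \<in> unit_disc" for z using B[of "\<psi> z"] \<psi>d[OF that] by auto
    qed
    have mean: "hardy_mean 2 (\<lambda>z. f z - f (\<psi> z)) r \<le> \<delta>" if r: "0 < r" "r < 1" for r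
    proof -
      have "hardy_mean 2 (\<lambda>z. f z - f (\<psi> z)) r \<le> K\<^sup>2 * hardy_mean 2 (\<lambda>z. z - \<psi> z) r"
      proof (rule hardy_mean_two_dominated[OF _ _ _ _ r])
        show "cmod (f z - f (\<psi> z)) \<le> K * cmod (z - \<psi> z)" if "z \<in> unit_disc" for z
          by (rule lip[OF that \<psi>d[OF that]])
      qed (use K fd f\<psi> \<psi> in \<open>auto intro!: holomorphic_intros\<close>)
      also have "\<dots> \<le> K\<^sup>2 * (4 * pi * (1 - Re (deriv \<psi> 0)))"
        by (intro mult_left_mono hardy_mean_two_minus_id \<psi> r) auto
      also have "\<dots> \<le> K\<^sup>2 * (4 * pi * e)" using v(5) by (intro mult_left_mono) (auto simp: \<psi>_def)
      also have "\<dots> = \<delta>" using K by (simp add: e_def)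
      finally show ?thesis .
    qed
    have "cmod (f z - f (\<psi> z)) \<le> 2 * B" if "z \<in> unit_disc" for z
      using norm_triangle_ineq4[of "f z" "f (\<psi> z)"] B[of z] B[of "\<psi> z"] \<psi>d[OF that] that by simp
    then show "\<exists>g. bounded_holomorphic g \<and> \<Lambda> g = 0 \<and> (\<forall>z\<in>unit_disc. cmod (f z - g z) \<le> 2 * B) \<and>
      (\<forall>r. 0 < r \<and> r < 1 \<longrightarrow> hardy_mean 2 (\<lambda>z. f z - g z) r \<le> \<delta>)"
      using gb Lz mean by (intro exI[of _ "\<lambda>z. f (\<psi> z)"]) blast
  qed
qed

lemma annihilates_bounded:
  assumes f: "bounded_holomorphic f"
  shows "\<Lambda> f = 0"
proof -
  obtain B where B: "B > 0" "\<And>z. z \<in> unit_disc \<Longrightarrow> cmod (f z) \<le> B" using bounded_holomorphicE[OF f] by blast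
  have fh: "f holomorphic_on unit_disc" by (rule bounded_holomorphic_imp_holomorphic[OF f])
  show ?thesis
  proof (rule \<Lambda>_eq_0_approx_mean_square[OF f])
    fix \<delta> :: real assume \<delta>: "\<delta> > 0"
    obtain \<rho> where \<rho>: "0 < \<rho>" "\<rho> < 1" "\<And>r. 0 < r \<Longrightarrow> r < 1 \<Longrightarrow> hardy_mean 2 (\<lambda>z. f z - f (of_real \<rho> * z)) r \<le> \<delta>"
    proof (rule dilation_approximation_mean_square[OF fh _ \<delta>])
      show "hardy_mean 2 f r \<le> 2 * pi * B powr 2" if "0 < r" "r < 1" for r
        by (rule hardy_mean_const_bound[OF fh _ that B(2)]) auto
    qed (use that in blast)
    let ?g = "\<lambda>z. f (of_real \<rho> * z)"
    have ins: "of_real \<rho> * z \<in> unit_disc" if "cmod z < 1 / \<rho>" for z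
      using that \<rho> by (simp add: norm_mult field_simps)
    have g: "?g holomorphic_on ball 0 (1 / \<rho>)"
      by (rule holomorphic_on_compose_gen[of _ _ f unit_disc, unfolded o_def])
         (use ins fh in \<open>auto intro!: holomorphic_intros\<close>)
    have r1: "1 / \<rho> > 1" using \<rho> by simp
    have gB: "cmod (?g z) \<le> B" if "z \<in> unit_disc" for z
      using B(2)[OF ins[of z]] that r1 by auto
    have gb: "bounded_holomorphic ?g"
      by (rule bounded_holomorphicI[OF holomorphic_on_subset[OF g] gB]) (use r1 in auto)
    have "cmod (f z - ?g z) \<le> 2 * B" if "z \<in> unit_disc" for z
      using norm_triangle_ineq4[of "f z" "?g z"] B(2)[OF that] gB[OF that] by simp
    then show "\<exists>g. bounded_holomorphic g \<and> \<Lambda> g = 0 \<and> (\<forall>z\<in>unit_disc. cmod (f z - g z) \<le> 2 * B) \<and>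
      (\<forall>r. 0 < r \<and> r < 1 \<longrightarrow> hardy_mean 2 (\<lambda>z. f z - g z) r \<le> \<delta>)"
      using gb annihilates_beyond_disc[OF g r1] \<rho>(3) by (intro exI[of _ ?g]) blast
  qed
qed

lemma annihilates_hardy_space:
  assumes f: "f \<in> hardy_space p"
  shows "L f = 0"
proof (rule L_eq_0_approx[OF f])
  fix \<delta> :: real assume \<delta>: "\<delta> > 0"
  have p0: "p > 0" using p_ge_1 by simp
  obtain g where g: "bounded_holomorphic g" "\<And>r. 0 < r \<Longrightarrow> r < 1 \<Longrightarrow> hardy_mean p (\<lambda>z. f z - g z) r \<le> \<delta>"
    using bounded_holomorphic_dense[OF f p_ge_1 \<delta>] by blast
  have fh: "f holomorphic_on unit_disc" and f0: "\<And>z. z \<notin> unit_disc \<Longrightarrow> f z = 0" using f by (auto simp: hardy_space_def)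
  have gr: "disc_restrict g \<in> hardy_space p" by (rule hardy_space_disc_restrict[OF g(1) p0])
  have mean: "hardy_mean p (f - disc_restrict g) r \<le> \<delta>" if r: "0 < r" "r < 1" for r
    using g(2)[OF r] hardy_mean_cong[of "f - disc_restrict g" "\<lambda>z. f z - g z" r p] r by (simp add: disc_restrict_def)
  have "(f - disc_restrict g) holomorphic_on unit_disc"
    by (rule holomorphic_transform[of "\<lambda>z. f z - g z"])
       (use fh bounded_holomorphic_imp_holomorphic[OF g(1)] in \<open>auto intro!: holomorphic_intros simp: disc_restrict_def\<close>)
  then have "f - disc_restrict g \<in> hardy_space p"
    using mean f0 unfolding hardy_space_def by (auto simp: disc_restrict_def intro!: bdd_aboveI2[of _ _ \<delta>])
  then show "\<exists>g. f - g \<in> hardy_space p \<and> g \<in> hardy_space p \<and> L g = 0 \<and> (\<forall>r. 0 < r \<and> r < 1 \<longrightarrow> hardy_mean p (f - g) r \<le> \<delta>)"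
    using gr annihilates_bounded[OF g(1)] mean by (intro exI[of _ "disc_restrict g"]) (auto simp: \<Lambda>_def)
qed

end

section \<open>The commutant\<close>

lemma hardy_mean_le_Sup:
  assumes "f \<in> hardy_space p" "0 < r" "r < 1"
  shows "hardy_mean p f r \<le> (SUP r\<in>{0<..<1}. hardy_mean p f r)"
  using assms by (intro cSUP_upper) (auto simp: hardy_space_def)

lemma point_evaluation_hardy_norm:
  assumes p: "p \<ge> 1" and z: "z \<in> unit_disc"
  shows "\<exists>C\<ge>0. \<forall>f\<in>hardy_space p. cmod (f z) \<le> C * hardy_norm p f"
proof -
  define s where "s = (1 + cmod z) / 2"
  have s: "0 < s" "s < 1" "cmod z < s" using z by (auto simp: s_def add_pos_nonneg)
  define C where "C = (2 * pi + 1) / (s - cmod z)"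
  have C: "C \<ge> 0" using s by (simp add: C_def)
  have "cmod (f z) \<le> C * hardy_norm p f" if f: "f \<in> hardy_space p" for f
  proof -
    define S where "S = (SUP r\<in>{0<..<1}. hardy_mean p f r)"
    have fh: "f holomorphic_on unit_disc" using f by (simp add: hardy_space_def)
    have le: "hardy_mean p f s \<le> S" unfolding S_def by (rule hardy_mean_le_Sup[OF f s(1,2)])
    then have S0: "S \<ge> 0" using hardy_mean_nonneg[of p f s] by linarith
    have bound: "cmod (f z) \<le> C * (S + e) powr (1 / p)" if "e > 0" for e
      unfolding C_def by (rule point_evaluation_bound[OF fh p s]) (use le S0 that in auto)
    have "((\<lambda>e. C * (S + e) powr (1 / p)) \<longlongrightarrow> C * (S + 0) powr (1 / p)) (at_right 0)"
      by (intro tendsto_mult tendsto_const tendsto_powr' tendsto_add tendsto_ident_at)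
         (use p S0 in \<open>auto simp: eventually_at_filter\<close>)
    moreover have "\<forall>\<^sub>F e in at_right 0. cmod (f z) \<le> C * (S + e) powr (1 / p)"
      using bound by (auto simp: eventually_at_filter)
    ultimately have "cmod (f z) \<le> C * (S + 0) powr (1 / p)" by (intro tendsto_lowerbound) auto
    then show ?thesis by (simp add: hardy_norm_def S_def)
  qed
  then show ?thesis using C by blast
qed

lemma bounded_operatorsD:
  assumes "A \<in> bounded_operators p"
  shows "f \<in> hardy_space p \<Longrightarrow> A f \<in> hardy_space p"
    and "f \<in> hardy_space p \<Longrightarrow> g \<in> hardy_space p \<Longrightarrow> A (\<lambda>z. f z + g z) = (\<lambda>z. A f z + A g z)"
    and "f \<in> hardy_space p \<Longrightarrow> A (\<lambda>z. c * f z) = (\<lambda>z. c * A f z)"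
    and "\<exists>C\<ge>0. \<forall>f\<in>hardy_space p. hardy_norm p (A f) \<le> C * hardy_norm p f"
proof -
  from assms have A: "A \<in> hardy_space p \<rightarrow>\<^sub>E hardy_space p"
    and add: "\<forall>f\<in>hardy_space p. \<forall>g\<in>hardy_space p. A (\<lambda>z. f z + g z) = (\<lambda>z. A f z + A g z)"
    and scale: "\<forall>c. \<forall>f\<in>hardy_space p. A (\<lambda>z. c * f z) = (\<lambda>z. c * A f z)"
    and bd: "\<exists>C. \<forall>f\<in>hardy_space p. hardy_norm p (A f) \<le> C * hardy_norm p f"
    unfolding bounded_operators_def by auto
  show "f \<in> hardy_space p \<Longrightarrow> A f \<in> hardy_space p" using A by (rule PiE_mem)
  show "f \<in> hardy_space p \<Longrightarrow> g \<in> hardy_space p \<Longrightarrow> A (\<lambda>z. f z + g z) = (\<lambda>z. A f z + A g z)" using add by blast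
  show "f \<in> hardy_space p \<Longrightarrow> A (\<lambda>z. c * f z) = (\<lambda>z. c * A f z)" using scale by blast
  obtain C where C: "\<And>f. f \<in> hardy_space p \<Longrightarrow> hardy_norm p (A f) \<le> C * hardy_norm p f" using bd by blast
  have "hardy_norm p (A f) \<le> \<bar>C\<bar> * hardy_norm p f" if "f \<in> hardy_space p" for f
    by (rule order_trans[OF C[OF that]]) (auto intro!: mult_right_mono simp: hardy_norm_def)
  then show "\<exists>C\<ge>0. \<forall>f\<in>hardy_space p. hardy_norm p (A f) \<le> C * hardy_norm p f" by (intro exI[of _ "\<bar>C\<bar>"]) auto
qed

text \<open>The points \<open>w + t\<close> accumulate at \<open>w\<close>.\<close>
lemma invariant_under_translations_constant:
  assumes F: "F holomorphic_on S" and S: "open S" "connected S" and w: "w \<in> S"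
    and inv: "\<And>t. t > 0 \<Longrightarrow> w + of_real t \<in> S \<and> F (w + of_real t) = F w" and x: "x \<in> S"
  shows "F x = F w"
proof -
  let ?U = "(\<lambda>t. w + of_real t) ` {0<..}"
  have "w islimpt ?U"
    unfolding islimpt_approachable
  proof (intro allI impI)
    fix e :: real assume "e > 0"
    then show "\<exists>x'\<in>?U. x' \<noteq> w \<and> dist x' w < e"
      by (intro bexI[OF _ imageI[of "e / 2"]]) (auto simp: dist_norm)
  qed
  moreover have "?U \<subseteq> S" using inv by auto
  moreover have "(\<lambda>x. F x - F w) holomorphic_on S" by (intro holomorphic_intros F)
  ultimately have "F x - F w = 0"
    by (intro analytic_continuation[of "\<lambda>x. F x - F w" S ?U w x]) (use S w x inv in auto)
  then show ?thesis by simp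
qed

theorem corollary3p5:
  fixes \<phi> :: "real \<Rightarrow> complex \<Rightarrow> complex"
    and h :: "complex \<Rightarrow> complex"
    and \<Omega> :: "complex set"
    and p :: real
  assumes "hyperbolic_semiflow \<phi>"
    and "koenigs_function \<phi> h"
    and "\<Omega> = h ` unit_disc"
    and "interior (closure \<Omega>) = \<Omega>"
    and "finite (components (- closure \<Omega>))"
    and "card (components (- closure \<Omega>)) \<le> 2"
    and "1 \<le> p"
  shows "(\<forall>A\<in>semigroup_commutant p \<phi>. \<forall>B\<in>semigroup_commutant p \<phi>.
            compose (hardy_space p) A B = compose (hardy_space p) B A) \<and>
         \<not> (\<exists>J\<in>semigroup_commutant p \<phi>. nontrivial_idempotent p J)"
proof -
  let ?H = "hardy_space p"
  have p0: "p > 0" using assms(7) by simp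
  obtain b where b: "b > 0" "\<And>z. z \<in> unit_disc \<Longrightarrow> \<bar>Im (h z)\<bar> < b"
    using Koenigs_domain_in_strip[OF assms(1,2)] by blast
  have hol: "h holomorphic_on unit_disc" "inj_on h unit_disc"
    and inv: "\<And>t z. t \<ge> 0 \<Longrightarrow> z \<in> unit_disc \<Longrightarrow> h z + of_real t \<in> h ` unit_disc"
    and \<phi>: "\<And>t z. t \<ge> 0 \<Longrightarrow> z \<in> unit_disc \<Longrightarrow> \<phi> t z = inv_into unit_disc h (h z + of_real t)"
    using assms(2) unfolding koenigs_function_def by auto
  interpret strip_domain h \<Omega> b
    by unfold_locales (use hol inv b assms(3) in auto)
  have \<phi>d: "\<phi> t z \<in> unit_disc" and h\<phi>: "h (\<phi> t z) = h z + of_real t" if "t \<ge> 0" "z \<in> unit_disc" for t z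
    using \<phi>[OF that] inv[OF that] inv_into_into[of "h z + of_real t" h unit_disc] f_inv_into_f[of "h z + of_real t" h unit_disc] by auto
  define e where "e = (\<lambda>y. disc_restrict (\<lambda>z. exp (\<i> * of_real y * h z)))"
  have eH: "e y \<in> ?H" for y unfolding e_def by (rule hardy_space_disc_restrict[OF bounded_holomorphic_exp p0])
  have e_in: "e y z = exp (\<i> * of_real y * h z)" if "z \<in> unit_disc" for y z using that by (simp add: e_def disc_restrict_def)
  have Hout: "f z = 0" if "f \<in> ?H" "z \<notin> unit_disc" for f z using that by (simp add: hardy_space_def)
  have Heq: "f = g" if "f \<in> ?H" "g \<in> ?H" "\<And>z. z \<in> unit_disc \<Longrightarrow> f z = g z" for f g
  proof
    fix z show "f z = g z" using that Hout[of f z] Hout[of g z] by (cases "z \<in> unit_disc") auto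
  qed
  \<comment> \<open>A continuous functional is determined by its values on the exponentials, and these depend
    continuously on the exponent\<close>
  have dense: "L f = 0" if add: "\<And>f g. f \<in> ?H \<Longrightarrow> g \<in> ?H \<Longrightarrow> L (\<lambda>z. f z + g z) = L f + L g"
    and scale: "\<And>c f. f \<in> ?H \<Longrightarrow> L (\<lambda>z. c * f z) = c * L f"
    and bound: "\<And>f. f \<in> ?H \<Longrightarrow> cmod (L f) \<le> C * hardy_norm p f"
    and zero: "\<And>y. L (e y) = 0" and f: "f \<in> ?H" for L C f
  proof -
    interpret hardy_functional p L C by unfold_locales (use assms(7) add scale bound in auto)
    interpret koenigs_functional h \<Omega> b p L C
      by unfold_locales (use zero assms(4-6) in \<open>auto simp: e_def \<Lambda>_def\<close>)
    show ?thesis by (rule annihilates_hardy_space[OF f])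
  qed
  have closed_zero: "L (e y) = 0" if add: "\<And>f g. f \<in> ?H \<Longrightarrow> g \<in> ?H \<Longrightarrow> L (\<lambda>z. f z + g z) = L f + L g"
    and scale: "\<And>c f. f \<in> ?H \<Longrightarrow> L (\<lambda>z. c * f z) = c * L f"
    and bound: "\<And>f. f \<in> ?H \<Longrightarrow> cmod (L f) \<le> C * hardy_norm p f"
    and near: "\<And>d. d > 0 \<Longrightarrow> \<exists>y'. \<bar>y - y'\<bar> < d \<and> L (e y') = 0" for L C y
  proof -
    interpret hardy_functional p L C by unfold_locales (use assms(7) add scale bound in auto)
    interpret strip_functional h \<Omega> b p L C by unfold_locales
    show ?thesis using exponential_zero_closed[of y] near by (simp add: e_def \<Lambda>_def)
  qed
  \<comment> \<open>Members of the commutant are diagonal on the exponentials\<close>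
  have comm_bd: "A \<in> bounded_operators p" if "A \<in> semigroup_commutant p \<phi>" for A
  proof -
    have "A \<in> commutant p (composition_operator p (\<phi> 1))"
      using that unfolding semigroup_commutant_def by (rule INT_D) simp
    then show ?thesis by (simp add: commutant_def)
  qed
  have eigen: "\<exists>c. A (e y) = (\<lambda>z. c * e y z)" if A: "A \<in> semigroup_commutant p \<phi>" for A y
  proof -
    note bA = bounded_operatorsD[OF comm_bd[OF A]]
    let ?g = "A (e y)"
    have gH: "?g \<in> ?H" by (rule bA(1)[OF eH])
    have gh: "?g holomorphic_on unit_disc" using gH by (simp add: hardy_space_def)
    have rel: "?g (\<phi> t z) = exp (\<i> * of_real y * of_real t) * ?g z" if t: "t > 0" and z: "z \<in> unit_disc" for t z
    proof -
      let ?T = "composition_operator p (\<phi> t)"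
      have "A \<in> commutant p ?T" using A t unfolding semigroup_commutant_def by blast
      then have "compose ?H A ?T (e y) = compose ?H ?T A (e y)" unfolding commutant_def by simp
      then have eq: "A (?T (e y)) = ?T ?g" using eH by (simp add: compose_def)
      have "?T (e y) = (\<lambda>z. exp (\<i> * of_real y * of_real t) * e y z)"
      proof
        fix x
        show "?T (e y) x = exp (\<i> * of_real y * of_real t) * e y x"
        proof (cases "x \<in> unit_disc")
          case True
          then have "?T (e y) x = exp (\<i> * of_real y * (h x + of_real t))"
            using eH e_in[OF \<phi>d[of t x]] h\<phi>[of t x] t by (simp add: composition_operator_def)
          then show ?thesis using e_in[OF True] by (simp add: exp_add[symmetric] algebra_simps)
        next
          case False
          then show ?thesis using eH Hout[OF eH False] by (simp add: composition_operator_def)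
        qed
      qed
      then have "?T ?g = (\<lambda>z. exp (\<i> * of_real y * of_real t) * ?g z)" using eq bA(3)[OF eH] by simp
      from fun_cong[OF this, of z] show ?thesis using gH z by (simp add: composition_operator_def)
    qed
    obtain k where k: "k holomorphic_on \<Omega>" "\<And>z. z \<in> unit_disc \<Longrightarrow> k (h z) = z"
      "\<And>w. w \<in> \<Omega> \<Longrightarrow> k w \<in> unit_disc \<and> h (k w) = w" using inverse_holomorphic by blast
    \<comment> \<open>The quotient of \<open>A (e y)\<close> by \<open>e y\<close>, moved to \<open>\<Omega>\<close>, where the flow is translation\<close>
    define F where "F = (\<lambda>w. ?g (k w) * exp (- (\<i> * of_real y * w)))"
    have Fh: "F holomorphic_on \<Omega>"
      unfolding F_def
      by (intro holomorphic_intros holomorphic_on_compose_gen[OF k(1) gh, unfolded o_def]) (use k(3) in auto)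
    have Finv: "w + of_real t \<in> \<Omega> \<and> F (w + of_real t) = F w" if w: "w \<in> \<Omega>" and t: "t > 0" for w t
    proof -
      have kw: "k w \<in> unit_disc" "h (k w) = w" using k(3)[OF w] by auto
      have w': "w + of_real t \<in> \<Omega>" using shift[OF w] t by simp
      have "k (w + of_real t) = \<phi> t (k w)" using k(2)[OF \<phi>d[of t "k w"]] h\<phi>[of t "k w"] kw t by simp
      then have "F (w + of_real t) = exp (\<i> * of_real y * of_real t) * ?g (k w) * exp (- (\<i> * of_real y * (w + of_real t)))"
        using rel[OF t kw(1)] by (simp add: F_def)
      also have "\<dots> = ?g (k w) * (exp (\<i> * of_real y * of_real t) * exp (- (\<i> * of_real y * (w + of_real t))))" by (simp add: mult_ac)
      also have "exp (\<i> * of_real y * of_real t) * exp (- (\<i> * of_real y * (w + of_real t))) = exp (- (\<i> * of_real y * w))"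
        by (simp add: exp_add[symmetric] algebra_simps)
      finally show ?thesis using w' by (simp add: F_def)
    qed
    have h0: "h 0 \<in> \<Omega>" using h_in[of 0] by simp
    have const: "F w = F (h 0)" if "w \<in> \<Omega>" for w
      by (rule invariant_under_translations_constant[OF Fh open_Omega connected_Omega h0 Finv[OF h0] that])
    show ?thesis
    proof (intro exI[of _ "F (h 0)"] Heq gH)
      show "(\<lambda>z. F (h 0) * e y z) \<in> ?H"
      proof -
        have "disc_restrict (\<lambda>z. F (h 0) * exp (\<i> * of_real y * h z)) \<in> ?H"
          by (rule hardy_space_disc_restrict[OF bounded_holomorphic_cmult[OF bounded_holomorphic_exp] p0])
        moreover have "disc_restrict (\<lambda>z. F (h 0) * exp (\<i> * of_real y * h z)) = (\<lambda>z. F (h 0) * e y z)"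
          by (auto simp: e_def disc_restrict_def)
        ultimately show ?thesis by simp
      qed
      fix z assume z: "z \<in> unit_disc"
      have "F (h 0) = F (h z)" using const[OF h_in[OF z]] by simp
      also have "\<dots> = ?g z * exp (- (\<i> * of_real y * h z))" using k(2)[OF z] by (simp add: F_def)
      finally show "?g z = F (h 0) * e y z" using e_in[OF z] by (simp add: exp_minus)
    qed
  qed
  have comm: "compose ?H A B = compose ?H B A" if A: "A \<in> semigroup_commutant p \<phi>" and B: "B \<in> semigroup_commutant p \<phi>" for A B
  proof -
    note bA = bounded_operatorsD[OF comm_bd[OF A]] and bB = bounded_operatorsD[OF comm_bd[OF B]]
    have "A (B f) = B (A f)" if f: "f \<in> ?H" for f
    proof (rule Heq)
      show "A (B f) \<in> ?H" "B (A f) \<in> ?H" using bA(1) bB(1) f by auto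
      fix z assume z: "z \<in> unit_disc"
      obtain Cz where Cz: "Cz \<ge> 0" "\<And>f. f \<in> ?H \<Longrightarrow> cmod (f z) \<le> Cz * hardy_norm p f"
        using point_evaluation_hardy_norm[OF assms(7) z] by blast
      obtain CA where CA: "CA \<ge> 0" "\<And>f. f \<in> ?H \<Longrightarrow> hardy_norm p (A f) \<le> CA * hardy_norm p f" using bA(4) by blast
      obtain CB where CB: "CB \<ge> 0" "\<And>f. f \<in> ?H \<Longrightarrow> hardy_norm p (B f) \<le> CB * hardy_norm p f" using bB(4) by blast
      define L where "L = (\<lambda>f. A (B f) z - B (A f) z)"
      have "L f = 0"
      proof (rule dense[OF _ _ _ _ f])
        show "L (\<lambda>z. f z + g z) = L f + L g" if "f \<in> ?H" "g \<in> ?H" for f g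
          unfolding L_def using that bA(1,2) bB(1,2) by simp
        show "L (\<lambda>z. c * f z) = c * L f" if "f \<in> ?H" for c f
          unfolding L_def using that bA(1,3) bB(1,3) by (simp add: algebra_simps)
        show "cmod (L f) \<le> (2 * (Cz * (CA * CB))) * hardy_norm p f" if g: "f \<in> ?H" for f
        proof -
          have "cmod (A (B f) z) \<le> Cz * (CA * (CB * hardy_norm p f))"
            by (rule order_trans[OF Cz(2)[OF bA(1)[OF bB(1)[OF g]]]], intro mult_left_mono Cz(1),
                rule order_trans[OF CA(2)[OF bB(1)[OF g]]], intro mult_left_mono CA(1) CB(2)[OF g])
          moreover have "cmod (B (A f) z) \<le> Cz * (CB * (CA * hardy_norm p f))"
            by (rule order_trans[OF Cz(2)[OF bB(1)[OF bA(1)[OF g]]]], intro mult_left_mono Cz(1),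
                rule order_trans[OF CB(2)[OF bA(1)[OF g]]], intro mult_left_mono CB(1) CA(2)[OF g])
          moreover have "cmod (L f) \<le> cmod (A (B f) z) + cmod (B (A f) z)" unfolding L_def by (rule norm_triangle_ineq4)
          ultimately show ?thesis by (simp add: algebra_simps)
        qed
        fix y
        obtain a where a: "A (e y) = (\<lambda>z. a * e y z)" using eigen[OF A] by blast
        obtain b' where b': "B (e y) = (\<lambda>z. b' * e y z)" using eigen[OF B] by blast
        show "L (e y) = 0" unfolding L_def using a b' bA(3)[OF eH] bB(3)[OF eH] by simp
      qed
      then show "A (B f) z = B (A f) z" by (simp add: L_def)
    qed
    then show ?thesis by (auto simp: compose_def restrict_def)
  qed
  have "\<not> nontrivial_idempotent p J" if J: "J \<in> semigroup_commutant p \<phi>" for J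
  proof
    assume "nontrivial_idempotent p J"
    then have JJ: "compose ?H J J = J" and nz: "J \<noteq> zero_operator p" and nid: "J \<noteq> id_operator p"
      by (auto simp: nontrivial_idempotent_def)
    note bJ = bounded_operatorsD[OF comm_bd[OF J]]
    have ext: "J \<in> extensional ?H" using comm_bd[OF J] by (auto simp: bounded_operators_def PiE_def)
    obtain c where c: "\<And>y. J (e y) = (\<lambda>z. c y * e y z)" using eigen[OF J] by metis
    have c01: "c y = 0 \<or> c y = 1" for y
    proof -
      have "J (J (e y)) = J (e y)" using fun_cong[OF JJ, of "e y"] eH by (simp add: compose_def)
      then have "c y * (c y * e y 0) = c y * e y 0" using c bJ(3)[OF eH] by metis
      moreover have "e y 0 \<noteq> 0" using e_in[of 0 y] by simp
      ultimately show ?thesis by simp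
    qed
    have e0: "e y 0 \<noteq> 0" for y using e_in[of 0 y] by simp
    obtain CJ where CJ: "CJ \<ge> 0" "\<And>f. f \<in> ?H \<Longrightarrow> hardy_norm p (J f) \<le> CJ * hardy_norm p f" using bJ(4) by blast
    have bound: "\<exists>C. \<forall>f\<in>?H. cmod (J f z) \<le> C * hardy_norm p f \<and> cmod (J f z - f z) \<le> C * hardy_norm p f" if z: "z \<in> unit_disc" for z
    proof -
      obtain Cz where Cz: "Cz \<ge> 0" "\<And>f. f \<in> ?H \<Longrightarrow> cmod (f z) \<le> Cz * hardy_norm p f"
        using point_evaluation_hardy_norm[OF assms(7) z] by blast
      have "cmod (J f z) \<le> (Cz * CJ + Cz) * hardy_norm p f \<and> cmod (J f z - f z) \<le> (Cz * CJ + Cz) * hardy_norm p f" if f: "f \<in> ?H" for f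
      proof -
        have n0: "hardy_norm p f \<ge> 0" by (simp add: hardy_norm_def)
        have 1: "cmod (J f z) \<le> Cz * (CJ * hardy_norm p f)"
          by (rule order_trans[OF Cz(2)[OF bJ(1)[OF f]]]) (intro mult_left_mono Cz(1) CJ(2)[OF f])
        have 2: "cmod (f z) \<le> Cz * hardy_norm p f" by (rule Cz(2)[OF f])
        have 3: "0 \<le> Cz * hardy_norm p f" using Cz(1) n0 by simp
        show ?thesis using 1 2 3 norm_triangle_ineq4[of "J f z" "f z"] by (simp add: algebra_simps)
      qed
      then show ?thesis by blast
    qed
    have lin: "J (\<lambda>x. f x + g x) z = J f z + J g z" "J (\<lambda>x. f x + g x) z - (f z + g z) = (J f z - f z) + (J g z - g z)"
      if "f \<in> ?H" "g \<in> ?H" for f g z using bJ(2)[OF that] by simp_all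
    have scal: "J (\<lambda>x. a * f x) z = a * J f z" "J (\<lambda>x. a * f x) z - a * f z = a * (J f z - f z)"
      if "f \<in> ?H" for f a z using bJ(3)[OF that] by (simp_all add: algebra_simps)
    \<comment> \<open>Both values of \<open>c\<close> are taken on closed sets, so the connectedness of the line leaves one of them\<close>
    have "closed {y. c y = 0}"
    proof (rule closure_subset_eq[THEN iffD1], rule subsetI)
      fix y assume "y \<in> closure {y. c y = 0}"
      then have near: "\<forall>d>0. \<exists>y'\<in>{y. c y = 0}. dist y' y < d" by (simp only: closure_approachable)
      obtain C where C: "\<And>f. f \<in> ?H \<Longrightarrow> cmod (J f 0) \<le> C * hardy_norm p f" using bound[of 0] by auto
      have "J (e y) 0 = 0"
      proof (rule closed_zero[of "\<lambda>f. J f 0", OF lin(1) scal(1) C])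
        show "\<exists>y'. \<bar>y - y'\<bar> < d \<and> J (e y') 0 = 0" if "d > 0" for d
          using near that c by (fastforce simp: dist_real_def abs_minus_commute)
      qed auto
      then show "y \<in> {y. c y = 0}" using c e0 by simp
    qed
    moreover have "closed {y. c y = 1}"
    proof (rule closure_subset_eq[THEN iffD1], rule subsetI)
      fix y assume "y \<in> closure {y. c y = 1}"
      then have near: "\<forall>d>0. \<exists>y'\<in>{y. c y = 1}. dist y' y < d" by (simp only: closure_approachable)
      obtain C where C: "\<And>f. f \<in> ?H \<Longrightarrow> cmod (J f 0 - f 0) \<le> C * hardy_norm p f" using bound[of 0] by auto
      have "J (e y) 0 - e y 0 = 0"
      proof (rule closed_zero[of "\<lambda>f. J f 0 - f 0", OF lin(2) scal(2) C])
        show "\<exists>y'. \<bar>y - y'\<bar> < d \<and> J (e y') 0 - e y' 0 = 0" if "d > 0" for d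
          using near that c by (fastforce simp: dist_real_def abs_minus_commute)
      qed auto
      then show "y \<in> {y. c y = 1}" using c e0 by simp
    qed
    moreover have "connected (UNIV :: real set)" by simp
    moreover have "UNIV \<subseteq> {y. c y = 0} \<union> {y. c y = 1}" "{y. c y = 0} \<inter> {y. c y = 1} \<inter> UNIV = {}" using c01 by auto
    ultimately have "{y. c y = 0} \<inter> UNIV = {} \<or> {y. c y = 1} \<inter> UNIV = {}"
      using connected_closed[THEN iffD1, of "UNIV :: real set"] by blast
    then consider "\<And>y. c y = 1" | "\<And>y. c y = 0" using c01 by auto
    then show False
    proof cases
      case 1
      have "J f = f" if f: "f \<in> ?H" for f
      proof (rule Heq[OF bJ(1)[OF f] f])
        fix z assume z: "z \<in> unit_disc"
        obtain C where C: "\<And>f. f \<in> ?H \<Longrightarrow> cmod (J f z - f z) \<le> C * hardy_norm p f" using bound[OF z] by auto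
        have "J f z - f z = 0"
          by (rule dense[of "\<lambda>f. J f z - f z", OF lin(2) scal(2) C _ f]) (use c 1 in auto)
        then show "J f z = f z" by simp
      qed
      then have "J = id_operator p" using ext unfolding id_operator_def by (auto simp: extensional_def restrict_def fun_eq_iff)
      then show False using nid by simp
    next
      case 2
      have zH: "(\<lambda>z. 0) \<in> ?H" using bJ(3)[OF eH, of 0] bounded_operatorsD(1)[OF comm_bd[OF J] eH]
        hardy_space_disc_restrict[OF bounded_holomorphic_const[of 0] p0] by (simp add: disc_restrict_def)
      have "J f = (\<lambda>z. 0)" if f: "f \<in> ?H" for f
      proof (rule Heq[OF bJ(1)[OF f] zH])
        fix z assume z: "z \<in> unit_disc"
        obtain C where C: "\<And>f. f \<in> ?H \<Longrightarrow> cmod (J f z) \<le> C * hardy_norm p f" using bound[OF z] by auto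
        show "J f z = 0"
          by (rule dense[of "\<lambda>f. J f z", OF lin(1) scal(1) C _ f]) (use c 2 in auto)
      qed
      then have "J = zero_operator p" using ext unfolding zero_operator_def by (auto simp: extensional_def restrict_def fun_eq_iff)
      then show False using nz by simp
    qed
  qed
  then show ?thesis using comm by blast
qed

end
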